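(* Let $d\ge 1$, let $\phi:\mathbb{R}^A\to\mathbb{R}$ be equivariant under constant shifts, monotone, invariant under lattice symmetries and twice continuously differentiable, let $g:\mathbb{R}^d\to\mathbb{R}$ be Lipschitz, and let $\beta,\gamma$ and the rescaled surfaces $f^{(\varepsilon)}:\mathbb{R}_{\ge 0}\times\mathbb{R}^d\to\mathbb{R}$ be as defined in the context. (1) Suppose that $\beta$ and $\gamma$ are both nonzero. Then $f^{(\varepsilon)}(t,x)$ converges pointwise on $\mathbb{R}_{\ge 0}\times\mathbb{R}^d$, as $\varepsilon\to 0$, to a function $f$ with $f(0,x)=g(x)$ for all $x$, and for $t>0$, $$f(t,x)=\frac{\beta}{\gamma}\log\int_{\mathbb{R}^d}K(t,x-y)\,e^{\gamma g(y)/\beta}\,dy,$$ where $K(t,x)=(4\pi\beta t)^{-d/2}e^{-|x|^2/4\beta t}$. The function $f$ is continuous on $\mathbb{R}_{\ge 0}\times\mathbb{R}^d$, is infinitely differentiable on $\mathbb{R}_{>0}\times\mathbb{R}^d$, and solves the deterministic KPZ equation $$\partial_t f=\beta\Delta f+\gamma|\nabla f|^2$$ (on $\mathbb{R}_{>0}\times\mathbb{R}^d$) with initial condition $f(0,x)=g(x)$. (2) Suppose that $\beta\neq 0$ and $\gamma=0$. Then $f^{(\varepsilon)}$ converges pointwise, as $\varepsilon\to 0$, to the function $f$ given by $f(0,x)=g(x)$ and $$f(t,x)=\int_{\mathbb{R}^d}K(t,x-y)g(y)\,dy\quad\text{for } t>0.$$ The function $f$ is continuous on $\mathbb{R}_{\ge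 0}\times\mathbb{R}^d$, is infinitely differentiable on $\mathbb{R}_{>0}\times\mathbb{R}^d$, and solves the heat equation $\partial_t f=\beta\Delta f$ with initial condition $f(0,x)=g(x)$. (3) If $\beta=0$, then $\gamma=0$, and in this case $f^{(\varepsilon)}(t,x)$ converges to $g(x)$ as $\varepsilon\to 0$ for every $t\in\mathbb{R}_{\ge0}$ and $x\in\mathbb{R}^d$.
   Context: Let $e_1,\dots,e_d$ be the standard basis of $\mathbb{R}^d$, $A=\{0,\pm e_1,\dots,\pm e_d\}\subset\mathbb{Z}^d$ and $B=A\setminus\{0\}$. The assumptions on $\phi:\mathbb{R}^A\to\mathbb{R}$ are as follows. Equivariance under constant shifts: $\phi(u+c)=\phi(u)+c$ for all $u\in\mathbb{R}^A$, $c\in\mathbb{R}$, where $u+c$ is obtained by adding $c$ to each coordinate of $u$. Monotonicity: if $u_a\ge v_a$ for all $a\in A$, then $\phi(u)\ge\phi(v)$. Invariance under lattice symmetries: $\phi(u)=\phi(v)$ whenever $v$ is obtained from $u$ by swapping $u_{e_i}$ with $u_{e_j}$ and $u_{-e_i}$ with $u_{-e_j}$ for some $i,j$, or by swapping $u_{e_i}$ with $u_{-e_i}$ for some $i$. Regularity: $\phi$ is twice continuously differentiable. For $a\in A$, $\partial_a\phi$ denotes the partial derivative of $\phi$ with respect to $u_a$. By the lattice symmetries the following do not depend on the choice of $b\in B$: $\beta:=\partial_b\phi(0)$ and $\gamma:=\partial_b^2\phi(0)-\partial_b\partial_{-b}\phi(0)$. For $\varepsilon>0$, define $g_\varepsilon:\mathbb{Z}^d\to\mathbb{R}$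 by $g_\varepsilon(x)=g(\varepsilon x)$, and $f_\varepsilon:\mathbb{Z}_{\ge0}\times\mathbb{Z}^d\to\mathbb{R}$ by $f_\varepsilon(0,x)=g_\varepsilon(x)$ and $f_\varepsilon(t+1,x)=\phi((f_\varepsilon(t,x+a))_{a\in A})$. For $t\in\mathbb{R}$, $[t]$ is the greatest integer $\le t$; for $x\in\mathbb{R}^d$, $[x]=([x_1],\dots,[x_d])$. For $t\in\mathbb{R}_{\ge0}$, $x\in\mathbb{R}^d$, put $t_\varepsilon=[\varepsilon^{-2}t]$, $x_\varepsilon=[\varepsilon^{-1}x]$, and $$f^{(\varepsilon)}(t,x)=f_\varepsilon(t_\varepsilon,x_\varepsilon)-t_\varepsilon\,\phi(0).$$ $|\cdot|$ is the Euclidean norm; $\nabla$ and $\Delta$ are taken in the $x$ variable. *)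

theory Defs
  imports "HOL-Analysis.Analysis"
begin

text \<open>The set \<open>A = {0, \<plusminus>e\<^sub>1, \<dots>, \<plusminus>e\<^sub>d}\<close> as a finite type, so that \<open>\<real>\<^sup>A\<close> is
  \<open>real ^ 'n stencil\<close> with \<open>d = CARD('n)\<close>.\<close>

typedef ('n::finite) stencil =
  "insert 0 (range (\<lambda>i. axis i 1) \<union> range (\<lambda>i. - axis i 1)) :: (int ^ 'n) set"
  by blast

instance stencil :: (finite) finite
proof
  have "finite (range (Rep_stencil :: 'a stencil \<Rightarrow> int ^ 'a))"
    by (simp add: type_definition.Rep_range[OF type_definition_stencil])
  then show "finite (UNIV :: 'a stencil set)"
    by (rule finite_imageD) (simp add: inj_on_def Rep_stencil_inject)
qed

text \<open>\<open>B = A - {0}\<close>\<close>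

definition nonzero_stencil :: "('n::finite) stencil set" where
  "nonzero_stencil = {a. Rep_stencil a \<noteq> 0}"

definition opposite :: "('n::finite) stencil \<Rightarrow> 'n stencil" where
  "opposite a = Abs_stencil (- Rep_stencil a)"

definition e_vec :: "'n::finite \<Rightarrow> 'n stencil" where
  "e_vec i = Abs_stencil (axis i 1)"

lemma Rep_opposite: "Rep_stencil (opposite a) = - Rep_stencil a"
proof -
  have "- Rep_stencil a \<in> insert 0 (range (\<lambda>i. axis i 1) \<union> range (\<lambda>i. - axis i 1))"
    using Rep_stencil[of a] by auto
  then show ?thesis by (simp add: opposite_def Abs_stencil_inverse)
qed

lemma Rep_e_vec: "Rep_stencil (e_vec i) = axis i 1"
  by (simp add: e_vec_def Abs_stencil_inverse)

definition shift_equivariant :: "(real ^ 'a::finite \<Rightarrow> real) \<Rightarrow> bool" where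
  "shift_equivariant \<phi> \<longleftrightarrow> (\<forall>u c. \<phi> (u + (\<chi> a. c)) = \<phi> u + c)"

definition swap_axes :: "'n::finite \<Rightarrow> 'n \<Rightarrow> real ^ 'n stencil \<Rightarrow> real ^ 'n stencil" where
  "swap_axes i j u =
     (\<chi> a. u $ Transposition.transpose (e_vec i) (e_vec j)
                (Transposition.transpose (opposite (e_vec i)) (opposite (e_vec j)) a))"

definition reflect_axis :: "'n::finite \<Rightarrow> real ^ 'n stencil \<Rightarrow> real ^ 'n stencil" where
  "reflect_axis i u = (\<chi> a. u $ Transposition.transpose (e_vec i) (opposite (e_vec i)) a)"

definition lattice_symmetric :: "(real ^ ('n::finite) stencil \<Rightarrow> real) \<Rightarrow> bool" where
  "lattice_symmetric \<phi> \<longleftrightarrow>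
     (\<forall>i j u. \<phi> (swap_axes i j u) = \<phi> u) \<and> (\<forall>i u. \<phi> (reflect_axis i u) = \<phi> u)"

definition partial_deriv :: "'a \<Rightarrow> ('a::real_normed_vector \<Rightarrow> real) \<Rightarrow> 'a \<Rightarrow> real" where
  "partial_deriv v f x = deriv (\<lambda>s. f (x + s *\<^sub>R v)) 0"

text \<open>\<open>C_k k f S\<close>: \<open>f\<close> is \<open>k\<close> times continuously differentiable on \<open>S\<close>. It is meant for open
  \<open>S\<close> only. Differentiability is required along with the partial derivatives, since
  \<open>deriv\<close> is unspecified at points of non-differentiability.\<close>

primrec C_k :: "nat \<Rightarrow> ('a::euclidean_space \<Rightarrow> real) \<Rightarrow> 'a set \<Rightarrow> bool" where
  "C_k 0 f S \<longleftrightarrow> continuous_on S f"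
| "C_k (Suc k) f S \<longleftrightarrow>
     (\<forall>x\<in>S. f differentiable (at x)) \<and> (\<forall>v\<in>Basis. C_k k (partial_deriv v f) S)"

definition C_infinity :: "('a::euclidean_space \<Rightarrow> real) \<Rightarrow> 'a set \<Rightarrow> bool" where
  "C_infinity f S \<longleftrightarrow> (\<forall>k. C_k k f S)"

definition grad :: "(real ^ 'n::finite \<Rightarrow> real) \<Rightarrow> real ^ 'n \<Rightarrow> real ^ 'n" where
  "grad f x = (\<chi> i. partial_deriv (axis i 1) f x)"

definition laplacian :: "(real ^ 'n::finite \<Rightarrow> real) \<Rightarrow> real ^ 'n \<Rightarrow> real" where
  "laplacian f x = (\<Sum>i\<in>UNIV. partial_deriv (axis i 1) (partial_deriv (axis i 1) f) x)"

text \<open>\<open>\<beta>\<close> and \<open>\<gamma>\<close>, computed in a direction \<open>b\<close> in \<open>nonzero_stencil\<close>. For a lattice symmetric \<open>\<phi>\<close> the values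
  do not depend on \<open>b\<close>.\<close>

definition beta :: "(real ^ ('n::finite) stencil \<Rightarrow> real) \<Rightarrow> 'n stencil \<Rightarrow> real" where
  "beta \<phi> b = partial_deriv (axis b 1) \<phi> 0"

definition gamma :: "(real ^ ('n::finite) stencil \<Rightarrow> real) \<Rightarrow> 'n stencil \<Rightarrow> real" where
  "gamma \<phi> b =
     partial_deriv (axis b 1) (partial_deriv (axis b 1) \<phi>) 0
     - partial_deriv (axis b 1) (partial_deriv (axis (opposite b) 1) \<phi>) 0"

definition real_vec :: "int ^ 'n::finite \<Rightarrow> real ^ 'n" where
  "real_vec x = (\<chi> i. real_of_int (x $ i))"

definition floor_vec :: "real ^ 'n::finite \<Rightarrow> int ^ 'n" where
  "floor_vec x = (\<chi> i. \<lfloor>x $ i\<rfloor>)"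

primrec surface ::
  "(real ^ ('n::finite) stencil \<Rightarrow> real) \<Rightarrow> (real ^ 'n \<Rightarrow> real) \<Rightarrow> real \<Rightarrow> nat \<Rightarrow> int ^ 'n \<Rightarrow> real"
where
  "surface \<phi> g \<epsilon> 0 x = g (\<epsilon> *\<^sub>R real_vec x)"
| "surface \<phi> g \<epsilon> (Suc t) x = \<phi> (\<chi> a. surface \<phi> g \<epsilon> t (x + Rep_stencil a))"

definition rescaled_surface ::
  "(real ^ ('n::finite) stencil \<Rightarrow> real) \<Rightarrow> (real ^ 'n \<Rightarrow> real) \<Rightarrow> real \<Rightarrow> real \<Rightarrow> real ^ 'n \<Rightarrow> real"
where
  "rescaled_surface \<phi> g \<epsilon> t x =
     (let t\<^sub>\<epsilon> = nat \<lfloor>t / \<epsilon>\<^sup>2\<rfloor>; x\<^sub>\<epsilon> = floor_vec (x /\<^sub>R \<epsilon>)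
      in surface \<phi> g \<epsilon> t\<^sub>\<epsilon> x\<^sub>\<epsilon> - real t\<^sub>\<epsilon> * \<phi> 0)"

definition heat_kernel :: "real \<Rightarrow> real \<Rightarrow> real ^ 'n::finite \<Rightarrow> real" where
  "heat_kernel \<beta> t x =
     (4 * pi * \<beta> * t) powr (- real CARD('n) / 2) * exp (- (norm x)\<^sup>2 / (4 * \<beta> * t))"

end

theory Submission
  imports Defs "HOL-Probability.Distributions"
begin

text \<open>The scheme is monotone and commutes with constant shifts, so one step does not increase the sup distance
  of two surfaces. A second-order expansion of \<open>\<phi>\<close> at the origin, whose Hessian on antisymmetric vectors is
  diagonal by the reflection symmetries, shows that a function with uniformly bounded derivatives solving
  \<open>\<partial>\<^sub>t h = \<beta> \<Delta> h + \<gamma> |\<nabla> h|\<^sup>2\<close> satisfies the recursion up to \<open>o(\<epsilon>\<^sup>2)\<close> per step. The Cole-Hopf formula gives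
  such a solution, regular uniformly away from time \<open>0\<close> because \<open>exp (\<gamma> g / \<beta>)\<close> varies at most exponentially; starting
  it at time \<open>\<delta>\<close> instead of \<open>0\<close> costs an initial error \<open>O(\<surd>\<delta>)\<close>. If \<open>\<beta> = 0\<close>, the partial derivatives \<open>\<partial>\<^sub>b \<phi> \<ge> 0\<close> are minimal at the
  origin, so that \<open>\<gamma> = 0\<close>, and a mollification of \<open>g\<close> is an approximate fixed point.\<close>

section \<open>The stencil and the derivatives of \<open>\<phi>\<close> at the origin\<close>

text \<open>The comparison is in the sup norm, so every local estimate must hold uniformly over the
  whole lattice, while \<open>g\<close> and the Cole-Hopf datum
  \<open>G = exp (\<gamma> g / \<beta>)\<close> may be unbounded. Two devices restore uniformity.
  The derivatives of the heat kernel have integral zero, so \<open>g\<close> may be replaced by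
  \<open>g - g x\<close> under the integral, which the Lipschitz constant alone controls. In the
  Cole-Hopf case the value \<open>G x\<close> bounds the heat convolution \<open>U\<close> of
  \<open>G\<close> from below and the derivatives of \<open>U\<close> from above, up to constants
  independent of \<open>x\<close>, and the derivatives of \<open>ln U\<close> only involve ratios of
  these. Both sets of bounds are available only away from time 0, because \<open>g\<close> is merely
  Lipschitz; hence the delayed start. Since \<open>\<phi>\<close> is only C^2, the local error is an
  arbitrarily small multiple of \<open>\<epsilon>\<^sup>2\<close> rather than a cubic term, which is
  enough for about \<open>t / \<epsilon>\<^sup>2\<close> steps. An expansion of
  \<open>\<phi>\<close> at the origin suffices, because shift equivariance removes the central
  height and leaves only small differences of neighbouring heights.\<close>

definition center :: "('n::finite) stencil" where
  "center = Abs_stencil 0"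

lemma Rep_center: "Rep_stencil center = 0"
  by (simp add: center_def Abs_stencil_inverse)

lemma stencil_cases:
  obtains "a = center" | i where "a = e_vec i" | i where "a = opposite (e_vec i)"
proof -
  have "Rep_stencil a \<in> insert 0 (range (\<lambda>i. axis i 1) \<union> range (\<lambda>i. - axis i 1))"
    by (rule Rep_stencil)
  then show ?thesis
    using that
    by (auto simp: Rep_stencil_inject[symmetric] Rep_center Rep_e_vec Rep_opposite)
qed

lemma stencil_distinct [simp]:
  fixes i j :: "'n::finite" and a :: "'n stencil"
  shows "e_vec i \<noteq> center" "center \<noteq> e_vec i"
  "opposite (e_vec i) \<noteq> center" "center \<noteq> opposite (e_vec i)"
  "opposite (e_vec i) \<noteq> e_vec j" "e_vec j \<noteq> opposite (e_vec i)"
  "e_vec i = e_vec j \<longleftrightarrow> i = j" "opposite (e_vec i) = opposite (e_vec j) \<longleftrightarrow> i = j"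
  "opposite (opposite a) = a"
proof -
  have "(- axis i 1 :: int ^ 'n) \<noteq> axis j 1" for i j :: 'n
  proof
    assume "(- axis i 1 :: int ^ 'n) = axis j 1"
    then have "(- axis i 1 :: int ^ 'n) $ j = axis j 1 $ j" by (rule arg_cong)
    then show False by (simp add: axis_def split: if_splits)
  qed
  note neq = this this[symmetric]
  show "e_vec i \<noteq> center" "center \<noteq> e_vec i"
    "opposite (e_vec i) \<noteq> center" "center \<noteq> opposite (e_vec i)"
    "opposite (e_vec i) \<noteq> e_vec j" "e_vec j \<noteq> opposite (e_vec i)"
    "e_vec i = e_vec j \<longleftrightarrow> i = j" "opposite (e_vec i) = opposite (e_vec j) \<longleftrightarrow> i = j"
    "opposite (opposite a) = a"
    using neq by (simp_all add: Rep_stencil_inject[symmetric] Rep_center Rep_e_vec Rep_opposite axis_eq_axis)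
qed

lemma sum_stencil:
  fixes F :: "('n::finite) stencil \<Rightarrow> real"
  shows "sum F UNIV = F center + (\<Sum>i\<in>UNIV. F (e_vec i) + F (opposite (e_vec i)))"
proof -
  have "(UNIV :: 'n stencil set) = insert center (range e_vec \<union> range (\<lambda>i. opposite (e_vec i)))"
  proof (rule UNIV_eq_I)
    show "a \<in> insert center (range e_vec \<union> range (\<lambda>i. opposite (e_vec i)))" for a :: "'n stencil"
      by (cases a rule: stencil_cases) auto
  qed
  then have "sum F UNIV = sum F (insert center (range e_vec \<union> range (\<lambda>i. opposite (e_vec i))))"
    by simp
  also have "\<dots> = F center + sum F (range e_vec \<union> range (\<lambda>i. opposite (e_vec i)))"
    by (subst sum.insert) auto
  also have "sum F (range e_vec \<union> range (\<lambda>i. opposite (e_vec i))) =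
      sum F (range e_vec) + sum F (range (\<lambda>i. opposite (e_vec i)))"
    by (subst sum.union_disjoint) auto
  also have "sum F (range e_vec) = (\<Sum>i\<in>UNIV. F (e_vec i))"
    by (subst sum.reindex) (auto simp: inj_on_def)
  also have "sum F (range (\<lambda>i. opposite (e_vec i))) = (\<Sum>i\<in>UNIV. F (opposite (e_vec i)))"
    by (subst sum.reindex) (auto simp: inj_on_def)
  finally show ?thesis by (simp add: sum.distrib)
qed

lemma sum_Basis_vec:
  fixes F :: "real ^ 'a::finite \<Rightarrow> real"
  shows "sum F Basis = (\<Sum>a\<in>UNIV. F (axis a 1))"
proof -
  have "(Basis :: (real ^ 'a) set) = range (\<lambda>a. axis a 1)"
    by (auto simp: Basis_vec_def)
  then have "sum F Basis = sum F (range (\<lambda>a. axis a 1))" by simp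
  also have "\<dots> = (\<Sum>a\<in>UNIV. F (axis a 1))"
    by (subst sum.reindex) (auto simp: inj_on_def axis_eq_axis)
  finally show ?thesis .
qed

section \<open>Derivatives at the origin under the lattice symmetries\<close>

lemma partial_deriv_linear_invariant:
  assumes "linear P" and "\<And>u. f (P u) = f u"
  shows "partial_deriv (P v) f (P x) = partial_deriv v f x"
proof -
  have "(\<lambda>s. f (P x + s *\<^sub>R P v)) = (\<lambda>s. f (x + s *\<^sub>R v))"
    using assms(2) by (metis linear_add[OF assms(1)] linear_scale[OF assms(1)])
  then show ?thesis by (simp add: partial_deriv_def)
qed

text \<open>\<open>P\<close> maps the line through \<open>x\<close> in direction \<open>v\<close>
  onto the line through \<open>P x\<close> in direction \<open>P v\<close>, and by the first-order
  lemma the inner derivatives in directions \<open>w\<close> and \<open>P w\<close> agree along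
  these two lines. At \<open>x = 0\<close>, a fixed point of \<open>P\<close>, this relates Hessian
  entries at the origin.\<close>

lemma partial_deriv2_linear_invariant:
  assumes "linear P" and "\<And>u. f (P u) = f u"
  shows "partial_deriv (P v) (partial_deriv (P w) f) (P x) = partial_deriv v (partial_deriv w f) x"
proof -
  have "(\<lambda>s. partial_deriv (P w) f (P x + s *\<^sub>R P v)) = (\<lambda>s. partial_deriv w f (x + s *\<^sub>R v))"
    using partial_deriv_linear_invariant[of P f, OF assms(1)] assms(2)
    by (metis linear_add[OF assms(1)] linear_scale[OF assms(1)])
  then show ?thesis unfolding partial_deriv_def[of "P v"] partial_deriv_def[of v] by simp
qed

lemma linear_swap_axes: "linear (swap_axes i j)"
  by (rule linearI) (simp_all add: swap_axes_def vec_eq_iff)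

lemma linear_reflect_axis: "linear (reflect_axis i)"
  by (rule linearI) (simp_all add: reflect_axis_def vec_eq_iff)

lemma swap_axes_axis:
  "swap_axes i j (axis (e_vec i) 1) = axis (e_vec j) 1"
  "swap_axes i j (axis (opposite (e_vec i)) 1) = axis (opposite (e_vec j)) 1"
  by (auto simp: swap_axes_def axis_def vec_eq_iff Transposition.transpose_def)

lemma reflect_axis_axis:
  "reflect_axis i (axis (e_vec i) 1) = axis (opposite (e_vec i)) 1"
  "reflect_axis i (axis (opposite (e_vec i)) 1) = axis (e_vec i) 1"
  "i \<noteq> j \<Longrightarrow> reflect_axis i (axis (e_vec j) 1) = axis (e_vec j) 1"
  "i \<noteq> j \<Longrightarrow> reflect_axis i (axis (opposite (e_vec j)) 1) = axis (opposite (e_vec j)) 1"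
  by (auto simp: reflect_axis_def axis_def vec_eq_iff Transposition.transpose_def)

abbreviation gradient0 :: "(real ^ 'a::finite \<Rightarrow> real) \<Rightarrow> 'a \<Rightarrow> real" where
  "gradient0 \<phi> a \<equiv> partial_deriv (axis a 1) \<phi> 0"

abbreviation hessian0 :: "(real ^ 'a::finite \<Rightarrow> real) \<Rightarrow> 'a \<Rightarrow> 'a \<Rightarrow> real" where
  "hessian0 \<phi> a b \<equiv> partial_deriv (axis a 1) (partial_deriv (axis b 1) \<phi>) 0"

context
  fixes \<phi> :: "real ^ ('n::finite) stencil \<Rightarrow> real"
  assumes sym: "lattice_symmetric \<phi>"
begin

lemma gradient0_reflect: "gradient0 \<phi> (opposite (e_vec i)) = gradient0 \<phi> (e_vec i)"
  using partial_deriv_linear_invariant[OF linear_reflect_axis[of i], of \<phi> "axis (e_vec i) 1" 0] sym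
  by (simp add: lattice_symmetric_def reflect_axis_axis linear_0[OF linear_reflect_axis])

lemma gradient0_swap: "gradient0 \<phi> (e_vec i) = gradient0 \<phi> (e_vec j)"
  using partial_deriv_linear_invariant[OF linear_swap_axes[of i j], of \<phi> "axis (e_vec i) 1" 0] sym
  by (simp add: lattice_symmetric_def swap_axes_axis linear_0[OF linear_swap_axes])

lemma gradient0_eq_beta:
  assumes "b \<in> nonzero_stencil"
  shows "gradient0 \<phi> (e_vec i) = beta \<phi> b" "gradient0 \<phi> (opposite (e_vec i)) = beta \<phi> b"
proof -
  have "gradient0 \<phi> (e_vec i) = beta \<phi> b"
    using assms
    by (cases b rule: stencil_cases)
      (auto simp: beta_def nonzero_stencil_def Rep_center gradient0_reflect intro: gradient0_swap)
  then show "gradient0 \<phi> (e_vec i) = beta \<phi> b" "gradient0 \<phi> (opposite (e_vec i)) = beta \<phi> b"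
    by (simp_all add: gradient0_reflect)
qed

lemma hessian0_reflect:
  "partial_deriv (reflect_axis i v) (partial_deriv (reflect_axis i w) \<phi>) 0 = partial_deriv v (partial_deriv w \<phi>) 0"
  using partial_deriv2_linear_invariant[OF linear_reflect_axis[of i], of \<phi> v w 0] sym
  by (simp add: lattice_symmetric_def linear_0[OF linear_reflect_axis])

lemma hessian0_swap:
  "partial_deriv (swap_axes i j v) (partial_deriv (swap_axes i j w) \<phi>) 0 = partial_deriv v (partial_deriv w \<phi>) 0"
  using partial_deriv2_linear_invariant[OF linear_swap_axes[of i j], of \<phi> v w 0] sym
  by (simp add: lattice_symmetric_def linear_0[OF linear_swap_axes])

text \<open>Reflecting axis \<open>i\<close> exchanges its two neighbours in both slots at once. The
  equality of the two mixed entries comes from this reflection too.\<close>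

lemma hessian0_same_axis:
  "hessian0 \<phi> (opposite (e_vec i)) (opposite (e_vec i)) = hessian0 \<phi> (e_vec i) (e_vec i)"
  "hessian0 \<phi> (opposite (e_vec i)) (e_vec i) = hessian0 \<phi> (e_vec i) (opposite (e_vec i))"
  using hessian0_reflect[of i "axis (e_vec i) 1" "axis (e_vec i) 1"]
    hessian0_reflect[of i "axis (e_vec i) 1" "axis (opposite (e_vec i)) 1"]
  by (simp_all add: reflect_axis_axis)

text \<open>Reflecting axis \<open>j\<close> fixes both neighbours on axis \<open>i\<close> and
  exchanges those on axis \<open>j\<close>, so these entries do not see the sign of the inner
  direction.\<close>

lemma hessian0_other_axis:
  assumes "i \<noteq> j"
  shows "hessian0 \<phi> (e_vec i) (opposite (e_vec j)) = hessian0 \<phi> (e_vec i) (e_vec j)"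
    and "hessian0 \<phi> (opposite (e_vec i)) (opposite (e_vec j)) = hessian0 \<phi> (opposite (e_vec i)) (e_vec j)"
  using hessian0_reflect[of j "axis (e_vec i) 1" "axis (e_vec j) 1"]
    hessian0_reflect[of j "axis (opposite (e_vec i)) 1" "axis (e_vec j) 1"] assms
  by (simp_all add: reflect_axis_axis)

lemma gamma_eq_hessian0:
  assumes "b \<in> nonzero_stencil"
  shows "hessian0 \<phi> (e_vec i) (e_vec i) - hessian0 \<phi> (e_vec i) (opposite (e_vec i)) = gamma \<phi> b"
proof -
  have swap: "hessian0 \<phi> (e_vec i) (e_vec i) = hessian0 \<phi> (e_vec j) (e_vec j)"
    "hessian0 \<phi> (e_vec i) (opposite (e_vec i)) = hessian0 \<phi> (e_vec j) (opposite (e_vec j))" for j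
    using hessian0_swap[of i j "axis (e_vec i) 1" "axis (e_vec i) 1"]
      hessian0_swap[of i j "axis (e_vec i) 1" "axis (opposite (e_vec i)) 1"]
    by (simp_all add: swap_axes_axis)
  show ?thesis
  proof (cases b rule: stencil_cases)
    case 1
    then show ?thesis using assms by (simp add: nonzero_stencil_def Rep_center)
  next
    case (2 j)
    then show ?thesis using swap[of j] by (simp add: gamma_def)
  next
    case (3 j)
    then show ?thesis using swap[of j] hessian0_same_axis[of j] by (simp add: gamma_def)
  qed
qed

text \<open>To first order in the mesh the increments around a lattice point are antisymmetric, so
  this is the part of the quadratic form that survives in the limit. Different axes cancel by
  reflection, and each single axis contributes \<open>2 * gamma \<phi> b\<close>.\<close>

lemma hessian0_antisymmetric_form:
  fixes w :: "'n stencil \<Rightarrow> real"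
  assumes "b \<in> nonzero_stencil"
    and w: "w center = 0" "\<And>i. w (e_vec i) = c i" "\<And>i. w (opposite (e_vec i)) = - c i"
  shows "(\<Sum>a\<in>UNIV. \<Sum>a'\<in>UNIV. hessian0 \<phi> a' a * (w a * w a')) = 2 * gamma \<phi> b * (\<Sum>i\<in>UNIV. (c i)\<^sup>2)"
proof -
  \<comment> \<open>\<open>T i j\<close> is the coefficient of \<open>c i * c j\<close> after
    collecting the four sign choices on the axes \<open>i\<close> and \<open>j\<close>.\<close>
  define T where "T i j = hessian0 \<phi> (e_vec j) (e_vec i) - hessian0 \<phi> (e_vec j) (opposite (e_vec i))
     - hessian0 \<phi> (opposite (e_vec j)) (e_vec i) + hessian0 \<phi> (opposite (e_vec j)) (opposite (e_vec i))" for i j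
  have T: "T i j = (if i = j then 2 * gamma \<phi> b else 0)" for i j
    using hessian0_other_axis[of j i] hessian0_same_axis[of i] gamma_eq_hessian0[OF assms(1), of i]
    by (auto simp: T_def)
  have "(\<Sum>a\<in>UNIV. \<Sum>a'\<in>UNIV. hessian0 \<phi> a' a * (w a * w a')) =
    (\<Sum>i\<in>UNIV. \<Sum>j\<in>UNIV. T i j * (c i * c j))"
    unfolding sum_stencil w T_def
    by (simp add: w sum.distrib[symmetric] algebra_simps)
  also have "\<dots> = (\<Sum>i\<in>UNIV. \<Sum>j\<in>UNIV. if i = j then 2 * gamma \<phi> b * (c i)\<^sup>2 else 0)"
    by (intro sum.cong refl) (simp add: T power2_eq_square)
  also have "\<dots> = 2 * gamma \<phi> b * (\<Sum>i\<in>UNIV. (c i)\<^sup>2)"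
    by (simp add: sum_distrib_left)
  finally show ?thesis .
qed

end

section \<open>Second-order Taylor expansion with Peano remainder\<close>

lemma partial_deriv_eq_has_derivative:
  assumes "(f has_derivative f') (at x)"
  shows "partial_deriv v f x = f' v"
proof -
  have lin: "linear f'" using assms by (simp add: has_derivative_linear)
  have "((\<lambda>s. f (x + s *\<^sub>R v)) has_derivative (\<lambda>s. f' (s *\<^sub>R v))) (at 0)"
    by (rule has_derivative_compose[of "\<lambda>s. x + s *\<^sub>R v" _ _ _ f f'])
      (use assms in \<open>auto intro!: derivative_eq_intros\<close>)
  then have "((\<lambda>s. f (x + s *\<^sub>R v)) has_real_derivative f' v) (at 0)"
    by (rule has_derivative_imp_has_field_derivative) (simp add: linear_scale[OF lin])
  then show ?thesis by (simp add: partial_deriv_def DERIV_imp_deriv)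
qed

lemma differentiable_has_derivative_partial:
  fixes f :: "'a::euclidean_space \<Rightarrow> real"
  assumes "f differentiable at x"
  shows "(f has_derivative (\<lambda>h. \<Sum>v\<in>Basis. (h \<bullet> v) * partial_deriv v f x)) (at x)"
proof -
  obtain f' where f': "(f has_derivative f') (at x)"
    using assms by (auto simp: differentiable_def)
  then have lin: "linear f'" by (simp add: has_derivative_linear)
  have "f' h = (\<Sum>v\<in>Basis. (h \<bullet> v) * partial_deriv v f x)" for h
  proof -
    have "f' h = f' (\<Sum>v\<in>Basis. (h \<bullet> v) *\<^sub>R v)" by (simp add: euclidean_representation)
    then show ?thesis
      by (simp add: linear_sum[OF lin] linear_scale[OF lin] partial_deriv_eq_has_derivative[OF f'])
  qed
  then have "f' = (\<lambda>h. \<Sum>v\<in>Basis. (h \<bullet> v) * partial_deriv v f x)" by auto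
  with f' show ?thesis by simp
qed

text \<open>After subtracting the quadratic Taylor polynomial, the mean value theorem on the segment
  from 0 to \<open>v\<close> reduces the claim to the first-order expansion at 0 of each partial
  derivative.\<close>

lemma second_order_expansion:
  fixes f :: "'a::euclidean_space \<Rightarrow> real"
  assumes C2: "C_k 2 f UNIV" and "e > 0"
  shows "\<exists>r>0. \<forall>v. norm v \<le> r \<longrightarrow>
    \<bar>f v - f 0 - (\<Sum>a\<in>Basis. (v \<bullet> a) * partial_deriv a f 0)
      - (\<Sum>a\<in>Basis. \<Sum>a'\<in>Basis. (v \<bullet> a) * (v \<bullet> a') * partial_deriv a' (partial_deriv a f) 0) / 2\<bar>
    \<le> e * (norm v)\<^sup>2"
proof -
  define H where "H a a' = partial_deriv a' (partial_deriv a f) 0" for a a'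
  \<comment> \<open>Each of the \<open>N\<close> partial derivatives is granted the tolerance
    \<open>e / N\<close>.\<close>
  define N where "N = real DIM('a)"
  have N: "N > 0" by (simp add: N_def)
  have diff: "f differentiable at x" for x
    using C2 by (simp add: numeral_2_eq_2)
  have diff': "a \<in> Basis \<Longrightarrow> partial_deriv a f differentiable at x" for a x
    using C2 by (simp add: numeral_2_eq_2)
  have "\<exists>r>0. \<forall>v. norm v < r \<longrightarrow>
      \<bar>partial_deriv a f v - partial_deriv a f 0 - (\<Sum>a'\<in>Basis. (v \<bullet> a') * H a a')\<bar> \<le> e / N * norm v"
    if a: "a \<in> Basis" for a
  proof -
    have "\<exists>r>0. \<forall>v. norm (v - 0) < r \<longrightarrow>
      norm (partial_deriv a f v - partial_deriv a f 0 - (\<Sum>a'\<in>Basis. ((v - 0) \<bullet> a') * H a a')) \<le> e / N * norm (v - 0)"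
      using differentiable_has_derivative_partial[OF diff'[OF a, of 0]] \<open>e > 0\<close> N
      unfolding has_derivative_at_alt H_def by (meson divide_pos_pos)
    then show ?thesis by simp
  qed
  then obtain r where r: "\<And>a. a \<in> Basis \<Longrightarrow> r a > 0"
    and rb: "\<And>a v. a \<in> Basis \<Longrightarrow> norm v < r a \<Longrightarrow>
      \<bar>partial_deriv a f v - partial_deriv a f 0 - (\<Sum>a'\<in>Basis. (v \<bullet> a') * H a a')\<bar> \<le> e / N * norm v"
    by metis
  \<comment> \<open>Halving the minimum turns \<open>norm v \<le> R\<close> into the strict bound
    \<open>norm v < r a\<close>.\<close>
  define R where "R = Min (r ` Basis) / 2"
  have R: "R > 0" using r by (simp add: R_def)
  have Rr: "R < r a" if "a \<in> Basis" for a
  proof -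
    have "Min (r ` Basis) \<le> r a" using that by simp
    then show ?thesis using r[OF that] R by (simp add: R_def)
  qed
  have "\<bar>f v - f 0 - (\<Sum>a\<in>Basis. (v \<bullet> a) * partial_deriv a f 0)
      - (\<Sum>a\<in>Basis. \<Sum>a'\<in>Basis. (v \<bullet> a) * (v \<bullet> a') * H a a') / 2\<bar> \<le> e * (norm v)\<^sup>2"
    if v: "norm v \<le> R" for v
  proof -
    \<comment> \<open>\<open>\<theta> 1 - \<theta> 0\<close> is the quantity to estimate; in the
      derivative \<open>\<theta>'\<close> each coordinate carries the first-order remainder of one
      partial derivative at \<open>s *\<^sub>R v\<close>.\<close>
    define \<theta> where "\<theta> s = f (s *\<^sub>R v) - s * (\<Sum>a\<in>Basis. (v \<bullet> a) * partial_deriv a f 0)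
      - s\<^sup>2 / 2 * (\<Sum>a\<in>Basis. \<Sum>a'\<in>Basis. (v \<bullet> a) * (v \<bullet> a') * H a a')" for s
    define \<theta>' where "\<theta>' s = (\<Sum>a\<in>Basis. (v \<bullet> a) *
      (partial_deriv a f (s *\<^sub>R v) - partial_deriv a f 0 - (\<Sum>a'\<in>Basis. ((s *\<^sub>R v) \<bullet> a') * H a a')))" for s
    have der: "(\<theta> has_real_derivative \<theta>' s) (at s)" for s
    proof -
      have "((\<lambda>s. f (s *\<^sub>R v)) has_derivative
          (\<lambda>t. \<Sum>a\<in>Basis. ((t *\<^sub>R v) \<bullet> a) * partial_deriv a f (s *\<^sub>R v))) (at s)"
        by (rule has_derivative_compose[of "\<lambda>s. s *\<^sub>R v" _ _ _ f,
            OF _ differentiable_has_derivative_partial[OF diff]])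
          (auto intro!: derivative_eq_intros)
      then have "((\<lambda>s. f (s *\<^sub>R v)) has_real_derivative (\<Sum>a\<in>Basis. (v \<bullet> a) * partial_deriv a f (s *\<^sub>R v))) (at s)"
        by (rule has_derivative_imp_has_field_derivative) (simp add: sum_distrib_left mult_ac)
      then show ?thesis unfolding \<theta>_def \<theta>'_def
        by (auto intro!: derivative_eq_intros
          simp: algebra_simps sum_subtractf sum_distrib_left sum.distrib)
    qed
    have "\<exists>z. 0 < z \<and> z < 1 \<and> \<theta> 1 - \<theta> 0 = (1 - 0) * \<theta>' z"
      using der by (intro MVT2) auto
    then obtain z where z: "0 < z" "z < 1" "\<theta> 1 - \<theta> 0 = \<theta>' z" by auto
    have "\<bar>\<theta>' z\<bar> \<le> (\<Sum>a\<in>(Basis::'a set). norm v * (e / N * norm v))"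
      unfolding \<theta>'_def
    proof (rule order.trans[OF sum_abs], rule sum_mono)
      fix a :: 'a assume a: "a \<in> Basis"
      have zv: "norm (z *\<^sub>R v) \<le> norm v" using z by (simp add: mult_left_le_one_le)
      then have "norm (z *\<^sub>R v) < r a" using v Rr[OF a] by linarith
      note rb[OF a this]
      also have "e / N * norm (z *\<^sub>R v) \<le> e / N * norm v"
        using zv \<open>e > 0\<close> N by (intro mult_left_mono) auto
      finally show "\<bar>(v \<bullet> a) * (partial_deriv a f (z *\<^sub>R v) - partial_deriv a f 0
          - (\<Sum>a'\<in>Basis. ((z *\<^sub>R v) \<bullet> a') * H a a'))\<bar> \<le> norm v * (e / N * norm v)"
        unfolding abs_mult using Basis_le_norm[OF a, of v] by (intro mult_mono) auto
    qed
    also have "\<dots> = e * (norm v)\<^sup>2" using N by (simp add: N_def power2_eq_square)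
    finally show ?thesis using z(3) by (simp add: \<theta>_def algebra_simps)
  qed
  then show ?thesis using R unfolding H_def by blast
qed

section \<open>Consistency and convergence of the monotone scheme\<close>

lemma shift_mono_nonexpansive:
  fixes \<phi> :: "real ^ 'a::finite \<Rightarrow> real"
  assumes shift: "shift_equivariant \<phi>" and mono: "mono \<phi>"
    and close: "\<And>a. \<bar>u $ a - v $ a\<bar> \<le> c"
  shows "\<bar>\<phi> u - \<phi> v\<bar> \<le> c"
proof -
  have "u \<le> v + (\<chi> a. c)" "v \<le> u + (\<chi> a. c)"
    using close by (auto simp: less_eq_vec_def abs_le_iff algebra_simps)
  then have "\<phi> u \<le> \<phi> (v + (\<chi> a. c))" "\<phi> v \<le> \<phi> (u + (\<chi> a. c))"
    using mono by (auto simp: mono_def)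
  then show ?thesis using shift by (auto simp: shift_equivariant_def)
qed

lemma partial_deriv_nonneg_if_mono:
  fixes \<phi> :: "real ^ 'a::finite \<Rightarrow> real"
  assumes mono: "mono \<phi>" and diff: "\<phi> differentiable at x"
  shows "partial_deriv (axis a 1) \<phi> x \<ge> 0"
proof -
  have "((\<lambda>s. \<phi> (x + s *\<^sub>R axis a 1)) has_derivative
      (\<lambda>t. \<Sum>v\<in>Basis. ((t *\<^sub>R axis a 1) \<bullet> v) * partial_deriv v \<phi> x)) (at 0)"
    by (rule has_derivative_compose[of "\<lambda>s. x + s *\<^sub>R axis a 1" _ _ _ \<phi>])
      (use differentiable_has_derivative_partial[OF diff] in \<open>auto intro!: derivative_eq_intros\<close>)
  then have der: "((\<lambda>s. \<phi> (x + s *\<^sub>R axis a 1)) has_real_derivative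
      (\<Sum>v\<in>Basis. (axis a 1 \<bullet> v) * partial_deriv v \<phi> x)) (at 0)"
    by (rule has_derivative_imp_has_field_derivative) (simp add: sum_distrib_left mult_ac)
  then have eq: "partial_deriv (axis a 1) \<phi> x = (\<Sum>v\<in>Basis. (axis a 1 \<bullet> v) * partial_deriv v \<phi> x)"
    by (simp add: partial_deriv_def DERIV_imp_deriv)
  have "mono (\<lambda>s. \<phi> (x + s *\<^sub>R axis a 1))"
    using mono by (auto simp: mono_def less_eq_vec_def axis_def)
  then show ?thesis
    using mono_on_imp_deriv_nonneg[OF _ der, of UNIV] by (simp add: eq)
qed

lemma gamma_eq_0_if_beta_eq_0:
  fixes \<phi> :: "real ^ ('n::finite) stencil \<Rightarrow> real"
  assumes mono: "mono \<phi>" and sym: "lattice_symmetric \<phi>" and C2: "C_k 2 \<phi> UNIV"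
    and b: "b \<in> nonzero_stencil" and "beta \<phi> b = 0"
  shows "gamma \<phi> b = 0"
proof -
  have *: "hessian0 \<phi> a a' = 0" if "gradient0 \<phi> a' = 0" for a a'
  proof -
    define F where "F s = partial_deriv (axis a' 1) \<phi> (0 + s *\<^sub>R axis a 1)" for s :: real
    have "\<phi> differentiable at x" for x using C2 by (simp add: numeral_2_eq_2)
    then have nonneg: "F s \<ge> 0" for s unfolding F_def by (intro partial_deriv_nonneg_if_mono mono)
    have "(axis a' 1 :: real ^ 'n stencil) \<in> Basis" by simp
    then have "partial_deriv (axis a' 1) \<phi> differentiable at 0"
      using C2 by (simp add: numeral_2_eq_2)
    then have "F differentiable at 0"
      unfolding F_def
      by (intro differentiable_compose[of "partial_deriv (axis a' 1) \<phi>" "\<lambda>s. 0 + s *\<^sub>R axis a 1" 0 UNIV])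
        (auto simp: intro!: derivative_intros)
    then obtain D where D: "(F has_real_derivative D) (at 0)"
      using real_differentiable_def by blast
    then have "D = 0"
      by (rule DERIV_local_min[of _ _ _ 1]) (use nonneg that in \<open>auto simp: F_def\<close>)
    then show ?thesis
      using D by (simp add: F_def[abs_def] partial_deriv_def[of "axis a 1"] DERIV_imp_deriv)
  qed
  obtain i where "b = e_vec i \<or> b = opposite (e_vec i)"
    using b by (cases b rule: stencil_cases) (auto simp: nonzero_stencil_def Rep_center)
  \<comment> \<open>\<open>gamma\<close> involves the inner directions \<open>b\<close> and
    \<open>opposite b\<close>; both have gradient \<open>beta \<phi> b\<close>, so both Hessian
    entries vanish.\<close>
  then have "gradient0 \<phi> b = 0" "gradient0 \<phi> (opposite b) = 0"
    using gradient0_eq_beta[OF sym b, of i] assms(5) by auto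
  then show ?thesis using *[of b b] *[of "opposite b" b] by (simp add: gamma_def)
qed

lemma second_order_expansion_vec:
  fixes \<phi> :: "real ^ 'a::finite \<Rightarrow> real"
  assumes "C_k 2 \<phi> UNIV" and "e > 0"
  shows "\<exists>r>0. \<forall>v. norm v \<le> r \<longrightarrow>
    \<bar>\<phi> v - \<phi> 0 - (\<Sum>a\<in>UNIV. v $ a * gradient0 \<phi> a)
      - (\<Sum>a\<in>UNIV. \<Sum>a'\<in>UNIV. hessian0 \<phi> a' a * (v $ a * v $ a')) / 2\<bar> \<le> e * (norm v)\<^sup>2"
  using second_order_expansion[OF assms] by (simp add: sum_Basis_vec inner_axis mult_ac)

text \<open>\<open>v\<close> stands for the increments of a smooth function over the stencil, with
  first derivatives \<open>p\<close> and pure second derivatives \<open>q\<close>. In the linear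
  term opposite neighbours have the same coefficient, so the odd parts
  \<open>\<epsilon> * p i\<close> cancel and \<open>\<epsilon>\<^sup>2 * q i\<close> is left; the
  quadratic term sees only the odd parts up to cubic order. The threshold depends on
  \<open>M\<close> and \<open>e\<close>, not on \<open>v\<close>, \<open>p\<close>,
  \<open>q\<close>, so it serves all lattice points and times at once.\<close>

lemma scheme_consistency:
  fixes \<phi> :: "real ^ ('n::finite) stencil \<Rightarrow> real"
  assumes sym: "lattice_symmetric \<phi>" and C2: "C_k 2 \<phi> UNIV"
    and b: "b \<in> nonzero_stencil" and "M \<ge> 0" and "e > 0"
  shows "\<exists>\<epsilon>\<^sub>0>0. \<forall>\<epsilon> v p q. 0 < \<epsilon> \<longrightarrow> \<epsilon> \<le> \<epsilon>\<^sub>0 \<longrightarrow> v center = 0 \<longrightarrow>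
    (\<forall>i. \<bar>p i\<bar> \<le> M \<and> \<bar>q i\<bar> \<le> M \<and>
      \<bar>v (e_vec i) - (\<epsilon> * p i + \<epsilon>\<^sup>2 / 2 * q i)\<bar> \<le> M * \<epsilon> ^ 3 \<and>
      \<bar>v (opposite (e_vec i)) - (- \<epsilon> * p i + \<epsilon>\<^sup>2 / 2 * q i)\<bar> \<le> M * \<epsilon> ^ 3) \<longrightarrow>
    \<bar>\<phi> (\<chi> a. v a) - \<phi> 0 - \<epsilon>\<^sup>2 * (beta \<phi> b * (\<Sum>i\<in>UNIV. q i) + gamma \<phi> b * (\<Sum>i\<in>UNIV. (p i)\<^sup>2))\<bar> \<le> e * \<epsilon>\<^sup>2"
proof -
  \<comment> \<open>Every entry of \<open>v\<close> is at most \<open>3 * M * \<epsilon>\<close>, so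
    \<open>N * \<epsilon>\<close> bounds the norm; the summand 1 keeps \<open>N\<close>
    positive.\<close>
  define N where "N = real CARD('n stencil) * (3 * M) + 1"
  have N: "N > 0" using \<open>M \<ge> 0\<close> by (simp add: N_def add_nonneg_pos)
  define HH where "HH = (\<Sum>a\<in>UNIV. \<Sum>a'\<in>UNIV. \<bar>hessian0 \<phi> a' a\<bar>)"
  have HH: "HH \<ge> 0" unfolding HH_def by (intro sum_nonneg) auto
  define d where "d = real CARD('n)"
  \<comment> \<open>\<open>C\<close> gathers the coefficients of the cubic errors: those of the
    linear term and those of replacing \<open>v\<close> by its odd part in half the quadratic
    form.\<close>
  define C where "C = \<bar>beta \<phi> b\<bar> * (2 * d * M) + 4 * M\<^sup>2 * HH + 1"
  have C: "C > 0" using \<open>M \<ge> 0\<close> HH by (auto simp: C_def d_def intro!: add_nonneg_pos add_nonneg_nonneg)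
  \<comment> \<open>With this choice the Taylor remainder
    \<open>e' * (N * \<epsilon>)\<^sup>2\<close> is exactly half of the allowed error.\<close>
  define e' where "e' = e / (2 * N\<^sup>2)"
  have e': "e' > 0" using N \<open>e > 0\<close> by (simp add: e'_def)
  obtain r where r: "r > 0" and taylor: "\<And>v. norm v \<le> r \<Longrightarrow>
    \<bar>\<phi> v - \<phi> 0 - (\<Sum>a\<in>UNIV. v $ a * gradient0 \<phi> a)
      - (\<Sum>a\<in>UNIV. \<Sum>a'\<in>UNIV. hessian0 \<phi> a' a * (v $ a * v $ a')) / 2\<bar> \<le> e' * (norm v)\<^sup>2"
    using second_order_expansion_vec[OF C2 e'] by blast
  \<comment> \<open>The three entries give \<open>\<epsilon>\<^sup>2 \<le> \<epsilon>\<close>,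
    \<open>N * \<epsilon> \<le> r\<close> so that the expansion applies, and
    \<open>C * \<epsilon> \<le> e / 2\<close>.\<close>
  define \<epsilon>0 where "\<epsilon>0 = min 1 (min (r / N) (e / (2 * C)))"
  have \<epsilon>0: "\<epsilon>0 > 0" using r N C \<open>e > 0\<close> by (simp add: \<epsilon>0_def)
  have "\<bar>\<phi> (\<chi> a. v a) - \<phi> 0 - \<epsilon>\<^sup>2 * (beta \<phi> b * (\<Sum>i\<in>UNIV. q i) + gamma \<phi> b * (\<Sum>i\<in>UNIV. (p i)\<^sup>2))\<bar> \<le> e * \<epsilon>\<^sup>2"
    if \<epsilon>: "0 < \<epsilon>" "\<epsilon> \<le> \<epsilon>0" and v0: "v center = 0" and
    pq: "\<And>i. \<bar>p i\<bar> \<le> M" "\<And>i. \<bar>q i\<bar> \<le> M"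
      "\<And>i. \<bar>v (e_vec i) - (\<epsilon> * p i + \<epsilon>\<^sup>2 / 2 * q i)\<bar> \<le> M * \<epsilon> ^ 3"
      "\<And>i. \<bar>v (opposite (e_vec i)) - (- \<epsilon> * p i + \<epsilon>\<^sup>2 / 2 * q i)\<bar> \<le> M * \<epsilon> ^ 3"
    for \<epsilon> v p q
  proof -
    have \<epsilon>1: "\<epsilon> \<le> 1" using \<epsilon> by (simp add: \<epsilon>0_def)
    have \<epsilon>2: "\<epsilon>\<^sup>2 \<le> \<epsilon>" using \<epsilon> \<epsilon>1 by (simp add: power2_eq_square mult_left_le)
    have \<epsilon>3: "\<epsilon> ^ 3 \<le> \<epsilon>\<^sup>2" using \<epsilon> \<epsilon>1 by (simp add: power_decreasing)
    have M3: "M * \<epsilon> ^ 3 \<le> M * \<epsilon>\<^sup>2" and M2: "M * \<epsilon>\<^sup>2 \<le> M * \<epsilon>"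
      using \<epsilon>2 \<epsilon>3 \<open>M \<ge> 0\<close> by (auto intro: mult_left_mono)
    \<comment> \<open>\<open>w\<close> is the odd first-order part of \<open>v\<close>; the
      difference from \<open>v\<close> is of order \<open>\<epsilon>\<^sup>2\<close>, hence the
      products \<open>v a * v a'\<close> and \<open>w a * w a'\<close> differ only at order
      \<open>\<epsilon> ^ 3\<close>.\<close>
    define w where "w a = (if \<exists>i. a = e_vec i then \<epsilon> * p (THE i. a = e_vec i)
      else if \<exists>i. a = opposite (e_vec i) then - (\<epsilon> * p (THE i. a = opposite (e_vec i))) else 0)" for a
    have w: "w center = 0" "\<And>i. w (e_vec i) = \<epsilon> * p i" "\<And>i. w (opposite (e_vec i)) = - (\<epsilon> * p i)"
      by (auto simp: w_def)
    have \<epsilon>p: "\<bar>\<epsilon> * p i\<bar> \<le> M * \<epsilon>" and \<epsilon>q: "\<bar>\<epsilon>\<^sup>2 / 2 * q i\<bar> \<le> M * \<epsilon>\<^sup>2 / 2" for i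
      using pq(1,2)[of i] \<epsilon> by (auto simp: abs_mult mult.commute)
    have wb: "\<bar>w a\<bar> \<le> M * \<epsilon>" for a
      by (cases a rule: stencil_cases) (use w \<epsilon>p \<open>M \<ge> 0\<close> \<epsilon> in auto)
    have vw: "\<bar>v a - w a\<bar> \<le> 2 * M * \<epsilon>\<^sup>2" for a
    proof (cases a rule: stencil_cases)
      case 1
      then show ?thesis using v0 w \<open>M \<ge> 0\<close> by simp
    next
      case (2 i)
      have "\<bar>v a - w a\<bar> \<le> M * \<epsilon> ^ 3 + M * \<epsilon>\<^sup>2 / 2"
        using pq(3)[of i] \<epsilon>q[of i] unfolding 2 w by linarith
      also have "\<dots> \<le> 2 * M * \<epsilon>\<^sup>2" using M3 mult_nonneg_nonneg[OF \<open>M \<ge> 0\<close> zero_le_power2[of \<epsilon>]] by linarith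
      finally show ?thesis .
    next
      case (3 i)
      have "\<bar>v a - w a\<bar> \<le> M * \<epsilon> ^ 3 + M * \<epsilon>\<^sup>2 / 2"
        using pq(4)[of i] \<epsilon>q[of i] unfolding 3 w by linarith
      also have "\<dots> \<le> 2 * M * \<epsilon>\<^sup>2" using M3 mult_nonneg_nonneg[OF \<open>M \<ge> 0\<close> zero_le_power2[of \<epsilon>]] by linarith
      finally show ?thesis .
    qed
    have vb: "\<bar>v a\<bar> \<le> 3 * M * \<epsilon>" for a
      using vw[of a] wb[of a] M2 by linarith
    have "norm (\<chi> a. v a) \<le> (\<Sum>a\<in>UNIV. \<bar>(\<chi> a. v a) $ a\<bar>)" by (rule norm_le_l1_cart)
    also have "\<dots> \<le> (\<Sum>a\<in>(UNIV::'n stencil set). 3 * M * \<epsilon>)" by (intro sum_mono) (simp add: vb)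
    also have "\<dots> \<le> N * \<epsilon>" using \<epsilon> by (simp add: N_def algebra_simps)
    finally have nv: "norm (\<chi> a. v a) \<le> N * \<epsilon>" .
    have "N * \<epsilon> \<le> r" using \<epsilon> N by (simp add: \<epsilon>0_def field_simps)
    then have "\<bar>\<phi> (\<chi> a. v a) - \<phi> 0 - (\<Sum>a\<in>UNIV. v a * gradient0 \<phi> a)
      - (\<Sum>a\<in>UNIV. \<Sum>a'\<in>UNIV. hessian0 \<phi> a' a * (v a * v a')) / 2\<bar> \<le> e' * (norm (\<chi> a. v a))\<^sup>2"
      using taylor[of "\<chi> a. v a"] nv by simp
    also have "\<dots> \<le> e' * (N * \<epsilon>)\<^sup>2" using nv e' by (intro mult_left_mono power_mono) auto
    also have "\<dots> = e / 2 * \<epsilon>\<^sup>2" using N by (simp add: e'_def power_mult_distrib)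
    finally have A: "\<bar>\<phi> (\<chi> a. v a) - \<phi> 0 - (\<Sum>a\<in>UNIV. v a * gradient0 \<phi> a)
      - (\<Sum>a\<in>UNIV. \<Sum>a'\<in>UNIV. hessian0 \<phi> a' a * (v a * v a')) / 2\<bar> \<le> e / 2 * \<epsilon>\<^sup>2" .
    have lin: "(\<Sum>a\<in>UNIV. v a * gradient0 \<phi> a) = beta \<phi> b * (\<Sum>i\<in>UNIV. v (e_vec i) + v (opposite (e_vec i)))"
      by (simp add: sum_stencil v0 gradient0_eq_beta[OF sym b] sum_distrib_left algebra_simps)
    have "\<bar>(\<Sum>i\<in>UNIV. v (e_vec i) + v (opposite (e_vec i))) - \<epsilon>\<^sup>2 * (\<Sum>i\<in>UNIV. q i)\<bar>
        = \<bar>\<Sum>i\<in>UNIV. v (e_vec i) + v (opposite (e_vec i)) - \<epsilon>\<^sup>2 * q i\<bar>"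
      by (simp add: sum_distrib_left sum_subtractf sum.distrib)
    also have "\<dots> \<le> (\<Sum>i\<in>(UNIV::'n set). 2 * M * \<epsilon> ^ 3)"
    proof (rule order.trans[OF sum_abs], rule sum_mono)
      show "\<bar>v (e_vec i) + v (opposite (e_vec i)) - \<epsilon>\<^sup>2 * q i\<bar> \<le> 2 * M * \<epsilon> ^ 3" for i
        using pq(3)[of i] pq(4)[of i] by linarith
    qed
    also have "\<dots> = 2 * d * M * \<epsilon> ^ 3" by (simp add: d_def)
    finally have B: "\<bar>beta \<phi> b * (\<Sum>i\<in>UNIV. v (e_vec i) + v (opposite (e_vec i))) - \<epsilon>\<^sup>2 * (beta \<phi> b * (\<Sum>i\<in>UNIV. q i))\<bar>
        \<le> \<bar>beta \<phi> b\<bar> * (2 * d * M * \<epsilon> ^ 3)"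
      unfolding mult.left_commute[of "\<epsilon>\<^sup>2"] right_diff_distrib[symmetric] abs_mult
      by (intro mult_left_mono) auto
    have quad: "(\<Sum>a\<in>UNIV. \<Sum>a'\<in>UNIV. hessian0 \<phi> a' a * (w a * w a')) = 2 * \<epsilon>\<^sup>2 * (gamma \<phi> b * (\<Sum>i\<in>UNIV. (p i)\<^sup>2))"
      by (subst hessian0_antisymmetric_form[OF sym b w])
        (simp add: power_mult_distrib sum_distrib_left mult_ac)
    have vvww: "\<bar>v a * v a' - w a * w a'\<bar> \<le> 8 * M\<^sup>2 * \<epsilon> ^ 3" for a a'
    proof -
      have "v a * v a' - w a * w a' = (v a - w a) * v a' + w a * (v a' - w a')" by (simp add: algebra_simps)
      then have "\<bar>v a * v a' - w a * w a'\<bar> \<le> \<bar>v a - w a\<bar> * \<bar>v a'\<bar> + \<bar>w a\<bar> * \<bar>v a' - w a'\<bar>"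
        by (metis abs_mult abs_triangle_ineq)
      also have "\<dots> \<le> (2 * M * \<epsilon>\<^sup>2) * (3 * M * \<epsilon>) + (M * \<epsilon>) * (2 * M * \<epsilon>\<^sup>2)"
        using \<open>M \<ge> 0\<close> \<epsilon> by (intro add_mono mult_mono vw wb vb) auto
      also have "\<dots> = 8 * M\<^sup>2 * \<epsilon> ^ 3" by (simp add: power2_eq_square power3_eq_cube)
      finally show ?thesis .
    qed
    have "\<bar>(\<Sum>a\<in>UNIV. \<Sum>a'\<in>UNIV. hessian0 \<phi> a' a * (v a * v a')) - (\<Sum>a\<in>UNIV. \<Sum>a'\<in>UNIV. hessian0 \<phi> a' a * (w a * w a'))\<bar>
      = \<bar>\<Sum>a\<in>UNIV. \<Sum>a'\<in>UNIV. hessian0 \<phi> a' a * (v a * v a' - w a * w a')\<bar>"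
      by (simp add: sum_subtractf[symmetric] right_diff_distrib)
    also have "\<dots> \<le> (\<Sum>a\<in>UNIV. \<Sum>a'\<in>UNIV. \<bar>hessian0 \<phi> a' a\<bar> * (8 * M\<^sup>2 * \<epsilon> ^ 3))"
      by (intro order.trans[OF sum_abs] sum_mono)
        (simp only: abs_mult, intro mult_left_mono vvww, simp)
    also have "\<dots> = HH * (8 * M\<^sup>2 * \<epsilon> ^ 3)" by (simp add: HH_def sum_distrib_right)
    finally have D: "\<bar>(\<Sum>a\<in>UNIV. \<Sum>a'\<in>UNIV. hessian0 \<phi> a' a * (v a * v a')) / 2 - \<epsilon>\<^sup>2 * (gamma \<phi> b * (\<Sum>i\<in>UNIV. (p i)\<^sup>2))\<bar>
      \<le> HH * (4 * M\<^sup>2 * \<epsilon> ^ 3)"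
      unfolding quad by (simp add: abs_le_iff field_simps)
    have "\<bar>\<phi> (\<chi> a. v a) - \<phi> 0 - \<epsilon>\<^sup>2 * (beta \<phi> b * (\<Sum>i\<in>UNIV. q i) + gamma \<phi> b * (\<Sum>i\<in>UNIV. (p i)\<^sup>2))\<bar>
      \<le> e / 2 * \<epsilon>\<^sup>2 + \<bar>beta \<phi> b\<bar> * (2 * d * M * \<epsilon> ^ 3) + HH * (4 * M\<^sup>2 * \<epsilon> ^ 3)"
      using A B D unfolding lin distrib_left by linarith
    also have "\<dots> \<le> e / 2 * \<epsilon>\<^sup>2 + (C * \<epsilon>) * \<epsilon>\<^sup>2"
      using \<epsilon> by (simp add: C_def power2_eq_square power3_eq_cube algebra_simps)
    also have "\<dots> \<le> e / 2 * \<epsilon>\<^sup>2 + e / 2 * \<epsilon>\<^sup>2"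
      using \<epsilon> C by (intro add_mono mult_right_mono) (auto simp: \<epsilon>0_def field_simps)
    finally show ?thesis by (simp add: field_simps)
  qed
  then show ?thesis using \<epsilon>0 by blast
qed

section \<open>Propagation of the local errors\<close>

lemma surface_error_bound:
  fixes \<phi> :: "real ^ ('n::finite) stencil \<Rightarrow> real" and h :: "nat \<Rightarrow> int ^ 'n \<Rightarrow> real"
  assumes shift: "shift_equivariant \<phi>" and mono: "mono \<phi>"
    and init: "\<And>x. \<bar>surface \<phi> g \<epsilon> 0 x - h 0 x\<bar> \<le> E"
    and step: "\<And>k x. k < n \<Longrightarrow> \<bar>\<phi> (\<chi> a. h k (x + Rep_stencil a)) - \<phi> 0 - h (Suc k) x\<bar> \<le> \<rho>"
  shows "\<bar>surface \<phi> g \<epsilon> n x - real n * \<phi> 0 - h n x\<bar> \<le> E + real n * \<rho>"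
  using step
proof (induction n arbitrary: x)
  case 0
  then show ?case using init by simp
next
  case (Suc n)
  have IH: "\<bar>surface \<phi> g \<epsilon> n x - real n * \<phi> 0 - h n x\<bar> \<le> E + real n * \<rho>" for x
    using Suc by simp
  define u where "u = (\<chi> a. surface \<phi> g \<epsilon> n (x + Rep_stencil a))"
  define v where "v = (\<chi> a. h n (x + Rep_stencil a))"
  \<comment> \<open>The drift accumulated in \<open>n\<close> steps is placed inside
    \<open>\<phi>\<close>, so that nonexpansiveness compares two surfaces already known to be close;
    shift equivariance then takes it out again.\<close>
  have "\<bar>\<phi> u - \<phi> (v + (\<chi> a. real n * \<phi> 0))\<bar> \<le> E + real n * \<rho>"
  proof (rule shift_mono_nonexpansive[OF shift mono])
    show "\<bar>u $ a - (v + (\<chi> a. real n * \<phi> 0)) $ a\<bar> \<le> E + real n * \<rho>" for a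
      using IH[of "x + Rep_stencil a"] by (simp add: u_def v_def algebra_simps)
  qed
  moreover have "\<phi> (v + (\<chi> a. real n * \<phi> 0)) = \<phi> v + real n * \<phi> 0"
    using shift by (simp add: shift_equivariant_def)
  moreover have "\<bar>\<phi> v - \<phi> 0 - h (Suc n) x\<bar> \<le> \<rho>" using Suc.prems[of n x] by (simp add: v_def)
  moreover have "surface \<phi> g \<epsilon> (Suc n) x = \<phi> u" by (simp add: u_def)
  ultimately show ?case by (simp add: algebra_simps)
qed

lemma real_vec_add: "real_vec (x + y) = real_vec x + real_vec y"
  by (simp add: real_vec_def vec_eq_iff)

lemma real_vec_stencil:
  "real_vec (Rep_stencil center) = 0"
  "real_vec (Rep_stencil (e_vec i)) = axis i 1"
  "real_vec (Rep_stencil (opposite (e_vec i))) = - axis i 1"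
  by (simp_all add: real_vec_def vec_eq_iff Rep_center Rep_e_vec Rep_opposite axis_def)

lemma norm_floor_vec_diff:
  fixes x :: "real ^ 'n::finite"
  assumes "\<epsilon> > 0"
  shows "norm (\<epsilon> *\<^sub>R real_vec (floor_vec (x /\<^sub>R \<epsilon>)) - x) \<le> real CARD('n) * \<epsilon>"
proof -
  have "\<bar>(\<epsilon> *\<^sub>R real_vec (floor_vec (x /\<^sub>R \<epsilon>)) - x) $ i\<bar> \<le> \<epsilon>" for i
  proof -
    have "(\<epsilon> *\<^sub>R real_vec (floor_vec (x /\<^sub>R \<epsilon>)) - x) $ i = \<epsilon> * (real_of_int \<lfloor>x $ i / \<epsilon>\<rfloor> - x $ i / \<epsilon>)"
      using assms by (simp add: real_vec_def floor_vec_def field_simps)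
    moreover have "\<bar>real_of_int \<lfloor>x $ i / \<epsilon>\<rfloor> - x $ i / \<epsilon>\<bar> \<le> 1" by linarith
    ultimately show ?thesis using assms by (simp add: abs_mult mult_left_le)
  qed
  then have "(\<Sum>i\<in>UNIV. \<bar>(\<epsilon> *\<^sub>R real_vec (floor_vec (x /\<^sub>R \<epsilon>)) - x) $ i\<bar>) \<le> (\<Sum>i\<in>(UNIV::'n set). \<epsilon>)"
    by (intro sum_mono)
  then show ?thesis using norm_le_l1_cart[of "\<epsilon> *\<^sub>R real_vec (floor_vec (x /\<^sub>R \<epsilon>)) - x"] by simp
qed

text \<open>Comparison of the scheme with an approximate solution \<open>h\<close> whose initial value is within \<open>E\<close> of \<open>g\<close>:
  the local errors are \<open>o(\<epsilon>\<^sup>2)\<close> and there are about \<open>T / \<epsilon>\<^sup>2\<close> steps, none of which amplifies errors.\<close>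

lemma scheme_convergence:
  fixes \<phi> :: "real ^ ('n::finite) stencil \<Rightarrow> real" and h D :: "real \<Rightarrow> real ^ 'n \<Rightarrow> real"
    and p q :: "real \<Rightarrow> real ^ 'n \<Rightarrow> 'n \<Rightarrow> real"
  assumes shift: "shift_equivariant \<phi>" and mono: "mono \<phi>"
    and sym: "lattice_symmetric \<phi>" and C2: "C_k 2 \<phi> UNIV"
    and b: "b \<in> nonzero_stencil"
    and "T \<ge> 0" "M \<ge> 0" "e > 0"
    and init: "\<And>x. \<bar>g x - h 0 x\<bar> \<le> E"
    and lip: "\<And>s x y. 0 \<le> s \<Longrightarrow> s \<le> T \<Longrightarrow> \<bar>h s x - h s y\<bar> \<le> M * norm (x - y)"
    and pb: "\<And>s x i. 0 \<le> s \<Longrightarrow> s \<le> T \<Longrightarrow> \<bar>p s x i\<bar> \<le> M"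
    and qb: "\<And>s x i. 0 \<le> s \<Longrightarrow> s \<le> T \<Longrightarrow> \<bar>q s x i\<bar> \<le> M"
    and space: "\<And>s x i r. 0 \<le> s \<Longrightarrow> s \<le> T \<Longrightarrow>
      \<bar>h s (x + r *\<^sub>R axis i 1) - h s x - (r * p s x i + r\<^sup>2 / 2 * q s x i)\<bar> \<le> M * \<bar>r\<bar> ^ 3"
    and time: "\<And>s x r. 0 \<le> s \<Longrightarrow> 0 \<le> r \<Longrightarrow> s + r \<le> T \<Longrightarrow>
      \<bar>h (s + r) x - h s x - r * D s x\<bar> \<le> M * r\<^sup>2"
    and time_lip: "\<And>s x r. 0 \<le> s \<Longrightarrow> 0 \<le> r \<Longrightarrow> s + r \<le> T \<Longrightarrow> \<bar>h (s + r) x - h s x\<bar> \<le> M * r"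
    and pde: "\<And>s x. 0 \<le> s \<Longrightarrow> s \<le> T \<Longrightarrow>
      D s x = beta \<phi> b * (\<Sum>i\<in>UNIV. q s x i) + gamma \<phi> b * (\<Sum>i\<in>UNIV. (p s x i)\<^sup>2)"
  shows "eventually (\<lambda>\<epsilon>. \<bar>rescaled_surface \<phi> g \<epsilon> T x - h T x\<bar> \<le> E + e) (at_right 0)"
proof -
  \<comment> \<open>At most \<open>T / \<epsilon>\<^sup>2\<close> steps with defect
    \<open>2 * e' * \<epsilon>\<^sup>2\<close> each add up to at most \<open>e / 2\<close>.\<close>
  define e' where "e' = e / (4 * (T + 1))"
  have e': "e' > 0" using \<open>e > 0\<close> \<open>T \<ge> 0\<close> by (simp add: e'_def)
  obtain \<epsilon>0 where \<epsilon>0: "\<epsilon>0 > 0" and cons: "\<And>\<epsilon> v p q. 0 < \<epsilon> \<Longrightarrow> \<epsilon> \<le> \<epsilon>0 \<Longrightarrow> v center = 0 \<Longrightarrow>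
    (\<forall>i. \<bar>p i\<bar> \<le> M \<and> \<bar>q i\<bar> \<le> M \<and>
      \<bar>v (e_vec i) - (\<epsilon> * p i + \<epsilon>\<^sup>2 / 2 * q i)\<bar> \<le> M * \<epsilon> ^ 3 \<and>
      \<bar>v (opposite (e_vec i)) - (- \<epsilon> * p i + \<epsilon>\<^sup>2 / 2 * q i)\<bar> \<le> M * \<epsilon> ^ 3) \<Longrightarrow>
    \<bar>\<phi> (\<chi> a. v a) - \<phi> 0 - \<epsilon>\<^sup>2 * (beta \<phi> b * (\<Sum>i\<in>UNIV. q i) + gamma \<phi> b * (\<Sum>i\<in>UNIV. (p i)\<^sup>2))\<bar> \<le> e' * \<epsilon>\<^sup>2"
    using scheme_consistency[OF sym C2 b \<open>M \<ge> 0\<close> e'] by blast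
  define d where "d = real CARD('n)"
  \<comment> \<open>Besides consistency and \<open>\<epsilon>\<^sup>2 \<le> \<epsilon>\<close>, the
    entries provide that the time remainder \<open>M * (\<epsilon>\<^sup>2)\<^sup>2\<close> is at
    most \<open>e' * \<epsilon>\<^sup>2\<close> and that rounding space and time to the grid costs
    at most \<open>e / 4\<close>.\<close>
  define \<epsilon>1 where "\<epsilon>1 = min (min \<epsilon>0 1) (min (e' / (M + 1)) (e / (4 * (M + 1) * (d + 1))))"
  have d0: "d \<ge> 0" by (simp add: d_def)
  have \<epsilon>1: "\<epsilon>1 > 0" using \<epsilon>0 \<open>M \<ge> 0\<close> e' \<open>e > 0\<close> d0 by (simp add: \<epsilon>1_def)
  have main: "\<bar>rescaled_surface \<phi> g \<epsilon> T x - h T x\<bar> \<le> E + e" if \<epsilon>: "0 < \<epsilon>" "\<epsilon> < \<epsilon>1" for \<epsilon>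
  proof -
    define n where "n = nat \<lfloor>T / \<epsilon>\<^sup>2\<rfloor>"
    define x' where "x' = floor_vec (x /\<^sub>R \<epsilon>)"
    define H where "H k y = h (real k * \<epsilon>\<^sup>2) (\<epsilon> *\<^sub>R real_vec y)" for k y
    have \<epsilon>2: "\<epsilon>\<^sup>2 > 0" and \<epsilon>le: "\<epsilon> \<le> 1" "\<epsilon> \<le> \<epsilon>0" using \<epsilon> by (auto simp: \<epsilon>1_def)
    have \<epsilon>2le: "\<epsilon>\<^sup>2 \<le> \<epsilon>" using \<epsilon> \<epsilon>le by (simp add: power2_eq_square mult_left_le)
    have "real n \<le> T / \<epsilon>\<^sup>2" using \<open>T \<ge> 0\<close> by (simp add: n_def)
    then have nT: "real n * \<epsilon>\<^sup>2 \<le> T" using \<epsilon>2 by (simp add: pos_le_divide_eq)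
    have "T / \<epsilon>\<^sup>2 \<le> real n + 1" using \<open>T \<ge> 0\<close> unfolding n_def by linarith
    then have Tn: "T \<le> real n * \<epsilon>\<^sup>2 + \<epsilon>\<^sup>2" using \<epsilon>2 by (simp add: pos_divide_le_eq algebra_simps)
    have Me: "M * \<epsilon>\<^sup>2 \<le> e'"
    proof -
      have "M * \<epsilon>\<^sup>2 \<le> (M + 1) * \<epsilon>" using \<epsilon>2le \<open>M \<ge> 0\<close> \<epsilon>2 by (intro mult_mono) auto
      also have "\<dots> \<le> e'" using \<epsilon> \<open>M \<ge> 0\<close> by (simp add: \<epsilon>1_def field_simps)
      finally show ?thesis .
    qed
    have step: "\<bar>\<phi> (\<chi> a. H k (y + Rep_stencil a)) - \<phi> 0 - H (Suc k) y\<bar> \<le> 2 * e' * \<epsilon>\<^sup>2" if k: "k < n" for k y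
    proof -
      define s where "s = real k * \<epsilon>\<^sup>2"
      define z where "z = \<epsilon> *\<^sub>R real_vec y"
      have "real (Suc k) * \<epsilon>\<^sup>2 \<le> real n * \<epsilon>\<^sup>2" using k \<epsilon>2 by (intro mult_right_mono) auto
      then have s2: "s + \<epsilon>\<^sup>2 \<le> T" using nT by (simp add: s_def algebra_simps)
      have s: "0 \<le> s" "s + \<epsilon>\<^sup>2 \<le> T" "s \<le> T" using s2 \<epsilon>2 by (simp add: s_def, simp, linarith)
      \<comment> \<open>Subtracting the central height makes \<open>v center = 0\<close> and the
        entries small; shift equivariance adds the height back.\<close>
      define v where "v a = h s (z + \<epsilon> *\<^sub>R real_vec (Rep_stencil a)) - h s z" for a
      have eq: "(\<chi> a. H k (y + Rep_stencil a)) = (\<chi> a. v a) + (\<chi> a. h s z)"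
        by (simp add: vec_eq_iff H_def v_def s_def z_def real_vec_add scaleR_add_right)
      have "\<bar>\<phi> (\<chi> a. v a) - \<phi> 0 - \<epsilon>\<^sup>2 * (beta \<phi> b * (\<Sum>i\<in>UNIV. q s z i) + gamma \<phi> b * (\<Sum>i\<in>UNIV. (p s z i)\<^sup>2))\<bar> \<le> e' * \<epsilon>\<^sup>2"
      proof (rule cons[OF \<epsilon>(1) \<epsilon>le(2)])
        show "v center = 0" by (simp add: v_def real_vec_stencil)
        show "\<forall>i. \<bar>p s z i\<bar> \<le> M \<and> \<bar>q s z i\<bar> \<le> M \<and>
          \<bar>v (e_vec i) - (\<epsilon> * p s z i + \<epsilon>\<^sup>2 / 2 * q s z i)\<bar> \<le> M * \<epsilon> ^ 3 \<and>
          \<bar>v (opposite (e_vec i)) - (- \<epsilon> * p s z i + \<epsilon>\<^sup>2 / 2 * q s z i)\<bar> \<le> M * \<epsilon> ^ 3"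
          using pb[OF s(1,3), of z] qb[OF s(1,3), of z] space[OF s(1,3), of z \<epsilon>] space[OF s(1,3), of z "- \<epsilon>"] \<epsilon>
          by (simp add: v_def real_vec_stencil)
      qed
      then have 1: "\<bar>\<phi> (\<chi> a. v a) - \<phi> 0 - \<epsilon>\<^sup>2 * D s z\<bar> \<le> e' * \<epsilon>\<^sup>2" by (simp add: pde[OF s(1,3)])
      have 2: "\<bar>h (s + \<epsilon>\<^sup>2) z - h s z - \<epsilon>\<^sup>2 * D s z\<bar> \<le> M * (\<epsilon>\<^sup>2)\<^sup>2"
        using time[OF s(1) _ s(2)] \<epsilon>2 by simp
      have 3: "M * (\<epsilon>\<^sup>2)\<^sup>2 \<le> e' * \<epsilon>\<^sup>2"
        using mult_right_mono[OF Me, of "\<epsilon>\<^sup>2"] \<epsilon>2 by (simp add: power2_eq_square mult_ac)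
      have 4: "\<phi> (\<chi> a. H k (y + Rep_stencil a)) = \<phi> (\<chi> a. v a) + h s z"
        unfolding eq using shift by (simp add: shift_equivariant_def)
      have 5: "H (Suc k) y = h (s + \<epsilon>\<^sup>2) z" by (simp add: H_def s_def z_def algebra_simps)
      show ?thesis using 1 2 3 unfolding 4 5 by linarith
    qed
    have "\<bar>surface \<phi> g \<epsilon> n x' - real n * \<phi> 0 - H n x'\<bar> \<le> E + real n * (2 * e' * \<epsilon>\<^sup>2)"
      by (rule surface_error_bound[OF shift mono]) (use init step in \<open>auto simp: H_def\<close>)
    also have "real n * (2 * e' * \<epsilon>\<^sup>2) \<le> 2 * e' * T"
      using mult_left_mono[OF nT, of "2 * e'"] e' by (simp add: mult_ac)
    also have "2 * e' * T \<le> e / 2"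
      using \<open>T \<ge> 0\<close> \<open>e > 0\<close> by (simp add: e'_def field_simps)
    finally have A: "\<bar>rescaled_surface \<phi> g \<epsilon> T x - H n x'\<bar> \<le> E + e / 2"
      by (simp add: rescaled_surface_def Let_def n_def x'_def)
    have n0: "0 \<le> real n * \<epsilon>\<^sup>2" using \<epsilon>2 by simp
    \<comment> \<open>So far the comparison holds at the rounded point and time; the Lipschitz
      bounds in space and time now lead to \<open>x\<close> and \<open>T\<close> themselves.\<close>
    have "\<bar>H n x' - h (real n * \<epsilon>\<^sup>2) x\<bar> \<le> M * norm (\<epsilon> *\<^sub>R real_vec x' - x)"
      unfolding H_def by (rule lip[OF n0 nT])
    also have "\<dots> \<le> M * (d * \<epsilon>)"
      using norm_floor_vec_diff[OF \<epsilon>(1), of x] \<open>M \<ge> 0\<close> by (intro mult_left_mono) (simp_all add: x'_def d_def)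
    finally have B: "\<bar>H n x' - h (real n * \<epsilon>\<^sup>2) x\<bar> \<le> M * (d * \<epsilon>)" .
    have "\<bar>h (real n * \<epsilon>\<^sup>2 + (T - real n * \<epsilon>\<^sup>2)) x - h (real n * \<epsilon>\<^sup>2) x\<bar> \<le> M * (T - real n * \<epsilon>\<^sup>2)"
      by (rule time_lip[OF n0]) (use nT in auto)
    also have "\<dots> \<le> M * \<epsilon>" using Tn \<epsilon>2le \<open>M \<ge> 0\<close> by (intro mult_left_mono) auto
    finally have C: "\<bar>h T x - h (real n * \<epsilon>\<^sup>2) x\<bar> \<le> M * \<epsilon>" by simp
    have "M * (d * \<epsilon>) + M * \<epsilon> \<le> ((M + 1) * (d + 1)) * \<epsilon>" using \<epsilon> d0 by (simp add: algebra_simps)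
    also have "\<dots> \<le> e / 4"
    proof -
      have "\<epsilon> \<le> e / (4 * (M + 1) * (d + 1))" using \<epsilon> by (simp add: \<epsilon>1_def)
      then have "\<epsilon> * (4 * (M + 1) * (d + 1)) \<le> e" using \<open>M \<ge> 0\<close> d0 by (subst (asm) pos_le_divide_eq) auto
      then show ?thesis by (simp add: algebra_simps)
    qed
    finally show ?thesis using A B C \<open>e > 0\<close> by linarith
  qed
  show ?thesis
    unfolding eventually_at_right_field using \<epsilon>1 main by blast
qed

section \<open>Gaussian kernels and their convolutions\<close>

lemma partial_deriv_cong_open:
  assumes "open S" "x \<in> S" and "\<And>y. y \<in> S \<Longrightarrow> f y = g y"
  shows "partial_deriv v f x = partial_deriv v g x"
proof -
  have "isCont (\<lambda>s. x + s *\<^sub>R v) 0" by (intro continuous_intros)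
  then have "\<forall>\<^sub>F s in at 0. x + s *\<^sub>R v \<in> S"
    using assms(1,2) by (auto simp: isCont_def dest: topological_tendstoD)
  moreover have "x + 0 *\<^sub>R v \<in> S" using assms(2) by simp
  ultimately have "\<forall>\<^sub>F s in nhds 0. x + s *\<^sub>R v \<in> S"
    unfolding eventually_at_filter by (auto elim!: eventually_mono)
  then have "\<forall>\<^sub>F s in nhds 0. f (x + s *\<^sub>R v) = g (x + s *\<^sub>R v)"
    by eventually_elim (rule assms(3))
  then show ?thesis unfolding partial_deriv_def by (intro deriv_cong_ev) auto
qed

lemma differentiable_cong_open:
  assumes "open S" "x \<in> S" and "\<And>y. y \<in> S \<Longrightarrow> f y = g y"
  shows "f differentiable at x \<longleftrightarrow> g differentiable at x"
  unfolding differentiable_def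
  using assms has_derivative_transform_within_open[of f _ x UNIV S g]
    has_derivative_transform_within_open[of g _ x UNIV S f] by metis

section \<open>The class of kernels generated by the heat kernel\<close>

abbreviation (input) pos_time :: "(real \<times> (real ^ 'n::finite)) set" where
  "pos_time \<equiv> {0<..} \<times> UNIV"

lemma open_pos_time: "open (pos_time :: (real \<times> (real ^ 'n::finite)) set)"
  by (intro open_Times) auto

text \<open>The last rule makes the set insensitive to values at times \<open>t \<le> 0\<close>.\<close>

inductive_set gaussian_kernels :: "real \<Rightarrow> (real \<times> (real ^ 'n::finite) \<Rightarrow> real) set" for \<beta> where
  heat: "(\<lambda>p. heat_kernel \<beta> (fst p) (snd p)) \<in> gaussian_kernels \<beta>"
| coordinate: "k \<in> gaussian_kernels \<beta> \<Longrightarrow> (\<lambda>p. snd p $ i * k p) \<in> gaussian_kernels \<beta>"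
| over_time: "k \<in> gaussian_kernels \<beta> \<Longrightarrow> (\<lambda>p. k p / fst p) \<in> gaussian_kernels \<beta>"
| scale: "k \<in> gaussian_kernels \<beta> \<Longrightarrow> (\<lambda>p. c * k p) \<in> gaussian_kernels \<beta>"
| add: "k \<in> gaussian_kernels \<beta> \<Longrightarrow> k' \<in> gaussian_kernels \<beta> \<Longrightarrow> (\<lambda>p. k p + k' p) \<in> gaussian_kernels \<beta>"
| cong: "k \<in> gaussian_kernels \<beta> \<Longrightarrow> (\<And>p. fst p > 0 \<Longrightarrow> k' p = k p) \<Longrightarrow> k' \<in> gaussian_kernels \<beta>"

lemma gaussian_kernels_sum:
  assumes "finite S" and "\<And>i. i \<in> S \<Longrightarrow> k i \<in> gaussian_kernels \<beta>"
  shows "(\<lambda>p. \<Sum>i\<in>S. k i p) \<in> gaussian_kernels \<beta>"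
  using assms
proof (induction S rule: finite_induct)
  case empty
  show ?case using gaussian_kernels.scale[OF gaussian_kernels.heat, of 0] by simp
next
  case (insert i S)
  then show ?case using gaussian_kernels.add[of "k i" \<beta> "\<lambda>p. \<Sum>i\<in>S. k i p"] by simp
qed

lemma heat_kernel_has_derivative:
  fixes p :: "real \<times> (real ^ 'n::finite)"
  assumes "\<beta> > 0" and p: "fst p > 0"
  shows "((\<lambda>p. heat_kernel \<beta> (fst p) (snd p)) has_derivative
    (\<lambda>h. (fst h * ((snd p \<bullet> snd p) / (4 * \<beta> * (fst p)\<^sup>2) - real CARD('n) / (2 * fst p))
       - (snd h \<bullet> snd p) / (2 * \<beta> * fst p)) * heat_kernel \<beta> (fst p) (snd p))) (at p)"
proof -
  \<comment> \<open>At positive times the normalising power joins the exponent, so the derivative is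
    that of the exponent times the kernel.\<close>
  define E where "E p = exp (- (real CARD('n) / 2) * ln (4 * pi * \<beta> * fst p) - (snd p \<bullet> snd p) / (4 * \<beta> * fst p))"
    for p :: "real \<times> (real ^ 'n)"
  have eq: "E p = heat_kernel \<beta> (fst p) (snd p)" if "p \<in> pos_time" for p
    using that \<open>\<beta> > 0\<close>
    by (auto simp: E_def heat_kernel_def powr_def exp_add[symmetric] power2_norm_eq_inner)
  have "(E has_derivative
    (\<lambda>h. (fst h * ((snd p \<bullet> snd p) / (4 * \<beta> * (fst p)\<^sup>2) - real CARD('n) / (2 * fst p))
       - (snd h \<bullet> snd p) / (2 * \<beta> * fst p)) * E p)) (at p)"
  proof -
    let ?A = "\<lambda>p :: real \<times> (real ^ 'n). - (real CARD('n) / 2) * ln (4 * pi * \<beta> * fst p) - (snd p \<bullet> snd p) / (4 * \<beta> * fst p)"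
    have "(?A has_derivative (\<lambda>h. fst h * ((snd p \<bullet> snd p) / (4 * \<beta> * (fst p)\<^sup>2) - real CARD('n) / (2 * fst p))
       - (snd h \<bullet> snd p) / (2 * \<beta> * fst p))) (at p)"
    proof (rule has_derivative_eq_rhs)
      show "(?A has_derivative (\<lambda>h. - (real CARD('n) / 2) * (fst h / fst p) -
         (- (snd p \<bullet> snd p) * (inverse (4 * \<beta> * fst p) * (4 * \<beta> * fst h) * inverse (4 * \<beta> * fst p))
           + (snd p \<bullet> snd h + snd h \<bullet> snd p) / (4 * \<beta> * fst p)))) (at p)"
        using assms
        by (intro has_derivative_diff has_derivative_divide has_derivative_mult_right has_derivative_inner
            has_derivative_snd has_derivative_ident has_derivative_fst)
          (auto intro!: derivative_eq_intros simp: field_simps)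
    qed (use assms in \<open>auto simp: fun_eq_iff inner_commute power2_eq_square field_simps\<close>)
    from has_derivative_exp[OF this] show ?thesis
      by (simp add: E_def[abs_def] mult.commute)
  qed
  then have "(E has_derivative
    (\<lambda>h. (fst h * ((snd p \<bullet> snd p) / (4 * \<beta> * (fst p)\<^sup>2) - real CARD('n) / (2 * fst p))
       - (snd h \<bullet> snd p) / (2 * \<beta> * fst p)) * heat_kernel \<beta> (fst p) (snd p))) (at p)"
    using p by (simp add: eq mem_Times_iff)
  then show ?thesis
    by (rule has_derivative_transform_within_open[OF _ open_pos_time]) (use p eq in \<open>auto simp: mem_Times_iff\<close>)
qed

text \<open>The product and quotient rules never leave the class, and the derivatives of the heat
  kernel are the kernel times coordinates and inverse powers of time. Closure under derivatives lets
  every order be treated by the same bounds and by repeated use of one lemma on differentiation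
  under the integral.\<close>

lemma gaussian_kernels_derivative:
  fixes k :: "real \<times> (real ^ 'n::finite) \<Rightarrow> real"
  assumes \<beta>: "\<beta> > 0" and "k \<in> gaussian_kernels \<beta>"
  shows "(\<forall>p. fst p > 0 \<longrightarrow> k differentiable at p) \<and> (\<forall>v. partial_deriv v k \<in> gaussian_kernels \<beta>)"
  using assms(2)
proof (induction rule: gaussian_kernels.induct)
  case heat
  let ?K = "\<lambda>p :: real \<times> (real ^ 'n). heat_kernel \<beta> (fst p) (snd p)"
  have "partial_deriv v ?K \<in> gaussian_kernels \<beta>" for v
  proof -
    \<comment> \<open>The summands are the time derivative of the exponent, with the squared norm
      written coordinate by coordinate, the time derivative of the normalising power, and the
      spatial derivative of the exponent.\<close>
    let ?k = "\<lambda>p. (fst v / (4 * \<beta>)) * (\<Sum>i\<in>UNIV. snd p $ i * (snd p $ i * (?K p / fst p / fst p)))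
      + ((- (fst v * real CARD('n) / 2)) * (?K p / fst p)
      + (- 1 / (2 * \<beta>)) * (\<Sum>i\<in>UNIV. snd v $ i * (snd p $ i * (?K p / fst p))))"
    have k: "?k \<in> gaussian_kernels \<beta>"
      by (intro gaussian_kernels.add gaussian_kernels.scale gaussian_kernels_sum gaussian_kernels.coordinate
         gaussian_kernels.over_time gaussian_kernels.heat) auto
    have "partial_deriv v ?K p = ?k p" if "fst p > 0" for p
      unfolding partial_deriv_eq_has_derivative[OF heat_kernel_has_derivative[OF \<beta> that]]
      using that \<beta>
      by (simp add: inner_vec_def sum_distrib_left sum_distrib_right sum_divide_distrib sum_negf
          field_simps power2_eq_square)
    then show ?thesis by (rule gaussian_kernels.cong[OF k])
  qed
  then show ?case using heat_kernel_has_derivative[OF \<beta>] unfolding differentiable_def by blast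
next
  case (coordinate k i)
  have dk: "k differentiable at p" if "fst p > 0" for p using coordinate.IH that by blast
  have pk: "partial_deriv v k \<in> gaussian_kernels \<beta>" for v using coordinate.IH by blast
  have pdk: "(\<Sum>w\<in>Basis. (v \<bullet> w) * partial_deriv w k p) = partial_deriv v k p" if "fst p > 0" for v p
    by (rule partial_deriv_eq_has_derivative[OF differentiable_has_derivative_partial[OF dk[OF that]], symmetric])
  have der: "((\<lambda>p. snd p $ i * k p) has_derivative
      (\<lambda>h. snd p $ i * (\<Sum>v\<in>Basis. (h \<bullet> v) * partial_deriv v k p) + snd h $ i * k p)) (at p)"
    if "fst p > 0" for p
    by (intro has_derivative_mult bounded_linear.has_derivative[OF bounded_linear_vec_nth] has_derivative_snd
        has_derivative_ident differentiable_has_derivative_partial dk that)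
  have "partial_deriv v (\<lambda>p. snd p $ i * k p) \<in> gaussian_kernels \<beta>" for v
  proof (rule gaussian_kernels.cong)
    show "(\<lambda>p. snd p $ i * partial_deriv v k p + snd v $ i * k p) \<in> gaussian_kernels \<beta>"
      by (intro gaussian_kernels.add gaussian_kernels.coordinate gaussian_kernels.scale pk coordinate.hyps)
    show "partial_deriv v (\<lambda>p. snd p $ i * k p) p = snd p $ i * partial_deriv v k p + snd v $ i * k p"
      if p: "fst p > 0" for p
      unfolding partial_deriv_eq_has_derivative[OF der[OF p]]
      by (simp add: pdk[OF p])
  qed
  then show ?case using der unfolding differentiable_def by blast
next
  case (over_time k)
  have dk: "k differentiable at p" if "fst p > 0" for p using over_time.IH that by blast
  have pk: "partial_deriv v k \<in> gaussian_kernels \<beta>" for v using over_time.IH by blast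
  have pdk: "(\<Sum>w\<in>Basis. (v \<bullet> w) * partial_deriv w k p) = partial_deriv v k p" if "fst p > 0" for v p
    by (rule partial_deriv_eq_has_derivative[OF differentiable_has_derivative_partial[OF dk[OF that]], symmetric])
  have der: "((\<lambda>p. k p / fst p) has_derivative
      (\<lambda>h. (\<Sum>v\<in>Basis. (h \<bullet> v) * partial_deriv v k p) / fst p - fst h * (k p / fst p / fst p))) (at p)"
    if "fst p > 0" for p
  proof (rule has_derivative_eq_rhs)
    show "((\<lambda>p. k p / fst p) has_derivative (\<lambda>h. - k p * (inverse (fst p) * fst h * inverse (fst p))
        + (\<Sum>v\<in>Basis. (h \<bullet> v) * partial_deriv v k p) / fst p)) (at p)"
      using that dk[OF that]
      by (intro has_derivative_divide has_derivative_fst has_derivative_ident differentiable_has_derivative_partial) auto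
  qed (use that in \<open>auto simp: fun_eq_iff divide_inverse algebra_simps\<close>)
  have "partial_deriv v (\<lambda>p. k p / fst p) \<in> gaussian_kernels \<beta>" for v
  proof (rule gaussian_kernels.cong)
    show "(\<lambda>p. partial_deriv v k p / fst p + (- fst v) * (k p / fst p / fst p)) \<in> gaussian_kernels \<beta>"
      by (intro gaussian_kernels.add gaussian_kernels.over_time gaussian_kernels.scale pk over_time.hyps)
    show "partial_deriv v (\<lambda>p. k p / fst p) p = partial_deriv v k p / fst p + (- fst v) * (k p / fst p / fst p)"
      if p: "fst p > 0" for p
      unfolding partial_deriv_eq_has_derivative[OF der[OF p]]
      by (simp add: pdk[OF p])
  qed
  then show ?case using der unfolding differentiable_def by blast
next
  case (scale k c)
  have dk: "k differentiable at p" if "fst p > 0" for p using scale.IH that by blast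
  have pk: "partial_deriv v k \<in> gaussian_kernels \<beta>" for v using scale.IH by blast
  have pdk: "(\<Sum>w\<in>Basis. (v \<bullet> w) * partial_deriv w k p) = partial_deriv v k p" if "fst p > 0" for v p
    by (rule partial_deriv_eq_has_derivative[OF differentiable_has_derivative_partial[OF dk[OF that]], symmetric])
  have der: "((\<lambda>p. c * k p) has_derivative (\<lambda>h. c * (\<Sum>v\<in>Basis. (h \<bullet> v) * partial_deriv v k p))) (at p)"
    if "fst p > 0" for p
    using dk[OF that] by (auto intro!: derivative_eq_intros differentiable_has_derivative_partial)
  have "partial_deriv v (\<lambda>p. c * k p) \<in> gaussian_kernels \<beta>" for v
  proof (rule gaussian_kernels.cong)
    show "(\<lambda>p. c * partial_deriv v k p) \<in> gaussian_kernels \<beta>"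
      by (intro gaussian_kernels.scale pk)
    show "partial_deriv v (\<lambda>p. c * k p) p = c * partial_deriv v k p" if p: "fst p > 0" for p
      unfolding partial_deriv_eq_has_derivative[OF der[OF p]]
      by (simp add: pdk[OF p])
  qed
  then show ?case using der unfolding differentiable_def by blast
next
  case (add k k')
  have dk: "k differentiable at p" if "fst p > 0" for p using add.IH that by blast
  have pk: "partial_deriv v k \<in> gaussian_kernels \<beta>" for v using add.IH by blast
  have pdk: "(\<Sum>w\<in>Basis. (v \<bullet> w) * partial_deriv w k p) = partial_deriv v k p" if "fst p > 0" for v p
    by (rule partial_deriv_eq_has_derivative[OF differentiable_has_derivative_partial[OF dk[OF that]], symmetric])
  have dk2: "k' differentiable at p" if "fst p > 0" for p using add.IH that by blast
  have pk2: "partial_deriv v k' \<in> gaussian_kernels \<beta>" for v using add.IH by blast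
  have pdk2: "(\<Sum>w\<in>Basis. (v \<bullet> w) * partial_deriv w k' p) = partial_deriv v k' p" if "fst p > 0" for v p
    by (rule partial_deriv_eq_has_derivative[OF differentiable_has_derivative_partial[OF dk2[OF that]], symmetric])
  have der: "((\<lambda>p. k p + k' p) has_derivative (\<lambda>h. (\<Sum>v\<in>Basis. (h \<bullet> v) * partial_deriv v k p)
      + (\<Sum>v\<in>Basis. (h \<bullet> v) * partial_deriv v k' p))) (at p)"
    if "fst p > 0" for p
    using dk[OF that] dk2[OF that] by (intro has_derivative_add differentiable_has_derivative_partial)
  have "partial_deriv v (\<lambda>p. k p + k' p) \<in> gaussian_kernels \<beta>" for v
  proof (rule gaussian_kernels.cong)
    show "(\<lambda>p. partial_deriv v k p + partial_deriv v k' p) \<in> gaussian_kernels \<beta>"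
      by (intro gaussian_kernels.add pk pk2)
    show "partial_deriv v (\<lambda>p. k p + k' p) p = partial_deriv v k p + partial_deriv v k' p" if p: "fst p > 0" for p
      unfolding partial_deriv_eq_has_derivative[OF der[OF p]]
      by (simp add: pdk[OF p] pdk2[OF p])
  qed
  then show ?case using der unfolding differentiable_def by blast
next
  case (cong k k')
  \<comment> \<open>Positive times form an open set, so derivatives there depend only on values
    there.\<close>
  have eq: "k' p = k p" if "p \<in> pos_time" for p using cong.hyps that by (auto simp: mem_Times_iff)
  have mem: "p \<in> pos_time" if "fst p > 0" for p :: "real \<times> (real ^ 'n)" using that by (simp add: mem_Times_iff)
  have "partial_deriv v k' \<in> gaussian_kernels \<beta>" for v
  proof (rule gaussian_kernels.cong[of "partial_deriv v k"])
    show "partial_deriv v k \<in> gaussian_kernels \<beta>" using cong.IH by blast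
    show "partial_deriv v k' p = partial_deriv v k p" if "fst p > 0" for p
      by (rule partial_deriv_cong_open[OF open_pos_time mem[OF that] eq])
  qed
  moreover have "k' differentiable at p" if "fst p > 0" for p
  proof -
    have "k differentiable at p" using cong.IH that by blast
    then show ?thesis by (subst differentiable_cong_open[OF open_pos_time mem[OF that] eq])
  qed
  ultimately show ?case by blast
qed

lemmas gaussian_kernels_differentiable = gaussian_kernels_derivative[THEN conjunct1, rule_format]
lemmas gaussian_kernels_partial_deriv = gaussian_kernels_derivative[THEN conjunct2, rule_format]

section \<open>Integrals and bounds of Gaussian type\<close>

lemma lborel_distr_reflect: "distr lborel borel (\<lambda>y. x - y) = (lborel :: 'a::euclidean_space measure)"
proof -
  have "lborel = density (distr lborel borel (\<lambda>y. x - y)) (\<lambda>_. 1)"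
    using lborel_affine[of "-1" x] by simp
  then show ?thesis by (simp add: density_1)
qed

lemma integral_lborel_reflect:
  fixes f :: "'a::euclidean_space \<Rightarrow> real"
  assumes "f \<in> borel_measurable borel"
  shows "(LINT y|lborel. f (x - y)) = (LINT y|lborel. f y)"
  by (subst (2) lborel_distr_reflect[of x, symmetric]) (simp add: integral_distr assms)

lemma integrable_lborel_reflect:
  fixes f :: "'a::euclidean_space \<Rightarrow> real"
  assumes "integrable lborel f"
  shows "integrable lborel (\<lambda>y. f (x - y))"
proof -
  have "integrable (distr lborel borel (\<lambda>y. x - y)) f" using assms by (simp add: lborel_distr_reflect)
  then show ?thesis by (subst (asm) integrable_distr_eq) (use assms in auto)
qed

text \<open>The heat kernel is the joint density of independent centred normal variables of variance
  \<open>2 * \<beta> * t\<close>, which reduces its total mass to the one-dimensional case.\<close>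

lemma heat_kernel_prod:
  fixes z :: "real ^ 'n::finite"
  assumes "\<beta> > 0" "t > 0"
  shows "heat_kernel \<beta> t z = (\<Prod>b\<in>Basis. normal_density 0 (sqrt (2 * \<beta> * t)) (z \<bullet> b))"
proof -
  have "normal_density 0 (sqrt (2 * \<beta> * t)) x = (4 * pi * \<beta> * t) powr (- 1 / 2) * exp (- x\<^sup>2 / (4 * \<beta> * t))" for x
    using assms by (simp add: normal_density_def powr_minus_divide powr_half_sqrt mult_ac)
  then have "(\<Prod>b\<in>Basis. normal_density 0 (sqrt (2 * \<beta> * t)) (z \<bullet> b)) =
    (\<Prod>b\<in>(Basis::(real ^ 'n) set). (4 * pi * \<beta> * t) powr (- 1 / 2)) * exp (\<Sum>b\<in>Basis. - (z \<bullet> b)\<^sup>2 / (4 * \<beta> * t))"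
    by (simp add: prod.distrib exp_sum)
  also have "(\<Prod>b\<in>(Basis::(real ^ 'n) set). (4 * pi * \<beta> * t) powr (- 1 / 2)) = (4 * pi * \<beta> * t) powr (- real CARD('n) / 2)"
    using assms by (simp add: powr_realpow[symmetric] powr_powr)
  also have "(\<Sum>b\<in>Basis. - (z \<bullet> b)\<^sup>2 / (4 * \<beta> * t)) = - (norm z)\<^sup>2 / (4 * \<beta> * t)"
    unfolding power2_norm_eq_inner euclidean_inner[of z z] by (simp add: sum_divide_distrib sum_negf power2_eq_square)
  finally show ?thesis by (simp add: heat_kernel_def)
qed

lemma heat_kernel_pos: "\<beta> > 0 \<Longrightarrow> t > 0 \<Longrightarrow> heat_kernel \<beta> t z > 0"
  by (simp add: heat_kernel_def)

lemma has_bochner_integral_heat_kernel: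
  assumes "\<beta> > 0" "t > 0"
  shows "has_bochner_integral lborel (heat_kernel \<beta> t :: real ^ 'n::finite \<Rightarrow> real) 1"
proof (rule has_bochner_integral_nn_integral)
  have [simp]: "heat_kernel \<beta> t = (\<lambda>z :: real ^ 'n. \<Prod>b\<in>Basis. normal_density 0 (sqrt (2 * \<beta> * t)) (z \<bullet> b))"
    by (rule ext) (rule heat_kernel_prod[OF assms])
  show "(heat_kernel \<beta> t :: real ^ 'n \<Rightarrow> real) \<in> borel_measurable lborel" by simp
  have "(\<integral>\<^sup>+ x. ennreal (normal_density 0 (sqrt (2 * \<beta> * t)) x) \<partial>lborel) = 1"
    using assms by (subst nn_integral_eq_integral) auto
  moreover have "(\<integral>\<^sup>+ z. ennreal (heat_kernel \<beta> t (z :: real ^ 'n)) \<partial>lborel) =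
    (\<integral>\<^sup>+ z. (\<Prod>b\<in>Basis. ennreal (normal_density 0 (sqrt (2 * \<beta> * t)) ((z :: real ^ 'n) \<bullet> b))) \<partial>lborel)"
    by (simp add: prod_ennreal)
  ultimately show "(\<integral>\<^sup>+ z. ennreal (heat_kernel \<beta> t (z :: real ^ 'n)) \<partial>lborel) = ennreal 1"
    by (simp add: nn_integral_lborel_prod[where f = "\<lambda>_ x. ennreal (normal_density 0 (sqrt (2 * \<beta> * t)) x)"])
qed (use assms in \<open>auto intro!: AE_I2 less_imp_le heat_kernel_pos\<close>)

lemma integrable_gaussian:
  fixes c :: real
  assumes "c > 0"
  shows "integrable lborel (\<lambda>z :: real ^ 'n::finite. exp (- c * (norm z)\<^sup>2))"
proof -
  \<comment> \<open>With \<open>\<beta> = 1 / (4 * c)\<close> and \<open>t = 1\<close> the exponent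
    of the heat kernel is \<open>- c * (norm z)\<^sup>2\<close>.\<close>
  have "integrable lborel (\<lambda>z :: real ^ 'n. heat_kernel (1 / (4 * c)) 1 z / (4 * pi * (1 / (4 * c)) * 1) powr (- real CARD('n) / 2))"
    using has_bochner_integral_heat_kernel[of "1 / (4 * c)" 1] assms
    by (intro integrable_divide) (auto simp: has_bochner_integral_iff)
  then show ?thesis using assms by (simp add: heat_kernel_def mult.commute)
qed

text \<open>Half of the Gaussian decay pays for the exponential growth, by completing the square in
  \<open>c * s - B\<close>.\<close>

lemma gaussian_absorbs_exp:
  fixes c B s :: real
  assumes "c > 0"
  shows "exp (- c * s\<^sup>2 + B * s) \<le> exp (B\<^sup>2 / (2 * c)) * exp (- (c / 2) * s\<^sup>2)"
proof -
  have "0 \<le> (c * s - B)\<^sup>2 / (2 * c)" using assms by simp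
  also have "\<dots> = c / 2 * s\<^sup>2 - B * s + B\<^sup>2 / (2 * c)"
    using assms by (simp add: power2_eq_square field_simps)
  finally show ?thesis unfolding exp_add[symmetric] by (simp add: field_simps)
qed

lemma integrable_gaussian_exp:
  fixes c B :: real
  assumes "c > 0"
  shows "integrable lborel (\<lambda>z :: real ^ 'n::finite. exp (- c * (norm z)\<^sup>2 + B * norm z))"
proof (rule Bochner_Integration.integrable_bound)
  show "integrable lborel (\<lambda>z :: real ^ 'n. exp (B\<^sup>2 / (2 * c)) * exp (- (c / 2) * (norm z)\<^sup>2))"
    by (intro integrable_mult_right integrable_gaussian) (use assms in simp)
qed (use gaussian_absorbs_exp[OF assms] in \<open>auto intro!: AE_I2\<close>)

text \<open>Half of the Gaussian decay absorbs the factor \<open>s\<close>, since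
  \<open>s \<le> 1 + s\<^sup>2\<close> and a multiple of \<open>1 + c / 2 * s\<^sup>2\<close> lies
  below an exponential.\<close>

lemma norm_le_gaussian:
  fixes c s :: real
  assumes "c > 0" "s \<ge> 0"
  shows "s * exp (- c * s\<^sup>2) \<le> (1 + 2 / c) * exp (- (c / 2) * s\<^sup>2)"
proof -
  have "s \<le> 1 + s\<^sup>2" using sum_power2_ge_zero[of "s - 1" 0] sum_squares_bound[of s 1] assms by (simp add: power2_eq_square)
  also have "\<dots> \<le> (1 + 2 / c) * (1 + c / 2 * s\<^sup>2)" using assms by (simp add: field_simps)
  also have "\<dots> \<le> (1 + 2 / c) * exp (c / 2 * s\<^sup>2)"
    using assms by (intro mult_left_mono exp_ge_add_one_self) auto
  finally have "s * exp (- c * s\<^sup>2) \<le> (1 + 2 / c) * exp (c / 2 * s\<^sup>2) * exp (- c * s\<^sup>2)"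
    by (intro mult_right_mono) auto
  also have "\<dots> = (1 + 2 / c) * exp (- (c / 2) * s\<^sup>2)"
    by (simp add: mult.assoc exp_add[symmetric] field_simps)
  finally show ?thesis .
qed

text \<open>On a time interval away from 0 a division by time costs a constant factor and a
  coordinate costs half of the decay rate. This is the domination used for all integrals
  below.\<close>

lemma gaussian_kernels_bound:
  fixes k :: "real \<times> (real ^ 'n::finite) \<Rightarrow> real"
  assumes \<beta>: "\<beta> > 0" and ab: "0 < a" "a \<le> b" and k: "k \<in> gaussian_kernels \<beta>"
  shows "\<exists>C\<ge>0. \<exists>c>0. \<forall>t z. a \<le> t \<longrightarrow> t \<le> b \<longrightarrow> \<bar>k (t, z)\<bar> \<le> C * exp (- c * (norm z)\<^sup>2)"
  using k
proof (induction rule: gaussian_kernels.induct)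
  case heat
  show ?case
  proof (intro exI conjI allI impI)
    show "(4 * pi * \<beta> * a) powr (- real CARD('n) / 2) \<ge> 0" by simp
    show "1 / (4 * \<beta> * b) > 0" using \<beta> ab by simp
    fix t :: real and z :: "real ^ 'n" assume t: "a \<le> t" "t \<le> b"
    have "(4 * pi * \<beta> * t) powr (- real CARD('n) / 2) \<le> (4 * pi * \<beta> * a) powr (- real CARD('n) / 2)"
      using t \<beta> ab by (intro powr_mono2') auto
    moreover have "- (norm z)\<^sup>2 / (4 * \<beta> * t) \<le> - (1 / (4 * \<beta> * b)) * (norm z)\<^sup>2"
      using t \<beta> ab by (simp add: frac_le)
    ultimately show "\<bar>heat_kernel \<beta> (fst (t, z)) (snd (t, z))\<bar>
      \<le> (4 * pi * \<beta> * a) powr (- real CARD('n) / 2) * exp (- (1 / (4 * \<beta> * b)) * (norm z)\<^sup>2)"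
      unfolding heat_kernel_def fst_conv snd_conv abs_mult abs_exp_cancel
      by (intro mult_mono) auto
  qed
next
  case (coordinate k i)
  then obtain C c where C: "C \<ge> 0" "c > 0"
    and b: "\<And>t z. a \<le> t \<Longrightarrow> t \<le> b \<Longrightarrow> \<bar>k (t, z)\<bar> \<le> C * exp (- c * (norm z)\<^sup>2)" by blast
  show ?case
  proof (intro exI conjI allI impI)
    show "C * (1 + 2 / c) \<ge> 0" "c / 2 > 0" using C by auto
    fix t :: real and z :: "real ^ 'n" assume t: "a \<le> t" "t \<le> b"
    have "\<bar>snd (t, z) $ i * k (t, z)\<bar> \<le> norm z * (C * exp (- c * (norm z)\<^sup>2))"
      unfolding abs_mult snd_conv using b[OF t, of z] component_le_norm_cart[of z i]
      by (intro mult_mono) auto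
    also have "\<dots> = C * (norm z * exp (- c * (norm z)\<^sup>2))" by simp
    also have "\<dots> \<le> C * ((1 + 2 / c) * exp (- (c / 2) * (norm z)\<^sup>2))"
      using C by (intro mult_left_mono norm_le_gaussian) auto
    finally show "\<bar>snd (t, z) $ i * k (t, z)\<bar> \<le> C * (1 + 2 / c) * exp (- (c / 2) * (norm z)\<^sup>2)"
      by (simp add: mult.assoc)
  qed
next
  case (over_time k)
  then obtain C c where C: "C \<ge> 0" "c > 0"
    and b: "\<And>t z. a \<le> t \<Longrightarrow> t \<le> b \<Longrightarrow> \<bar>k (t, z)\<bar> \<le> C * exp (- c * (norm z)\<^sup>2)" by blast
  show ?case
  proof (intro exI conjI allI impI)
    show "C / a \<ge> 0" "c > 0" using C ab by auto
    fix t :: real and z :: "real ^ 'n" assume t: "a \<le> t" "t \<le> b"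
    have "\<bar>k (t, z)\<bar> / \<bar>t\<bar> \<le> (C * exp (- c * (norm z)\<^sup>2)) / a"
      using b[OF t, of z] t ab C by (intro frac_le) auto
    then show "\<bar>k (t, z) / fst (t, z)\<bar> \<le> C / a * exp (- c * (norm z)\<^sup>2)" by simp
  qed
next
  case (scale k d)
  then obtain C c where C: "C \<ge> 0" "c > 0"
    and b: "\<And>t z. a \<le> t \<Longrightarrow> t \<le> b \<Longrightarrow> \<bar>k (t, z)\<bar> \<le> C * exp (- c * (norm z)\<^sup>2)" by blast
  show ?case
  proof (intro exI conjI allI impI)
    show "\<bar>d\<bar> * C \<ge> 0" "c > 0" using C by auto
    fix t :: real and z :: "real ^ 'n" assume t: "a \<le> t" "t \<le> b"
    show "\<bar>d * k (t, z)\<bar> \<le> \<bar>d\<bar> * C * exp (- c * (norm z)\<^sup>2)"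
      using b[OF t, of z] by (simp add: abs_mult mult.assoc mult_left_mono)
  qed
next
  case (add k k')
  then obtain C c where C: "C \<ge> 0" "c > 0"
    and b: "\<And>t z. a \<le> t \<Longrightarrow> t \<le> b \<Longrightarrow> \<bar>k (t, z)\<bar> \<le> C * exp (- c * (norm z)\<^sup>2)" by blast
  from add obtain C' c' where C': "C' \<ge> 0" "c' > 0"
    and b': "\<And>t z. a \<le> t \<Longrightarrow> t \<le> b \<Longrightarrow> \<bar>k' (t, z)\<bar> \<le> C' * exp (- c' * (norm z)\<^sup>2)" by blast
  show ?case
  proof (intro exI conjI allI impI)
    show "C + C' \<ge> 0" "min c c' > 0" using C C' by auto
    fix t :: real and z :: "real ^ 'n" assume t: "a \<le> t" "t \<le> b"
    have "C * exp (- c * (norm z)\<^sup>2) \<le> C * exp (- min c c' * (norm z)\<^sup>2)"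
      "C' * exp (- c' * (norm z)\<^sup>2) \<le> C' * exp (- min c c' * (norm z)\<^sup>2)"
      using C C' by (auto intro!: mult_left_mono mult_right_mono)
    then show "\<bar>k (t, z) + k' (t, z)\<bar> \<le> (C + C') * exp (- min c c' * (norm z)\<^sup>2)"
      using b[OF t, of z] b'[OF t, of z] unfolding distrib_right by linarith
  qed
next
  case (cong k k')
  have "k' (t, z) = k (t, z)" if "a \<le> t" for t z using cong.hyps(2)[of "(t, z)"] that ab by simp
  with cong.IH show ?case by metis
qed

lemma finite_gaussian_kernels_bound:
  fixes K :: "(real \<times> (real ^ 'n::finite) \<Rightarrow> real) set"
  assumes \<beta>: "\<beta> > 0" and ab: "0 < a" "a \<le> b" and "finite K" "K \<subseteq> gaussian_kernels \<beta>"
  shows "\<exists>C\<ge>0. \<exists>c>0. \<forall>k\<in>K. \<forall>t z. a \<le> t \<longrightarrow> t \<le> b \<longrightarrow> \<bar>k (t, z)\<bar> \<le> C * exp (- c * (norm z)\<^sup>2)"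
  using assms(4,5)
proof (induction K rule: finite_induct)
  case empty
  show ?case by (intro exI[of _ 0] conjI exI[of _ 1]) auto
next
  case (insert k K)
  obtain C c where C: "C \<ge> 0" "c > 0"
    and b: "\<And>t z. a \<le> t \<Longrightarrow> t \<le> b \<Longrightarrow> \<bar>k (t, z)\<bar> \<le> C * exp (- c * (norm z)\<^sup>2)"
    using gaussian_kernels_bound[OF \<beta> ab, of k] insert.prems by blast
  obtain C' c' where C': "C' \<ge> 0" "c' > 0"
    and b': "\<And>k t z. k \<in> K \<Longrightarrow> a \<le> t \<Longrightarrow> t \<le> b \<Longrightarrow> \<bar>k (t, z)\<bar> \<le> C' * exp (- c' * (norm z)\<^sup>2)"
    using insert by blast
  have "\<bar>k' (t, z)\<bar> \<le> (C + C') * exp (- min c c' * (norm z)\<^sup>2)"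
    if "k' \<in> insert k K" "a \<le> t" "t \<le> b" for k' t z
  proof -
    have "C * exp (- c * (norm z)\<^sup>2) \<le> (C + C') * exp (- min c c' * (norm z)\<^sup>2)"
      "C' * exp (- c' * (norm z)\<^sup>2) \<le> (C + C') * exp (- min c c' * (norm z)\<^sup>2)"
      using C C' by (auto intro!: mult_mono mult_right_mono)
    then show ?thesis using b[of t z] b'[of k' t z] that by fastforce
  qed
  moreover have "C + C' \<ge> 0" "min c c' > 0" using C C' by auto
  ultimately show ?case by blast
qed

section \<open>Convolution with data of exponential growth\<close>

definition kernel_conv ::
  "(real \<times> (real ^ 'n::finite) \<Rightarrow> real) \<Rightarrow> (real ^ 'n \<Rightarrow> real) \<Rightarrow> real \<times> (real ^ 'n) \<Rightarrow> real" where
  "kernel_conv k G p = (LINT y|lborel. k (fst p, snd p - y) * G y)"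

text \<open>A growth class holding both Lipschitz functions and their exponentials, small enough for
  every kernel of the class to be integrable against it.\<close>

definition exp_bounded :: "(real ^ 'n::finite \<Rightarrow> real) \<Rightarrow> bool" where
  "exp_bounded G \<longleftrightarrow> G \<in> borel_measurable borel \<and> (\<exists>A\<ge>0. \<exists>B\<ge>0. \<forall>y. \<bar>G y\<bar> \<le> A * exp (B * norm y))"

lemma integrable_gaussian_times_exp_bounded:
  fixes G :: "real ^ 'n::finite \<Rightarrow> real"
  assumes G: "exp_bounded G" and c: "c > 0"
  shows "integrable lborel (\<lambda>y. exp (- c * (norm (x - y))\<^sup>2) * \<bar>G y\<bar>)"
proof -
  obtain A B where AB: "A \<ge> 0" "B \<ge> 0" and b: "\<And>y. \<bar>G y\<bar> \<le> A * exp (B * norm y)"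
    and [measurable]: "G \<in> borel_measurable borel"
    using G by (auto simp: exp_bounded_def)
  have int: "integrable lborel (\<lambda>y. A * exp (B * norm x) * exp (- c * (norm (x - y))\<^sup>2 + B * norm (x - y)))"
    by (intro integrable_mult_right integrable_lborel_reflect[of "\<lambda>z. exp (- c * (norm z)\<^sup>2 + B * norm z)"]
        integrable_gaussian_exp c)
  show ?thesis
  proof (rule Bochner_Integration.integrable_bound[OF int], measurable, intro AE_I2)
    fix y :: "real ^ 'n"
    \<comment> \<open>Measuring the growth of \<open>G\<close> from \<open>x\<close> instead of 0
      costs the constant factor \<open>exp (B * norm x)\<close>.\<close>
    have "norm y \<le> norm x + norm (x - y)" by (metis norm_triangle_sub add.commute norm_minus_commute)
    then have "B * norm y \<le> B * norm x + B * norm (x - y)" using AB by (metis distrib_left mult_left_mono)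
    then have "A * exp (B * norm y) \<le> A * exp (B * norm x + B * norm (x - y))"
      using AB by (intro mult_left_mono) auto
    then have "\<bar>G y\<bar> \<le> A * (exp (B * norm x) * exp (B * norm (x - y)))"
      using b[of y] by (simp add: exp_add)
    then have "exp (- c * (norm (x - y))\<^sup>2) * \<bar>G y\<bar> \<le>
       exp (- c * (norm (x - y))\<^sup>2) * (A * (exp (B * norm x) * exp (B * norm (x - y))))"
      by (intro mult_left_mono) auto
    then show "norm (exp (- c * (norm (x - y))\<^sup>2) * \<bar>G y\<bar>) \<le>
        norm (A * exp (B * norm x) * exp (- c * (norm (x - y))\<^sup>2 + B * norm (x - y)))"
      unfolding exp_add[of "- c * (norm (x - y))\<^sup>2"] using AB by (simp add: abs_mult mult_ac)
  qed
qed

lemma gaussian_kernels_measurable: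
  fixes k :: "real \<times> (real ^ 'n::finite) \<Rightarrow> real"
  assumes "\<beta> > 0" "k \<in> gaussian_kernels \<beta>" "t > 0"
  shows "(\<lambda>z. k (t, z)) \<in> borel_measurable borel"
proof -
  have "isCont k (t, z)" for z
    using gaussian_kernels_differentiable[OF assms(1,2), of "(t, z)"] assms(3)
    by (simp add: differentiable_imp_continuous_within)
  then have "isCont (\<lambda>z. k (t, z)) z" for z
    by (intro isCont_o2[where f = "\<lambda>z. (t, z)" and g = k] continuous_intros)
  then have "continuous_on UNIV (\<lambda>z. k (t, z))"
    by (simp add: continuous_at_imp_continuous_on)
  then show ?thesis by (rule borel_measurable_continuous_onI)
qed

lemma kernel_conv_integrable:
  fixes G :: "real ^ 'n::finite \<Rightarrow> real"
  assumes \<beta>: "\<beta> > 0" and k: "k \<in> gaussian_kernels \<beta>" and t: "t > 0" and G: "exp_bounded G"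
  shows "integrable lborel (\<lambda>y. k (t, x - y) * G y)"
proof -
  obtain C c where C: "C \<ge> 0" "c > 0" and b: "\<And>z. \<bar>k (t, z)\<bar> \<le> C * exp (- c * (norm z)\<^sup>2)"
    using gaussian_kernels_bound[OF \<beta> t order_refl k] by blast
  have [measurable]: "G \<in> borel_measurable borel" "(\<lambda>z. k (t, z)) \<in> borel_measurable borel"
    using G gaussian_kernels_measurable[OF \<beta> k t] by (auto simp: exp_bounded_def)
  have [measurable]: "(\<lambda>y. k (t, x - y)) \<in> borel_measurable borel"
    by (rule measurable_compose[of "\<lambda>y. x - y" _ borel "\<lambda>z. k (t, z)"]) auto
  have int: "integrable lborel (\<lambda>y. C * (exp (- c * (norm (x - y))\<^sup>2) * \<bar>G y\<bar>))"
    by (intro integrable_mult_right integrable_gaussian_times_exp_bounded G C)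
  show ?thesis
  proof (rule Bochner_Integration.integrable_bound[OF int], measurable, intro AE_I2)
    fix y
    show "norm (k (t, x - y) * G y) \<le> norm (C * (exp (- c * (norm (x - y))\<^sup>2) * \<bar>G y\<bar>))"
      using mult_right_mono[OF b[of "x - y"], of "\<bar>G y\<bar>"] C by (simp add: abs_mult mult.assoc)
  qed
qed

text \<open>The increment \<open>h\<close> moves time and space together;
  \<open>norm h \<le> t / 2\<close> keeps the time within \<open>t / 2\<close> and
  \<open>3 * t / 2\<close>, where the second derivatives share one Gaussian bound. The remainder has
  to decay in \<open>z\<close> so that it can be integrated against \<open>G\<close>.\<close>

lemma gaussian_kernels_taylor:
  fixes k :: "real \<times> (real ^ 'n::finite) \<Rightarrow> real"
  assumes \<beta>: "\<beta> > 0" and k: "k \<in> gaussian_kernels \<beta>" and t: "t > 0"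
  shows "\<exists>C\<ge>0. \<exists>c>0. \<forall>h z. norm h \<le> t / 2 \<longrightarrow>
    \<bar>k ((t, z) + h) - k (t, z) - (\<Sum>v\<in>Basis. (h \<bullet> v) * partial_deriv v k (t, z))\<bar>
      \<le> (norm h)\<^sup>2 * (C * exp (- c * (norm z)\<^sup>2))"
proof -
  let ?B = "Basis :: (real \<times> (real ^ 'n)) set"
  define D where "D v w = partial_deriv w (partial_deriv v k)" for v w
  have pk: "partial_deriv v k \<in> gaussian_kernels \<beta>" and D: "D v w \<in> gaussian_kernels \<beta>" for v w
    unfolding D_def by (intro gaussian_kernels_partial_deriv[OF \<beta>] k)+
  have "\<exists>C\<ge>0. \<exists>c>0. \<forall>f\<in>(\<lambda>(v, w). D v w) ` (?B \<times> ?B). \<forall>s z. t / 2 \<le> s \<longrightarrow> s \<le> 3 * t / 2 \<longrightarrow>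
      \<bar>f (s, z)\<bar> \<le> C * exp (- c * (norm z)\<^sup>2)"
    using t by (intro finite_gaussian_kernels_bound[OF \<beta>]) (auto intro: D)
  then obtain C c where C: "C \<ge> 0" "c > 0"
    and b: "\<And>v w s z. v \<in> ?B \<Longrightarrow> w \<in> ?B \<Longrightarrow> t / 2 \<le> s \<Longrightarrow> s \<le> 3 * t / 2 \<Longrightarrow>
      \<bar>D v w (s, z)\<bar> \<le> C * exp (- c * (norm z)\<^sup>2)"
    by (fastforce simp del: split_paired_All split_paired_Ex)
  define N where "N = real (card ?B)"
  \<comment> \<open>\<open>N * N\<close> counts the second partial derivatives, and the exponential
    is the price of recentring the Gaussian from the intermediate point to \<open>z\<close>.\<close>
  define C' where "C' = N * N * (C * exp (c * (t / 2)\<^sup>2))"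
  have "\<bar>k ((t, z) + h) - k (t, z) - (\<Sum>v\<in>?B. (h \<bullet> v) * partial_deriv v k (t, z))\<bar>
      \<le> (norm h)\<^sup>2 * (C' * exp (- (c / 2) * (norm z)\<^sup>2))" if h: "norm h \<le> t / 2" for h z
  proof -
    define \<theta>0 where "\<theta>0 s = k ((t, z) + s *\<^sub>R h)" for s
    define \<theta>1 where "\<theta>1 s = (\<Sum>v\<in>?B. (h \<bullet> v) * partial_deriv v k ((t, z) + s *\<^sub>R h))" for s
    define \<theta>2 where "\<theta>2 s = (\<Sum>v\<in>?B. (h \<bullet> v) * (\<Sum>w\<in>?B. (h \<bullet> w) * D v w ((t, z) + s *\<^sub>R h)))" for s
    have fst_h: "\<bar>fst h\<bar> \<le> t / 2" and snd_h: "norm (snd h) \<le> t / 2"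
      using h norm_fst_le[of "fst h" "snd h"] norm_snd_le[of "snd h" "fst h"] by auto
    have pos: "t / 2 \<le> fst ((t, z) + s *\<^sub>R h)" "fst ((t, z) + s *\<^sub>R h) \<le> 3 * t / 2" if "0 \<le> s" "s \<le> 1" for s
    proof -
      have "\<bar>s * fst h\<bar> \<le> \<bar>fst h\<bar>" using that by (simp add: abs_mult mult_left_le_one_le)
      then show "t / 2 \<le> fst ((t, z) + s *\<^sub>R h)" "fst ((t, z) + s *\<^sub>R h) \<le> 3 * t / 2"
        using fst_h by auto
    qed
    have line: "((\<lambda>s. f ((t, z) + s *\<^sub>R h)) has_real_derivative
        (\<Sum>v\<in>?B. (h \<bullet> v) * partial_deriv v f ((t, z) + s *\<^sub>R h))) (at s)"
      if f: "f \<in> gaussian_kernels \<beta>" and s: "0 \<le> s" "s \<le> 1" for f s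
    proof -
      have "((\<lambda>s. f ((t, z) + s *\<^sub>R h)) has_derivative
          (\<lambda>r. \<Sum>v\<in>?B. ((r *\<^sub>R h) \<bullet> v) * partial_deriv v f ((t, z) + s *\<^sub>R h))) (at s)"
      proof (rule has_derivative_compose[of "\<lambda>s. (t, z) + s *\<^sub>R h" _ _ _ f])
        show "((\<lambda>s. (t, z) + s *\<^sub>R h) has_derivative (\<lambda>r. r *\<^sub>R h)) (at s)"
          by (auto intro!: derivative_eq_intros)
        show "(f has_derivative (\<lambda>h'. \<Sum>v\<in>?B. (h' \<bullet> v) * partial_deriv v f ((t, z) + s *\<^sub>R h))) (at ((t, z) + s *\<^sub>R h))"
          using pos[OF s] t
          by (intro differentiable_has_derivative_partial gaussian_kernels_differentiable[OF \<beta> f]) linarith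
      qed
      then show ?thesis
        by (rule has_derivative_imp_has_field_derivative) (simp add: sum_distrib_left mult_ac)
    qed
    have d0: "(\<theta>0 has_real_derivative \<theta>1 s) (at s)" if "0 \<le> s" "s \<le> 1" for s
      unfolding \<theta>0_def \<theta>1_def by (rule line[OF k that])
    have d1: "(\<theta>1 has_real_derivative \<theta>2 s) (at s)" if "0 \<le> s" "s \<le> 1" for s
      unfolding \<theta>1_def \<theta>2_def D_def by (intro DERIV_sum DERIV_cmult line[OF pk that])
    define diff where "diff m = (if m = 0 then \<theta>0 else if m = 1 then \<theta>1 else \<theta>2)" for m :: nat
    \<comment> \<open>Taylor's formula with Lagrange remainder along the segment, where
      \<open>\<theta>1\<close> and \<open>\<theta>2\<close> are the first two derivatives of
      \<open>\<theta>0\<close>.\<close>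
    have "\<exists>s>0. s < 1 \<and> \<theta>0 1 = (\<Sum>m<2. diff m 0 / fact m * 1 ^ m) + diff 2 s / fact 2 * 1 ^ 2"
      using d0 d1 by (intro Maclaurin) (auto simp: diff_def less_Suc_eq numeral_2_eq_2)
    then obtain s where s: "0 < s" "s < 1" and eq: "\<theta>0 1 = \<theta>0 0 + \<theta>1 0 + \<theta>2 s / 2"
      by (auto simp: diff_def numeral_2_eq_2)
    have "\<bar>\<theta>2 s\<bar> \<le> (\<Sum>v\<in>?B. norm h * (\<Sum>w\<in>?B. norm h * (C * exp (- c * (norm (z + s *\<^sub>R snd h))\<^sup>2))))"
      unfolding \<theta>2_def
    proof (rule order.trans[OF sum_abs], rule sum_mono)
      fix v assume v: "v \<in> ?B"
      have "\<bar>\<Sum>w\<in>?B. (h \<bullet> w) * D v w ((t, z) + s *\<^sub>R h)\<bar>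
         \<le> (\<Sum>w\<in>?B. norm h * (C * exp (- c * (norm (z + s *\<^sub>R snd h))\<^sup>2)))"
      proof (rule order.trans[OF sum_abs], rule sum_mono)
        fix w assume w: "w \<in> ?B"
        have "\<bar>D v w ((t, z) + s *\<^sub>R h)\<bar> \<le> C * exp (- c * (norm (z + s *\<^sub>R snd h))\<^sup>2)"
          using b[OF v w pos, of s "z + s *\<^sub>R snd h"] s by (simp add: plus_prod_def scaleR_prod_def)
        then show "\<bar>(h \<bullet> w) * D v w ((t, z) + s *\<^sub>R h)\<bar> \<le> norm h * (C * exp (- c * (norm (z + s *\<^sub>R snd h))\<^sup>2))"
          unfolding abs_mult using Basis_le_norm[OF w, of h] C by (intro mult_mono) auto
      qed
      then show "\<bar>(h \<bullet> v) * (\<Sum>w\<in>?B. (h \<bullet> w) * D v w ((t, z) + s *\<^sub>R h))\<bar>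
         \<le> norm h * (\<Sum>w\<in>?B. norm h * (C * exp (- c * (norm (z + s *\<^sub>R snd h))\<^sup>2)))"
        unfolding abs_mult using Basis_le_norm[OF v, of h] C
        by (intro mult_mono) (auto intro!: sum_nonneg mult_nonneg_nonneg)
    qed
    also have "\<dots> = (norm h)\<^sup>2 * (N * N * (C * exp (- c * (norm (z + s *\<^sub>R snd h))\<^sup>2)))"
      by (simp add: N_def power2_eq_square mult_ac)
    also have "\<dots> \<le> (norm h)\<^sup>2 * (C' * exp (- (c / 2) * (norm z)\<^sup>2))"
    proof -
      \<comment> \<open>From \<open>(x + y)\<^sup>2 \<le> 2 * x\<^sup>2 + 2 * y\<^sup>2\<close>:
        replacing the intermediate point by \<open>z\<close> halves the decay rate.\<close>
      have "norm z \<le> norm (z + s *\<^sub>R snd h) + t / 2"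
      proof -
        have "norm z \<le> norm (z + s *\<^sub>R snd h) + norm (s *\<^sub>R snd h)"
          by (metis norm_triangle_ineq4 add_diff_cancel)
        moreover have "norm (s *\<^sub>R snd h) \<le> norm (snd h)" using s by (simp add: mult_left_le_one_le)
        ultimately show ?thesis using snd_h by linarith
      qed
      then have "(norm z)\<^sup>2 \<le> (norm (z + s *\<^sub>R snd h) + t / 2)\<^sup>2" by (intro power_mono) auto
      also have "\<dots> \<le> 2 * (norm (z + s *\<^sub>R snd h))\<^sup>2 + 2 * (t / 2)\<^sup>2"
        using sum_squares_bound[of "norm (z + s *\<^sub>R snd h)" "t / 2"] by (simp add: power2_sum)
      finally have "c / 2 * (norm z)\<^sup>2 \<le> c / 2 * (2 * (norm (z + s *\<^sub>R snd h))\<^sup>2 + 2 * (t / 2)\<^sup>2)"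
        using C by (intro mult_left_mono) auto
      then have "- c * (norm (z + s *\<^sub>R snd h))\<^sup>2 \<le> c * (t / 2)\<^sup>2 + (- (c / 2) * (norm z)\<^sup>2)"
        by (simp add: algebra_simps)
      then have "exp (- c * (norm (z + s *\<^sub>R snd h))\<^sup>2) \<le> exp (c * (t / 2)\<^sup>2) * exp (- (c / 2) * (norm z)\<^sup>2)"
        by (simp only: exp_add[symmetric] exp_le_cancel_iff)
      then have "N * N * (C * exp (- c * (norm (z + s *\<^sub>R snd h))\<^sup>2)) \<le>
        N * N * (C * (exp (c * (t / 2)\<^sup>2) * exp (- (c / 2) * (norm z)\<^sup>2)))"
        using C by (intro mult_left_mono) (auto simp: N_def)
      then show ?thesis by (intro mult_left_mono) (simp_all add: C'_def mult.assoc)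
    qed
    finally have "\<bar>\<theta>2 s / 2\<bar> \<le> (norm h)\<^sup>2 * (C' * exp (- (c / 2) * (norm z)\<^sup>2))" by simp
    moreover have "k ((t, z) + h) - k (t, z) - (\<Sum>v\<in>?B. (h \<bullet> v) * partial_deriv v k (t, z)) = \<theta>2 s / 2"
      using eq by (simp add: \<theta>0_def \<theta>1_def)
    ultimately show ?thesis by simp
  qed
  moreover have "C' \<ge> 0" "c / 2 > 0" using C by (auto simp: C'_def N_def)
  ultimately show ?thesis by blast
qed

text \<open>Integrating the second-order Taylor bound of the kernel differentiates under the integral sign.\<close>

lemma kernel_conv_has_derivative:
  fixes G :: "real ^ 'n::finite \<Rightarrow> real"
  assumes \<beta>: "\<beta> > 0" and k: "k \<in> gaussian_kernels \<beta>" and p: "fst p > 0" and G: "exp_bounded G"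
  shows "(kernel_conv k G has_derivative (\<lambda>h. \<Sum>v\<in>Basis. (h \<bullet> v) * kernel_conv (partial_deriv v k) G p)) (at p)"
proof -
  let ?B = "Basis :: (real \<times> (real ^ 'n)) set"
  obtain t x where p_eq: "p = (t, x)" by (cases p)
  have t: "t > 0" using p p_eq by simp
  obtain C c where C: "C \<ge> 0" "c > 0"
    and taylor: "\<And>h z. norm h \<le> t / 2 \<Longrightarrow>
      \<bar>k ((t, z) + h) - k (t, z) - (\<Sum>v\<in>?B. (h \<bullet> v) * partial_deriv v k (t, z))\<bar>
      \<le> (norm h)\<^sup>2 * (C * exp (- c * (norm z)\<^sup>2))"
    using gaussian_kernels_taylor[OF \<beta> k t] by blast
  have pk: "partial_deriv v k \<in> gaussian_kernels \<beta>" for v by (intro gaussian_kernels_partial_deriv[OF \<beta>] k)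
  \<comment> \<open>The Gaussian remainder integrated against \<open>\<bar>G\<bar>\<close>: the
    coefficient of the quadratic error of the convolution.\<close>
  define I where "I = C * (LINT y|lborel. exp (- c * (norm (x - y))\<^sup>2) * \<bar>G y\<bar>)"
  have I: "I \<ge> 0" using C by (simp add: I_def)
  have est: "\<bar>kernel_conv k G (p + h) - kernel_conv k G p - (\<Sum>v\<in>?B. (h \<bullet> v) * kernel_conv (partial_deriv v k) G p)\<bar>
      \<le> (norm h)\<^sup>2 * I" if h: "norm h \<le> t / 2" for h
  proof -
    have "\<bar>fst h\<bar> \<le> t / 2" using h norm_fst_le[of "fst h" "snd h"] by auto
    then have pos: "t + fst h > 0" using t by linarith
    have int1: "integrable lborel (\<lambda>y. k (t + fst h, (x + snd h) - y) * G y)"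
      by (rule kernel_conv_integrable[OF \<beta> k pos G])
    have int2: "integrable lborel (\<lambda>y. k (t, x - y) * G y)"
      by (rule kernel_conv_integrable[OF \<beta> k t G])
    have int3: "integrable lborel (\<lambda>y. (h \<bullet> v) * (partial_deriv v k (t, x - y) * G y))" for v
      by (intro integrable_mult_right kernel_conv_integrable[OF \<beta> pk t G])
    have "kernel_conv k G (p + h) - kernel_conv k G p - (\<Sum>v\<in>?B. (h \<bullet> v) * kernel_conv (partial_deriv v k) G p)
      = (LINT y|lborel. k (t + fst h, (x + snd h) - y) * G y - k (t, x - y) * G y
          - (\<Sum>v\<in>?B. (h \<bullet> v) * (partial_deriv v k (t, x - y) * G y)))"
      using int1 int2 int3 by (simp add: kernel_conv_def p_eq)
    also have "\<dots> = (LINT y|lborel. (k ((t, x - y) + h) - k (t, x - y) -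
        (\<Sum>v\<in>?B. (h \<bullet> v) * partial_deriv v k (t, x - y))) * G y)"
      by (intro Bochner_Integration.integral_cong refl)
        (simp add: plus_prod_def algebra_simps sum_distrib_left)
    also have "\<bar>\<dots>\<bar> \<le> (LINT y|lborel. (norm h)\<^sup>2 * (C * (exp (- c * (norm (x - y))\<^sup>2) * \<bar>G y\<bar>)))"
    proof (rule Bochner_Integration.integral_abs_bound_integral)
      have "integrable lborel (\<lambda>y. k (t + fst h, (x + snd h) - y) * G y - k (t, x - y) * G y
          - (\<Sum>v\<in>?B. (h \<bullet> v) * (partial_deriv v k (t, x - y) * G y)))"
        by (intro Bochner_Integration.integrable_diff Bochner_Integration.integrable_sum int1 int2 int3)
      then show "integrable lborel (\<lambda>y. (k ((t, x - y) + h) - k (t, x - y) -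
        (\<Sum>v\<in>?B. (h \<bullet> v) * partial_deriv v k (t, x - y))) * G y)"
        by (rule Bochner_Integration.integrable_cong[THEN iffD1, rotated -1])
          (simp_all add: plus_prod_def algebra_simps sum_distrib_left)
      show "integrable lborel (\<lambda>y. (norm h)\<^sup>2 * (C * (exp (- c * (norm (x - y))\<^sup>2) * \<bar>G y\<bar>)))"
        using integrable_gaussian_times_exp_bounded[OF G C(2), of x]
        by (intro integrable_mult_right) simp
      fix y
      show "\<bar>(k ((t, x - y) + h) - k (t, x - y) -
        (\<Sum>v\<in>?B. (h \<bullet> v) * partial_deriv v k (t, x - y))) * G y\<bar>
        \<le> (norm h)\<^sup>2 * (C * (exp (- c * (norm (x - y))\<^sup>2) * \<bar>G y\<bar>))"
        using mult_right_mono[OF taylor[OF h, of "x - y"], of "\<bar>G y\<bar>"] by (simp add: abs_mult mult.assoc)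
    qed
    also have "\<dots> = (norm h)\<^sup>2 * I" by (simp add: I_def)
    finally show ?thesis .
  qed
  show ?thesis
    unfolding has_derivative_at_alt
  proof (intro conjI allI impI)
    show "bounded_linear (\<lambda>h. \<Sum>v\<in>?B. (h \<bullet> v) * kernel_conv (partial_deriv v k) G p)"
      by (intro bounded_linear_sum bounded_linear_mult_const bounded_linear_inner_left)
    fix e :: real assume e: "e > 0"
    \<comment> \<open>The first entry permits the quadratic estimate, the second turns it into one
      of size \<open>e * norm (q - p)\<close>.\<close>
    define d where "d = min (t / 2) (e / (I + 1))"
    have d: "d > 0" using t e I by (simp add: d_def)
    have "\<bar>kernel_conv k G q - kernel_conv k G p - (\<Sum>v\<in>?B. ((q - p) \<bullet> v) * kernel_conv (partial_deriv v k) G p)\<bar>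
        \<le> e * norm (q - p)" if q: "norm (q - p) < d" for q
    proof -
      have "\<bar>kernel_conv k G (p + (q - p)) - kernel_conv k G p - (\<Sum>v\<in>?B. ((q - p) \<bullet> v) * kernel_conv (partial_deriv v k) G p)\<bar>
        \<le> (norm (q - p))\<^sup>2 * I" using q by (intro est) (simp add: d_def)
      also have "\<dots> = (I * norm (q - p)) * norm (q - p)" by (simp add: power2_eq_square)
      also have "\<dots> \<le> e * norm (q - p)"
      proof (rule mult_right_mono)
        have "I * norm (q - p) \<le> (I + 1) * (e / (I + 1))"
          using q I by (intro mult_mono) (auto simp: d_def)
        then show "I * norm (q - p) \<le> e" using I by simp
      qed simp
      finally show ?thesis by simp
    qed
    then show "\<exists>d>0. \<forall>y. norm (y - p) < d \<longrightarrow> norm (kernel_conv k G y - kernel_conv k G p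
       - (\<Sum>v\<in>?B. ((y - p) \<bullet> v) * kernel_conv (partial_deriv v k) G p)) \<le> e * norm (y - p)"
      unfolding real_norm_def using d by blast
  qed
qed

lemma partial_deriv_kernel_conv:
  fixes G :: "real ^ 'n::finite \<Rightarrow> real"
  assumes "\<beta> > 0" and "k \<in> gaussian_kernels \<beta>" and "fst p > 0" and "exp_bounded G" and "v \<in> Basis"
  shows "partial_deriv v (kernel_conv k G) p = kernel_conv (partial_deriv v k) G p"
  using partial_deriv_eq_has_derivative[OF kernel_conv_has_derivative[OF assms(1-4)], of v] assms(5)
  by (simp add: inner_Basis if_distrib[of "\<lambda>c. c * _"] cong: if_cong)

section \<open>Calculus of \<open>C_k\<close>\<close>

lemma C_k_cong:
  assumes "open S" and "\<And>x. x \<in> S \<Longrightarrow> f x = g x"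
  shows "C_k m f S \<longleftrightarrow> C_k m g S"
  using assms(2)
proof (induction m arbitrary: f g)
  case 0
  then show ?case using continuous_on_cong[of S S f g] by simp
next
  case (Suc m)
  have "f differentiable at x \<longleftrightarrow> g differentiable at x" if "x \<in> S" for x
    by (rule differentiable_cong_open[OF assms(1) that Suc.prems])
  moreover have "C_k m (partial_deriv v f) S \<longleftrightarrow> C_k m (partial_deriv v g) S" for v
    by (rule Suc.IH) (rule partial_deriv_cong_open[OF assms(1) _ Suc.prems])
  ultimately show ?case by simp
qed

text \<open>\<open>C_k (Suc m)\<close> does not list the continuity of \<open>f\<close> itself;
  differentiability supplies it at the bottom of the recursion.\<close>

lemma C_k_Suc_imp: "C_k (Suc m) f S \<Longrightarrow> C_k m f S"
proof (induction m arbitrary: f)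
  case 0
  then show ?case
    by (auto intro!: continuous_at_imp_continuous_on differentiable_imp_continuous_within)
next
  case (Suc m)
  then show ?case unfolding C_k.simps(2)[of "Suc m"] C_k.simps(2)[of m f S] by blast
qed

lemma C_k_add:
  assumes "open S" "C_k m f S" "C_k m g S"
  shows "C_k m (\<lambda>x. f x + g x) S"
  using assms(2,3)
proof (induction m arbitrary: f g)
  case 0
  then show ?case by (simp add: continuous_on_add)
next
  case (Suc m)
  have "C_k m (partial_deriv v (\<lambda>x. f x + g x)) S" if v: "v \<in> Basis" for v
  proof -
    have eq: "partial_deriv v (\<lambda>x. f x + g x) x = partial_deriv v f x + partial_deriv v g x" if "x \<in> S" for x
    proof -
      have fg: "f differentiable at x" "g differentiable at x" using Suc.prems that by auto
      note d = fg[THEN differentiable_has_derivative_partial]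
      show ?thesis
        using partial_deriv_eq_has_derivative[OF has_derivative_add[OF d], of v]
          partial_deriv_eq_has_derivative[OF d(1), of v] partial_deriv_eq_has_derivative[OF d(2), of v] by simp
    qed
    have "C_k m (partial_deriv v f) S" "C_k m (partial_deriv v g) S" using Suc.prems v by auto
    from C_k_cong[OF assms(1) eq, THEN iffD2, OF _ Suc.IH[OF this]] show ?thesis by simp
  qed
  then show ?case using Suc.prems by auto
qed

lemma C_k_mult:
  assumes "open S" "C_k m f S" "C_k m g S"
  shows "C_k m (\<lambda>x. f x * g x) S"
  using assms(2,3)
proof (induction m arbitrary: f g)
  case 0
  then show ?case by (simp add: continuous_on_mult)
next
  case (Suc m)
  have "C_k m (partial_deriv v (\<lambda>x. f x * g x)) S" if v: "v \<in> Basis" for v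
  proof -
    have eq: "partial_deriv v (\<lambda>x. f x * g x) x = f x * partial_deriv v g x + partial_deriv v f x * g x" if "x \<in> S" for x
    proof -
      have fg: "f differentiable at x" "g differentiable at x" using Suc.prems that by auto
      note d = fg[THEN differentiable_has_derivative_partial]
      show ?thesis
        using partial_deriv_eq_has_derivative[OF has_derivative_mult[OF d], of v]
          partial_deriv_eq_has_derivative[OF d(1), of v] partial_deriv_eq_has_derivative[OF d(2), of v] by simp
    qed
    have "C_k m (partial_deriv v f) S" "C_k m (partial_deriv v g) S" using Suc.prems v by auto
    then have "C_k m (\<lambda>x. f x * partial_deriv v g x + partial_deriv v f x * g x) S"
      by (intro C_k_add[OF assms(1)] Suc.IH C_k_Suc_imp[OF Suc.prems(1)] C_k_Suc_imp[OF Suc.prems(2)])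
    then show ?thesis by (simp add: C_k_cong[OF assms(1) eq])
  qed
  then show ?case using Suc.prems by auto
qed

lemma C_k_const: "C_k m (\<lambda>x. c) S"
proof (induction m arbitrary: c)
  case (Suc m)
  have "partial_deriv v (\<lambda>x. c) = (\<lambda>x. 0)" for v :: 'a by (rule ext) (simp add: partial_deriv_def)
  then show ?case using Suc by simp
qed simp

text \<open>The derivative contains the inverse of \<open>f\<close> again, squared but needed to one
  order less, so the induction is on \<open>m\<close> with \<open>f\<close> fixed.\<close>

lemma C_k_inverse:
  fixes f :: "'a::euclidean_space \<Rightarrow> real"
  assumes "open S" "C_k m f S" "\<And>x. x \<in> S \<Longrightarrow> f x > 0"
  shows "C_k m (\<lambda>x. inverse (f x)) S"
  using assms(2)
proof (induction m)
  case 0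
  then show ?case using assms(3) by (simp add: continuous_on_inverse less_imp_neq[symmetric])
next
  case (Suc m)
  have fd: "f differentiable at x" if "x \<in> S" for x using Suc.prems that by auto
  have inv: "C_k m (\<lambda>x. inverse (f x)) S" by (rule Suc.IH[OF C_k_Suc_imp[OF Suc.prems]])
  have "((\<lambda>x. inverse (f x)) has_derivative
     (\<lambda>h. - (inverse (f x) * (\<Sum>v\<in>Basis. (h \<bullet> v) * partial_deriv v f x) * inverse (f x)))) (at x)" if "x \<in> S" for x
    using assms(3)[OF that] by (intro Deriv.has_derivative_inverse differentiable_has_derivative_partial fd that) auto
  note d = this
  have "C_k m (partial_deriv v (\<lambda>x. inverse (f x))) S" if v: "v \<in> Basis" for v
  proof -
    have eq: "partial_deriv v (\<lambda>x. inverse (f x)) x = ((-1) * partial_deriv v f x) * (inverse (f x) * inverse (f x))"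
      if "x \<in> S" for x
      using partial_deriv_eq_has_derivative[OF d[OF that], of v]
        partial_deriv_eq_has_derivative[OF differentiable_has_derivative_partial[OF fd[OF that]], of v] by simp
    have "C_k m (partial_deriv v f) S" using Suc.prems v by auto
    then have "C_k m (\<lambda>x. ((-1) * partial_deriv v f x) * (inverse (f x) * inverse (f x))) S"
      by (intro C_k_mult[OF assms(1)] C_k_const inv)
    then show ?thesis by (simp only: C_k_cong[OF assms(1) eq])
  qed
  then show ?case using d by (auto simp: differentiable_def)
qed

text \<open>One differentiation leads from the logarithm to a product with the inverse, so a case
  split on \<open>m\<close> takes the place of an induction.\<close>

lemma C_k_ln:
  fixes f :: "'a::euclidean_space \<Rightarrow> real"
  assumes "open S" "C_k m f S" "\<And>x. x \<in> S \<Longrightarrow> f x > 0"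
  shows "C_k m (\<lambda>x. ln (f x)) S"
proof (cases m)
  case 0
  then show ?thesis using assms by (force intro!: continuous_on_ln)
next
  case (Suc m')
  have fd: "f differentiable at x" if "x \<in> S" for x using assms(2) that Suc by auto
  have inv: "C_k m' (\<lambda>x. inverse (f x)) S"
    using assms Suc C_k_Suc_imp by (intro C_k_inverse) auto
  have "((\<lambda>x. ln (f x)) has_derivative
     (\<lambda>h. (\<Sum>v\<in>Basis. (h \<bullet> v) * partial_deriv v f x) * inverse (f x))) (at x)" if "x \<in> S" for x
    using assms(3)[OF that] by (intro has_derivative_ln differentiable_has_derivative_partial fd that) auto
  note d = this
  have "C_k m' (partial_deriv v (\<lambda>x. ln (f x))) S" if v: "v \<in> Basis" for v
  proof -
    have eq: "partial_deriv v (\<lambda>x. ln (f x)) x = partial_deriv v f x * inverse (f x)" if "x \<in> S" for x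
      using partial_deriv_eq_has_derivative[OF d[OF that], of v]
        partial_deriv_eq_has_derivative[OF differentiable_has_derivative_partial[OF fd[OF that]], of v] by simp
    have "C_k m' (partial_deriv v f) S" using assms(2) Suc v by auto
    then have "C_k m' (\<lambda>x. partial_deriv v f x * inverse (f x)) S"
      by (intro C_k_mult[OF assms(1)] inv)
    then show ?thesis by (simp only: C_k_cong[OF assms(1) eq])
  qed
  then show ?thesis using d Suc by (auto simp: differentiable_def)
qed

text \<open>Each derivative of a convolution is the convolution with another kernel of the class, so
  the induction runs with \<open>k\<close> arbitrary.\<close>

lemma C_k_kernel_conv:
  fixes G :: "real ^ 'n::finite \<Rightarrow> real"
  assumes "\<beta> > 0" and "k \<in> gaussian_kernels \<beta>" and "exp_bounded G"
  shows "C_k m (kernel_conv k G) pos_time"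
  using assms(2)
proof (induction m arbitrary: k)
  case 0
  have "isCont (kernel_conv k G) p" if "fst p > 0" for p
    by (rule has_derivative_continuous) (rule kernel_conv_has_derivative[OF assms(1) 0 that assms(3)])
  then show ?case by (auto intro!: continuous_at_imp_continuous_on)
next
  case (Suc m)
  have "kernel_conv k G differentiable at p" if "p \<in> pos_time" for p
    using kernel_conv_has_derivative[OF assms(1) Suc.prems _ assms(3), of p] that
    by (auto simp: differentiable_def mem_Times_iff)
  moreover have "C_k m (partial_deriv v (kernel_conv k G)) pos_time" if v: "v \<in> Basis" for v
  proof -
    have eq: "partial_deriv v (kernel_conv k G) p = kernel_conv (partial_deriv v k) G p" if "p \<in> pos_time" for p
      using that by (intro partial_deriv_kernel_conv[OF assms(1) Suc.prems _ assms(3) v]) (auto simp: mem_Times_iff)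
    show ?thesis
      by (simp only: C_k_cong[OF open_pos_time eq] Suc.IH[OF gaussian_kernels_partial_deriv[OF assms(1) Suc.prems]])
  qed
  ultimately show ?case by (simp del: split_paired_All)
qed

section \<open>Quantitative bounds on heat convolutions\<close>

abbreviation heat_fun :: "real \<Rightarrow> real \<times> (real ^ 'n::finite) \<Rightarrow> real" where
  "heat_fun \<beta> \<equiv> (\<lambda>p. heat_kernel \<beta> (fst p) (snd p))"

abbreviation time_dir :: "real \<times> (real ^ 'n::finite)" where "time_dir \<equiv> (1, 0)"

abbreviation space_dir :: "'n::finite \<Rightarrow> real \<times> (real ^ 'n)" where "space_dir i \<equiv> (0, axis i 1)"

lemma time_dir_Basis: "time_dir \<in> Basis" and space_dir_Basis: "space_dir i \<in> Basis"
  by (auto simp: Basis_prod_def)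

text \<open>The exponential of the kernel is a product of two factors
  \<open>exp (- c * s\<^sup>2)\<close>. One absorbs \<open>s = norm z\<close> at the price
  \<open>sqrt (8 * \<beta> * t)\<close>, the origin of the square root of time in the initial error;
  the other absorbs \<open>exp (B * s)\<close> and keeps half of its decay, which is the exponent of
  the heat kernel at time \<open>4 * t\<close>.\<close>

lemma heat_kernel_moment_bound:
  fixes z :: "real ^ 'n::finite"
  assumes \<beta>: "\<beta> > 0" and t: "t > 0"
  shows "heat_kernel \<beta> t z * (norm z * exp (B * norm z))
    \<le> sqrt (8 * \<beta> * t) * 2 ^ CARD('n) * exp (4 * \<beta> * B\<^sup>2 * t) * heat_kernel \<beta> (4 * t) z"
proof -
  define c where "c = 1 / (8 * \<beta> * t)"
  define s where "s = norm z"
  define X where "X = (4 * pi * \<beta> * t) powr (- real CARD('n) / 2)"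
  have c: "c > 0" and s: "s \<ge> 0" and X: "X \<ge> 0" using \<beta> t by (auto simp: c_def s_def X_def)
  have y: "y \<le> exp (y\<^sup>2)" for y :: real
  proof -
    have "y \<le> 1 + y\<^sup>2" using sum_squares_bound[of y 1] zero_le_power2[of y] by (simp; linarith)
    also have "\<dots> \<le> exp (y\<^sup>2)" by (rule exp_ge_add_one_self)
    finally show ?thesis .
  qed
  have "sqrt c * s * exp (- c * s\<^sup>2) \<le> exp ((sqrt c * s)\<^sup>2) * exp (- c * s\<^sup>2)"
    by (intro mult_right_mono y) auto
  also have "\<dots> = 1" using c by (simp add: power_mult_distrib exp_add[symmetric])
  finally have 1: "s * exp (- c * s\<^sup>2) \<le> sqrt (8 * \<beta> * t)"
    using c by (simp add: c_def real_sqrt_divide field_simps)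
  have 2: "exp (- c * s\<^sup>2 + B * s) \<le> exp (4 * \<beta> * B\<^sup>2 * t) * exp (- (c / 2) * s\<^sup>2)"
    using gaussian_absorbs_exp[OF c, of s B] by (simp add: c_def mult_ac)
  have "heat_kernel \<beta> t z * (norm z * exp (B * norm z)) = X * ((s * exp (- c * s\<^sup>2)) * exp (- c * s\<^sup>2 + B * s))"
    by (simp add: heat_kernel_def X_def s_def c_def exp_add[symmetric] mult_ac exp_minus_inverse)
  also have "\<dots> \<le> X * (sqrt (8 * \<beta> * t) * (exp (4 * \<beta> * B\<^sup>2 * t) * exp (- (c / 2) * s\<^sup>2)))"
    using 1 2 X s \<beta> t by (intro mult_left_mono mult_mono) auto
  also have "X * exp (- (c / 2) * s\<^sup>2) = 2 ^ CARD('n) * heat_kernel \<beta> (4 * t) z"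
  proof -
    \<comment> \<open>Passing from time \<open>t\<close> to \<open>4 * t\<close> divides the
      normalising factor by the d-th power of 2, with d the dimension.\<close>
    have "(4 * pi * \<beta> * (4 * t)) powr (- real CARD('n) / 2) = 4 powr (- real CARD('n) / 2) * X"
      unfolding X_def using \<beta> t by (subst powr_mult[symmetric]) (auto simp: mult_ac)
    also have "(4::real) powr (- real CARD('n) / 2) = (2 powr 2) powr (- real CARD('n) / 2)" by simp
    also have "\<dots> = 1 / 2 ^ CARD('n)" unfolding powr_powr by (simp add: powr_minus_divide powr_realpow)
    finally show ?thesis by (simp add: heat_kernel_def s_def c_def)
  qed
  then have "X * (sqrt (8 * \<beta> * t) * (exp (4 * \<beta> * B\<^sup>2 * t) * exp (- (c / 2) * s\<^sup>2))) =
    sqrt (8 * \<beta> * t) * 2 ^ CARD('n) * exp (4 * \<beta> * B\<^sup>2 * t) * heat_kernel \<beta> (4 * t) z"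
    by (simp add: mult_ac)
  finally show ?thesis .
qed

lemma exp_bounded_const: "exp_bounded (\<lambda>_. c)"
  unfolding exp_bounded_def by (intro conjI exI[of _ "\<bar>c\<bar>"] exI[of _ 0] allI) auto

lemma kernel_conv_heat_1:
  fixes p :: "real \<times> (real ^ 'n::finite)"
  assumes "\<beta> > 0" "fst p > 0"
  shows "kernel_conv (heat_fun \<beta>) (\<lambda>_. 1) p = 1"
proof -
  have hb: "has_bochner_integral lborel (heat_kernel \<beta> (fst p) :: real ^ 'n \<Rightarrow> real) 1"
    by (rule has_bochner_integral_heat_kernel[OF assms])
  then have "(LINT y|lborel. heat_kernel \<beta> (fst p) (snd p - y)) = (LINT y|lborel. heat_kernel \<beta> (fst p) (y :: real ^ 'n))"
    using borel_measurable_integrable[of lborel "heat_kernel \<beta> (fst p) :: real ^ 'n \<Rightarrow> real"]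
    by (intro integral_lborel_reflect) (simp add: has_bochner_integral_iff)
  then show ?thesis using hb by (simp add: kernel_conv_def has_bochner_integral_iff)
qed

lemma kernel_conv_diff:
  fixes G H :: "real ^ 'n::finite \<Rightarrow> real"
  assumes "\<beta> > 0" "k \<in> gaussian_kernels \<beta>" "t > 0" "exp_bounded G"
  shows "kernel_conv k G (t, x) - c * kernel_conv k (\<lambda>_. 1) (t, x) = (LINT y|lborel. k (t, x - y) * (G y - c))"
    and "integrable lborel (\<lambda>y. k (t, x - y) * (G y - c))"
proof -
  have i: "integrable lborel (\<lambda>y. k (t, x - y) * G y)" "integrable lborel (\<lambda>y. c * (k (t, x - y) * 1))"
    using kernel_conv_integrable[OF assms]
      integrable_mult_right[OF kernel_conv_integrable[OF assms(1-3) exp_bounded_const, of x 1], of c] by auto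
  have "(\<lambda>y. k (t, x - y) * (G y - c)) = (\<lambda>y. k (t, x - y) * G y - c * (k (t, x - y) * 1))"
    by (simp add: fun_eq_iff algebra_simps)
  then show "kernel_conv k G (t, x) - c * kernel_conv k (\<lambda>_. 1) (t, x) = (LINT y|lborel. k (t, x - y) * (G y - c))"
    and "integrable lborel (\<lambda>y. k (t, x - y) * (G y - c))"
    using i by (simp_all add: kernel_conv_def)
qed

text \<open>The moment bound is integrated, the heat kernel at time \<open>4 * t\<close> having mass
  1. \<open>C\<close> is chosen before \<open>x\<close>, \<open>G\<close> and \<open>D\<close>: for
  the Cole-Hopf datum \<open>D\<close> is a multiple of \<open>G x\<close>, and only a
  \<open>C\<close> free of \<open>x\<close> gives a uniform relative error.\<close>

lemma kernel_conv_heat_near_initial: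
  assumes \<beta>: "\<beta> > 0" and B: "B \<ge> 0"
  shows "\<exists>C\<ge>0. \<forall>(t::real) x G D. 0 < t \<longrightarrow> t \<le> 1 \<longrightarrow> D \<ge> 0 \<longrightarrow> exp_bounded G \<longrightarrow>
    (\<forall>y :: real ^ 'n::finite. \<bar>G y - G x\<bar> \<le> D * (norm (x - y) * exp (B * norm (x - y)))) \<longrightarrow>
    \<bar>kernel_conv (heat_fun \<beta>) G (t, x) - G x\<bar> \<le> D * (C * sqrt t)"
proof (intro exI conjI allI impI)
  let ?C = "sqrt (8 * \<beta>) * 2 ^ CARD('n) * exp (4 * \<beta> * B\<^sup>2)"
  show "0 \<le> ?C" using \<beta> by simp
  fix t D :: real and x :: "real ^ 'n" and G :: "real ^ 'n \<Rightarrow> real"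
  assume t: "0 < t" "t \<le> 1" and D: "D \<ge> 0" and G: "exp_bounded G"
    and GD: "\<forall>y. \<bar>G y - G x\<bar> \<le> D * (norm (x - y) * exp (B * norm (x - y)))"
  have K: "heat_fun \<beta> \<in> gaussian_kernels \<beta>" by (rule gaussian_kernels.heat)
  have t4: "4 * t > 0" using t by simp
  have int4: "integrable lborel (\<lambda>y :: real ^ 'n. D * (?C * sqrt t * heat_kernel \<beta> (4 * t) (x - y)))"
    using has_bochner_integral_heat_kernel[OF \<beta> t4]
    by (intro integrable_mult_right integrable_lborel_reflect) (auto simp: has_bochner_integral_iff)
  have "\<bar>kernel_conv (heat_fun \<beta>) G (t, x) - G x\<bar> = \<bar>LINT y|lborel. heat_kernel \<beta> t (x - y) * (G y - G x)\<bar>"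
    using kernel_conv_diff(1)[OF \<beta> K t(1) G, of x "G x"] t by (simp add: kernel_conv_heat_1[OF \<beta>])
  also have "\<dots> \<le> (LINT y|lborel. D * (?C * sqrt t * heat_kernel \<beta> (4 * t) (x - y)))"
  proof (rule Bochner_Integration.integral_abs_bound_integral[OF _ int4])
    show "integrable lborel (\<lambda>y. heat_kernel \<beta> t (x - y) * (G y - G x))"
      using kernel_conv_diff(2)[OF \<beta> K t(1) G, of x "G x"] by simp
    fix y :: "real ^ 'n"
    have "\<bar>heat_kernel \<beta> t (x - y) * (G y - G x)\<bar>
      \<le> heat_kernel \<beta> t (x - y) * (D * (norm (x - y) * exp (B * norm (x - y))))"
      unfolding abs_mult using GD heat_kernel_pos[OF \<beta> t(1), of "x - y"] by (simp add: mult_left_mono)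
    also have "\<dots> = D * (heat_kernel \<beta> t (x - y) * (norm (x - y) * exp (B * norm (x - y))))" by simp
    also have "\<dots> \<le> D * (sqrt (8 * \<beta> * t) * 2 ^ CARD('n) * exp (4 * \<beta> * B\<^sup>2 * t) * heat_kernel \<beta> (4 * t) (x - y))"
      by (intro mult_left_mono heat_kernel_moment_bound \<beta> t D)
    also have "\<dots> \<le> D * (?C * sqrt t * heat_kernel \<beta> (4 * t) (x - y))"
    proof (intro mult_left_mono mult_right_mono D)
      have "exp (4 * \<beta> * B\<^sup>2 * t) \<le> exp (4 * \<beta> * B\<^sup>2)" using t \<beta> by (simp add: mult_left_le)
      then have "sqrt (8 * \<beta>) * sqrt t * 2 ^ CARD('n) * exp (4 * \<beta> * B\<^sup>2 * t) \<le>
          sqrt (8 * \<beta>) * sqrt t * 2 ^ CARD('n) * exp (4 * \<beta> * B\<^sup>2)"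
        using t \<beta> by (intro mult_left_mono) auto
      then show "sqrt (8 * \<beta> * t) * 2 ^ CARD('n) * exp (4 * \<beta> * B\<^sup>2 * t) \<le> ?C * sqrt t"
        by (simp add: real_sqrt_mult mult_ac)
      show "0 \<le> heat_kernel \<beta> (4 * t) (x - y)" by (simp add: heat_kernel_def)
    qed
    finally show "\<bar>heat_kernel \<beta> t (x - y) * (G y - G x)\<bar> \<le> D * (?C * sqrt t * heat_kernel \<beta> (4 * t) (x - y))" .
  qed
  also have "\<dots> = D * (?C * sqrt t)"
  proof -
    have "(LINT y|lborel. heat_kernel \<beta> (4 * t) (x - y)) = 1"
      using kernel_conv_heat_1[OF \<beta>, of "(4 * t, x)"] t by (simp add: kernel_conv_def)
    then show ?thesis unfolding integral_mult_right_zero by simp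
  qed
  finally show "\<bar>kernel_conv (heat_fun \<beta>) G (t, x) - G x\<bar> \<le> D * (?C * sqrt t)" .
qed

text \<open>The size \<open>D\<close> of the datum as seen from \<open>x\<close> is kept apart from
  \<open>M\<close>, so that \<open>D\<close> may vary with \<open>x\<close> while \<open>M\<close>
  is uniform.\<close>

lemma kernel_conv_upper_bound:
  fixes k :: "real \<times> (real ^ 'n::finite) \<Rightarrow> real"
  assumes \<beta>: "\<beta> > 0" and k: "k \<in> gaussian_kernels \<beta>" and ab: "0 < a" "a \<le> b"
  shows "\<exists>M\<ge>0. \<forall>(t::real) x G D. a \<le> t \<longrightarrow> t \<le> b \<longrightarrow> D \<ge> 0 \<longrightarrow> exp_bounded G \<longrightarrow>
    (\<forall>y. \<bar>G y\<bar> \<le> D * exp (B * norm (x - y))) \<longrightarrow> \<bar>kernel_conv k G (t, x)\<bar> \<le> M * D"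
proof -
  obtain C c where C: "C \<ge> 0" "c > 0"
    and b: "\<And>t z. a \<le> t \<Longrightarrow> t \<le> b \<Longrightarrow> \<bar>k (t, z)\<bar> \<le> C * exp (- c * (norm z)\<^sup>2)"
    using gaussian_kernels_bound[OF \<beta> ab k] by blast
  let ?e = "\<lambda>z :: real ^ 'n. exp (- c * (norm z)\<^sup>2 + B * norm z)"
  show ?thesis
  proof (intro exI conjI allI impI)
    show "0 \<le> C * (LINT z|lborel. ?e z)" using C by simp
    fix t D :: real and x :: "real ^ 'n" and G :: "real ^ 'n \<Rightarrow> real"
    assume t: "a \<le> t" "t \<le> b" and D: "D \<ge> 0" and G: "exp_bounded G"
      and GD: "\<forall>y. \<bar>G y\<bar> \<le> D * exp (B * norm (x - y))"
    have "\<bar>kernel_conv k G (t, x)\<bar> \<le> (LINT y|lborel. (C * D) * ?e (x - y))"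
      unfolding kernel_conv_def fst_conv snd_conv
    proof (rule Bochner_Integration.integral_abs_bound_integral)
      show "integrable lborel (\<lambda>y. k (t, x - y) * G y)"
        using t ab by (intro kernel_conv_integrable[OF \<beta> k _ G]) auto
      show "integrable lborel (\<lambda>y. (C * D) * ?e (x - y))"
        by (intro integrable_mult_right integrable_lborel_reflect[of ?e] integrable_gaussian_exp C)
      fix y
      have "\<bar>k (t, x - y) * G y\<bar> \<le> (C * exp (- c * (norm (x - y))\<^sup>2)) * (D * exp (B * norm (x - y)))"
        unfolding abs_mult using b[OF t, of "x - y"] GD C by (intro mult_mono) auto
      then show "\<bar>k (t, x - y) * G y\<bar> \<le> (C * D) * ?e (x - y)"
        unfolding exp_add by (simp add: mult_ac)
    qed
    also have "\<dots> = (C * D) * (LINT z|lborel. ?e z)"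
      by (subst integral_mult_right_zero, subst integral_lborel_reflect[of ?e]) auto
    finally show "\<bar>kernel_conv k G (t, x)\<bar> \<le> C * (LINT z|lborel. ?e z) * D" by (simp add: mult_ac)
  qed
qed

lemma integral_lborel_pos:
  fixes f :: "'a::euclidean_space \<Rightarrow> real"
  assumes "integrable lborel f" and "\<And>x. f x > 0"
  shows "integral\<^sup>L lborel f > 0"
proof -
  have "integral\<^sup>L lborel f \<noteq> 0"
  proof
    assume "integral\<^sup>L lborel f = 0"
    then have "AE x in lborel. f x = 0"
      using assms by (subst (asm) integral_nonneg_eq_0_iff_AE) (auto intro: less_imp_le)
    then have "AE x in (lborel :: 'a measure). False"
      by (rule AE_mp) (use assms(2) in \<open>auto intro!: AE_I2 simp: less_imp_neq[symmetric]\<close>)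
    then show False by (simp add: AE_iff_measurable[of "UNIV"] emeasure_lborel_UNIV)
  qed
  then show ?thesis using assms by (simp add: less_imp_le order_less_le)
qed

text \<open>The counterpart of the upper bound: with the same \<open>D\<close> in both, quotients of
  convolutions are bounded uniformly in \<open>x\<close>.\<close>

lemma kernel_conv_heat_lower_bound:
  assumes \<beta>: "\<beta> > 0" and ab: "0 < a" "a \<le> b" and B: "B \<ge> 0"
  shows "\<exists>m>0. \<forall>(t::real) x G D. a \<le> t \<longrightarrow> t \<le> b \<longrightarrow> D \<ge> 0 \<longrightarrow> exp_bounded G \<longrightarrow>
    (\<forall>y :: real ^ 'n::finite. D * exp (- B * norm (x - y)) \<le> G y) \<longrightarrow> m * D \<le> kernel_conv (heat_fun \<beta>) G (t, x)"
proof -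
  \<comment> \<open>The heat kernel over the interval is minorised by its worst cases: decay as at
    the smallest time \<open>a\<close>, normalisation as at the largest time
    \<open>b\<close>.\<close>
  define c where "c = 1 / (4 * \<beta> * a)"
  define X where "X = (4 * pi * \<beta> * b) powr (- real CARD('n) / 2)"
  have c: "c > 0" and X: "X > 0" using \<beta> ab by (auto simp: c_def X_def)
  let ?e = "\<lambda>z :: real ^ 'n. exp (- c * (norm z)\<^sup>2 + (- B) * norm z)"
  have e: "integrable lborel ?e" by (rule integrable_gaussian_exp[OF c])
  show ?thesis
  proof (intro exI conjI allI impI)
    show "0 < X * (LINT z|lborel. ?e z)" using X integral_lborel_pos[OF e] by simp
    fix t D :: real and x :: "real ^ 'n" and G :: "real ^ 'n \<Rightarrow> real"
    assume t: "a \<le> t" "t \<le> b" and D: "D \<ge> 0" and G: "exp_bounded G"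
      and GD: "\<forall>y. D * exp (- B * norm (x - y)) \<le> G y"
    have "X * (LINT z|lborel. ?e z) * D = (LINT y|lborel. (X * D) * ?e (x - y))"
      by (subst integral_mult_right_zero, subst integral_lborel_reflect[of ?e]) auto
    also have "\<dots> \<le> kernel_conv (heat_fun \<beta>) G (t, x)"
      unfolding kernel_conv_def fst_conv snd_conv
    proof (rule integral_mono)
      show "integrable lborel (\<lambda>y. (X * D) * ?e (x - y))"
        by (intro integrable_mult_right integrable_lborel_reflect[of ?e] e)
      show "integrable lborel (\<lambda>y. heat_kernel \<beta> t (x - y) * G y)"
        using kernel_conv_integrable[OF \<beta> gaussian_kernels.heat _ G, of t x] t ab by simp
      fix y
      have "X \<le> (4 * pi * \<beta> * t) powr (- real CARD('n) / 2)"
        unfolding X_def using t \<beta> ab by (intro powr_mono2') auto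
      moreover have "- c * (norm (x - y))\<^sup>2 \<le> - (norm (x - y))\<^sup>2 / (4 * \<beta> * t)"
        unfolding c_def using t \<beta> ab by (simp add: frac_le)
      ultimately have "X * exp (- c * (norm (x - y))\<^sup>2) \<le> heat_kernel \<beta> t (x - y)"
        unfolding heat_kernel_def using X by (intro mult_mono) auto
      then have "(X * exp (- c * (norm (x - y))\<^sup>2)) * (D * exp (- B * norm (x - y))) \<le> heat_kernel \<beta> t (x - y) * G y"
        using GD X D by (intro mult_mono) (auto intro!: mult_nonneg_nonneg simp: heat_kernel_def)
      then show "(X * D) * ?e (x - y) \<le> heat_kernel \<beta> t (x - y) * G y"
        unfolding exp_add by (simp add: mult_ac)
    qed
    finally show "X * (LINT z|lborel. ?e z) * D \<le> kernel_conv (heat_fun \<beta>) G (t, x)" .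
  qed
qed

text \<open>The convolution with the constant 1 does not depend on the point, and derivatives pass
  onto the kernel: a differentiated kernel has integral zero.\<close>

lemma kernel_conv_partial_deriv_1:
  assumes "\<beta> > 0" and "k \<in> gaussian_kernels \<beta>" and "v \<in> Basis"
    and "\<And>q. fst q > 0 \<Longrightarrow> kernel_conv k (\<lambda>_. 1) q = c" and "fst p > 0"
  shows "kernel_conv (partial_deriv v k) (\<lambda>_. 1) p = 0"
proof -
  have p: "p \<in> pos_time" using assms(5) by (simp add: mem_Times_iff)
  have "kernel_conv (partial_deriv v k) (\<lambda>_. 1) p = partial_deriv v (kernel_conv k (\<lambda>_. 1)) p"
    by (rule partial_deriv_kernel_conv[symmetric]) (use assms exp_bounded_const in auto)
  also have "\<dots> = partial_deriv v (\<lambda>_. c) p"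
    by (rule partial_deriv_cong_open[OF open_pos_time p]) (use assms(4) in \<open>auto simp: mem_Times_iff\<close>)
  finally show ?thesis by (simp add: partial_deriv_def)
qed

lemma heat_kernel_heat_equation:
  fixes p :: "real \<times> (real ^ 'n::finite)"
  assumes \<beta>: "\<beta> > 0" and p: "fst p > 0"
  shows "partial_deriv time_dir (heat_fun \<beta>) p =
    \<beta> * (\<Sum>i\<in>UNIV. partial_deriv (space_dir i) (partial_deriv (space_dir i) (heat_fun \<beta>)) p)"
proof -
  let ?K = "heat_fun \<beta>"
  note hd = heat_kernel_has_derivative[OF \<beta>]
  have D1: "partial_deriv (space_dir i) ?K q = snd q $ i * ((- 1 / (2 * \<beta>)) * ?K q / fst q)" if "fst q > 0" for i and q :: "real \<times> (real ^ 'n)"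
    unfolding partial_deriv_eq_has_derivative[OF hd[OF that]] using that \<beta>
    by (simp add: inner_axis' field_simps)
  have D2: "partial_deriv (space_dir i) (partial_deriv (space_dir i) ?K) p =
    ((snd p $ i)\<^sup>2 / (4 * \<beta>\<^sup>2 * (fst p)\<^sup>2) - 1 / (2 * \<beta> * fst p)) * ?K p" for i
  proof -
    have mem: "p \<in> pos_time" using p by (simp add: mem_Times_iff)
    have "partial_deriv (space_dir i) (partial_deriv (space_dir i) ?K) p =
      partial_deriv (space_dir i) (\<lambda>q. snd q $ i * ((- 1 / (2 * \<beta>)) * ?K q / fst q)) p"
      by (rule partial_deriv_cong_open[OF open_pos_time mem]) (use D1 in \<open>auto simp: mem_Times_iff\<close>)
    also have "((\<lambda>q. snd q $ i * ((- 1 / (2 * \<beta>)) * ?K q / fst q)) has_derivative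
      (\<lambda>h. snd p $ i * (- ((- 1 / (2 * \<beta>)) * ?K p) * (inverse (fst p) * fst h * inverse (fst p)) +
        ((- 1 / (2 * \<beta>)) * ((fst h * ((snd p \<bullet> snd p) / (4 * \<beta> * (fst p)\<^sup>2) - real CARD('n) / (2 * fst p))
       - (snd h \<bullet> snd p) / (2 * \<beta> * fst p)) * ?K p)) / fst p) +
       snd h $ i * ((- 1 / (2 * \<beta>)) * ?K p / fst p))) (at p)"
      using p
      by (intro has_derivative_mult has_derivative_divide has_derivative_mult_right hd
          bounded_linear.has_derivative[OF bounded_linear_vec_nth] has_derivative_snd has_derivative_fst has_derivative_ident) auto
    note partial_deriv_eq_has_derivative[OF this, of "space_dir i"]
    finally show ?thesis
      using p \<beta> by (simp add: inner_axis' power2_eq_square field_simps)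
  qed
  have "(\<Sum>i\<in>UNIV. partial_deriv (space_dir i) (partial_deriv (space_dir i) ?K) p)
    = ((snd p \<bullet> snd p) / (4 * \<beta>\<^sup>2 * (fst p)\<^sup>2) - real CARD('n) / (2 * \<beta> * fst p)) * ?K p"
    unfolding D2 by (simp add: sum_distrib_right[symmetric] sum_subtractf sum_divide_distrib[symmetric] inner_vec_def power2_eq_square)
  then show ?thesis
    unfolding partial_deriv_eq_has_derivative[OF hd[OF p]]
    using p \<beta> by (simp add: power2_eq_square field_simps)
qed

lemma kernel_conv_heat_equation:
  fixes G :: "real ^ 'n::finite \<Rightarrow> real"
  assumes \<beta>: "\<beta> > 0" and t: "t > 0" and G: "exp_bounded G"
  shows "kernel_conv (partial_deriv time_dir (heat_fun \<beta>)) G (t, x) =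
    \<beta> * (\<Sum>i\<in>UNIV. kernel_conv (partial_deriv (space_dir i) (partial_deriv (space_dir i) (heat_fun \<beta>))) G (t, x))"
proof -
  let ?D = "\<lambda>i. partial_deriv (space_dir i) (partial_deriv (space_dir i) (heat_fun \<beta>))"
  have "?D i \<in> gaussian_kernels \<beta>" for i
    by (intro gaussian_kernels_partial_deriv \<beta> gaussian_kernels.heat)
  then have i: "integrable lborel (\<lambda>y. ?D i (t, x - y) * G y)" for i
    by (intro kernel_conv_integrable[OF \<beta> _ t G])
  have "kernel_conv (partial_deriv time_dir (heat_fun \<beta>)) G (t, x) =
    (LINT y|lborel. \<beta> * (\<Sum>i\<in>UNIV. ?D i (t, x - y) * G y))"
    unfolding kernel_conv_def using t
    by (simp add: heat_kernel_heat_equation[OF \<beta>] sum_distrib_right mult.assoc)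
  also have "\<dots> = \<beta> * (\<Sum>i\<in>UNIV. LINT y|lborel. ?D i (t, x - y) * G y)"
    using i by simp
  finally show ?thesis by (simp add: kernel_conv_def)
qed

lemma kernel_conv_DERIV_line:
  fixes G :: "real ^ 'n::finite \<Rightarrow> real"
  assumes \<beta>: "\<beta> > 0" and k: "k \<in> gaussian_kernels \<beta>" and G: "exp_bounded G" and v: "v \<in> Basis"
    and p: "fst (p + s *\<^sub>R v) > 0"
  shows "((\<lambda>s. kernel_conv k G (p + s *\<^sub>R v)) has_real_derivative
    kernel_conv (partial_deriv v k) G (p + s *\<^sub>R v)) (at s)"
proof -
  let ?L = "\<lambda>h. \<Sum>w\<in>Basis. (h \<bullet> w) * kernel_conv (partial_deriv w k) G (p + s *\<^sub>R v)"
  have "((\<lambda>s. kernel_conv k G (p + s *\<^sub>R v)) has_derivative (\<lambda>r. ?L (r *\<^sub>R v))) (at s)"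
    by (rule has_derivative_compose[of "\<lambda>s. p + s *\<^sub>R v" _ _ _ "kernel_conv k G", OF _ kernel_conv_has_derivative[OF \<beta> k p G]])
      (auto intro!: derivative_eq_intros)
  then have "((\<lambda>s. kernel_conv k G (p + s *\<^sub>R v)) has_real_derivative ?L v) (at s)"
    by (rule has_derivative_imp_has_field_derivative) (simp add: sum_distrib_left mult_ac)
  moreover have "?L v = kernel_conv (partial_deriv v k) G (p + s *\<^sub>R v)"
    using v by (simp add: inner_Basis if_distrib[of "\<lambda>c. c * _"] cong: if_cong)
  ultimately show ?thesis by simp
qed

lemma kernel_conv_DERIV_space:
  assumes "\<beta> > 0" and "k \<in> gaussian_kernels \<beta>" and "exp_bounded G" and "t > 0"
  shows "((\<lambda>s. kernel_conv k G (t, x + s *\<^sub>R axis i 1)) has_real_derivative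
    kernel_conv (partial_deriv (space_dir i) k) G (t, x + s *\<^sub>R axis i 1)) (at s)"
  using kernel_conv_DERIV_line[OF assms(1-3) space_dir_Basis[of i], of "(t, x)" s] assms(4)
  by (simp add: plus_prod_def scaleR_prod_def)

lemma kernel_conv_DERIV_time:
  assumes "\<beta> > 0" and "k \<in> gaussian_kernels \<beta>" and "exp_bounded G" and "t > 0"
  shows "((\<lambda>s. kernel_conv k G (s, x)) has_real_derivative
    kernel_conv (partial_deriv time_dir k) G (t, x)) (at t)"
  using kernel_conv_DERIV_line[OF assms(1-3) time_dir_Basis, of "(0, x)" t] assms(4)
  by (simp add: plus_prod_def scaleR_prod_def)

section \<open>Convergence to a smooth flow\<close>

text \<open>Turns pointwise derivative bounds on the time window from \<open>\<alpha>\<close> to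
  \<open>\<omega>\<close> into the Lipschitz and Taylor estimates of the comparison result, with the
  clock of the scheme starting at \<open>\<alpha>\<close>.\<close>

lemma scheme_convergence_smooth:
  fixes \<phi> :: "real ^ ('n::finite) stencil \<Rightarrow> real" and F Ft Ftt :: "real \<Rightarrow> real ^ 'n \<Rightarrow> real"
    and F1 F2 F3 :: "'n \<Rightarrow> real \<Rightarrow> real ^ 'n \<Rightarrow> real"
  assumes shift: "shift_equivariant \<phi>" and mono: "mono \<phi>"
    and sym: "lattice_symmetric \<phi>" and C2: "C_k 2 \<phi> UNIV"
    and bs: "b \<in> nonzero_stencil"
    and ab: "\<alpha> \<le> \<omega>" and M: "M \<ge> 0" and e: "e > 0"
    and init: "\<And>x. \<bar>g x - F \<alpha> x\<bar> \<le> E"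
    and dF: "\<And>t x. \<alpha> \<le> t \<Longrightarrow> t \<le> \<omega> \<Longrightarrow> F t differentiable at x"
    and d1: "\<And>t x i s. \<alpha> \<le> t \<Longrightarrow> t \<le> \<omega> \<Longrightarrow>
      ((\<lambda>s. F t (x + s *\<^sub>R axis i 1)) has_real_derivative F1 i t (x + s *\<^sub>R axis i 1)) (at s)"
    and d2: "\<And>t x i s. \<alpha> \<le> t \<Longrightarrow> t \<le> \<omega> \<Longrightarrow>
      ((\<lambda>s. F1 i t (x + s *\<^sub>R axis i 1)) has_real_derivative F2 i t (x + s *\<^sub>R axis i 1)) (at s)"
    and d3: "\<And>t x i s. \<alpha> \<le> t \<Longrightarrow> t \<le> \<omega> \<Longrightarrow>
      ((\<lambda>s. F2 i t (x + s *\<^sub>R axis i 1)) has_real_derivative F3 i t (x + s *\<^sub>R axis i 1)) (at s)"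
    and dt: "\<And>t x. \<alpha> \<le> t \<Longrightarrow> t \<le> \<omega> \<Longrightarrow> ((\<lambda>t. F t x) has_real_derivative Ft t x) (at t)"
    and dtt: "\<And>t x. \<alpha> \<le> t \<Longrightarrow> t \<le> \<omega> \<Longrightarrow> ((\<lambda>t. Ft t x) has_real_derivative Ftt t x) (at t)"
    and b1: "\<And>t x i. \<alpha> \<le> t \<Longrightarrow> t \<le> \<omega> \<Longrightarrow> \<bar>F1 i t x\<bar> \<le> M"
    and b2: "\<And>t x i. \<alpha> \<le> t \<Longrightarrow> t \<le> \<omega> \<Longrightarrow> \<bar>F2 i t x\<bar> \<le> M"
    and b3: "\<And>t x i. \<alpha> \<le> t \<Longrightarrow> t \<le> \<omega> \<Longrightarrow> \<bar>F3 i t x\<bar> \<le> M"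
    and bt: "\<And>t x. \<alpha> \<le> t \<Longrightarrow> t \<le> \<omega> \<Longrightarrow> \<bar>Ft t x\<bar> \<le> M"
    and btt: "\<And>t x. \<alpha> \<le> t \<Longrightarrow> t \<le> \<omega> \<Longrightarrow> \<bar>Ftt t x\<bar> \<le> M"
    and pde: "\<And>t x. \<alpha> \<le> t \<Longrightarrow> t \<le> \<omega> \<Longrightarrow>
      Ft t x = beta \<phi> b * (\<Sum>i\<in>UNIV. F2 i t x) + gamma \<phi> b * (\<Sum>i\<in>UNIV. (F1 i t x)\<^sup>2)"
  shows "eventually (\<lambda>\<epsilon>. \<bar>rescaled_surface \<phi> g \<epsilon> (\<omega> - \<alpha>) x - F \<omega> x\<bar> \<le> E + e) (at_right 0)"
proof -
  define N where "N = real CARD('n)"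
  have N: "N \<ge> 1" by (simp add: N_def Suc_leI)
  \<comment> \<open>The constant passed on is \<open>N * M\<close>: in the Lipschitz estimate all
    \<open>N\<close> coordinate derivatives add up, and the other estimates hold with
    \<open>M\<close> already.\<close>
  have MN: "M \<le> N * M" using N M by (simp add: mult_le_cancel_right1)
  define h where "h s x = F (\<alpha> + s) x" for s x
  have "eventually (\<lambda>\<epsilon>. \<bar>rescaled_surface \<phi> g \<epsilon> (\<omega> - \<alpha>) x - h (\<omega> - \<alpha>) x\<bar> \<le> E + e) (at_right 0)"
  proof (rule scheme_convergence[OF shift mono sym C2 bs, where M = "N * M"
      and D = "\<lambda>s. Ft (\<alpha> + s)" and p = "\<lambda>s x i. F1 i (\<alpha> + s) x" and q = "\<lambda>s x i. F2 i (\<alpha> + s) x"])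
    show "0 \<le> \<omega> - \<alpha>" "0 \<le> N * M" "0 < e" using ab M N e by auto
    show "\<bar>g x - h 0 x\<bar> \<le> E" for x using init by (simp add: h_def)
  next
    fix s :: real and x y :: "real ^ 'n" assume s: "0 \<le> s" "s \<le> \<omega> - \<alpha>"
    then have t: "\<alpha> \<le> \<alpha> + s" "\<alpha> + s \<le> \<omega>" by auto
    have pd: "partial_deriv (axis i 1) (F (\<alpha> + s)) z = F1 i (\<alpha> + s) z" for i z
      using d1[OF t, of z i 0] by (simp add: partial_deriv_def DERIV_imp_deriv)
    define L where "L r = x + r *\<^sub>R (y - x)" for r
    have der: "((\<lambda>r. F (\<alpha> + s) (L r)) has_real_derivative (\<Sum>i\<in>UNIV. (y - x) $ i * F1 i (\<alpha> + s) (L r))) (at r)" for r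
    proof -
      have "((\<lambda>r. F (\<alpha> + s) (L r)) has_derivative
         (\<lambda>u. \<Sum>v\<in>Basis. ((u *\<^sub>R (y - x)) \<bullet> v) * partial_deriv v (F (\<alpha> + s)) (L r))) (at r)"
        unfolding L_def
        by (rule has_derivative_compose[of "\<lambda>r. x + r *\<^sub>R (y - x)" _ _ _ "F (\<alpha> + s)",
              OF _ differentiable_has_derivative_partial[OF dF[OF t]]])
          (auto intro!: derivative_eq_intros)
      then show ?thesis
        by (rule has_derivative_imp_has_field_derivative)
          (simp add: sum_Basis_vec inner_axis pd sum_distrib_left mult_ac)
    qed
    obtain r where "F (\<alpha> + s) (L 1) - F (\<alpha> + s) (L 0) = (1 - 0) * (\<Sum>i\<in>UNIV. (y - x) $ i * F1 i (\<alpha> + s) (L r))"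
      using MVT2[of 0 1 "\<lambda>r. F (\<alpha> + s) (L r)", OF _ der] by auto
    moreover have "\<bar>\<Sum>i\<in>UNIV. (y - x) $ i * F1 i (\<alpha> + s) (L r)\<bar> \<le> (\<Sum>i\<in>(UNIV::'n set). norm (y - x) * M)"
    proof (rule order.trans[OF sum_abs], rule sum_mono)
      show "\<bar>(y - x) $ i * F1 i (\<alpha> + s) (L r)\<bar> \<le> norm (y - x) * M" for i
        unfolding abs_mult by (intro mult_mono component_le_norm_cart b1[OF t]) auto
    qed
    ultimately show "\<bar>h s x - h s y\<bar> \<le> N * M * norm (x - y)"
      by (simp add: h_def L_def N_def norm_minus_commute abs_minus_commute mult_ac)
  next
    fix s :: real and x :: "real ^ 'n" and i :: 'n assume s: "0 \<le> s" "s \<le> \<omega> - \<alpha>"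
    then have t: "\<alpha> \<le> \<alpha> + s" "\<alpha> + s \<le> \<omega>" by auto
    show "\<bar>F1 i (\<alpha> + s) x\<bar> \<le> N * M" "\<bar>F2 i (\<alpha> + s) x\<bar> \<le> N * M"
      using b1[OF t] b2[OF t] MN by (meson order.trans)+
    fix r :: real
    define diff where "diff m u = (if m = 0 then F (\<alpha> + s) (x + u *\<^sub>R axis i 1)
      else if m = 1 then F1 i (\<alpha> + s) (x + u *\<^sub>R axis i 1)
      else if m = 2 then F2 i (\<alpha> + s) (x + u *\<^sub>R axis i 1)
      else F3 i (\<alpha> + s) (x + u *\<^sub>R axis i 1))" for m :: nat and u
    \<comment> \<open>Both neighbours on an axis occur, so the Taylor formula must admit increments
      \<open>r\<close> of either sign.\<close>
    have "\<exists>u. \<bar>u\<bar> \<le> \<bar>r\<bar> \<and> diff 0 r = (\<Sum>m<3. diff m 0 / fact m * r ^ m) + diff 3 u / fact 3 * r ^ 3"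
      using d1[OF t] d2[OF t] d3[OF t]
      by (intro Maclaurin_bi_le) (auto simp: diff_def[abs_def] less_Suc_eq numeral_3_eq_3)
    then obtain u where "F (\<alpha> + s) (x + r *\<^sub>R axis i 1) = F (\<alpha> + s) x + F1 i (\<alpha> + s) x * r
        + F2 i (\<alpha> + s) x / 2 * r\<^sup>2 + F3 i (\<alpha> + s) (x + u *\<^sub>R axis i 1) / 6 * r ^ 3"
      by (auto simp: diff_def numeral_3_eq_3 fact_numeral power2_eq_square)
    then have "\<bar>h s (x + r *\<^sub>R axis i 1) - h s x - (r * F1 i (\<alpha> + s) x + r\<^sup>2 / 2 * F2 i (\<alpha> + s) x)\<bar>
        = \<bar>F3 i (\<alpha> + s) (x + u *\<^sub>R axis i 1)\<bar> / 6 * \<bar>r\<bar> ^ 3"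
      by (simp add: h_def abs_mult power_abs)
    also have "\<dots> \<le> (N * M) * \<bar>r\<bar> ^ 3"
      using b3[OF t, of i "x + u *\<^sub>R axis i 1"] MN by (intro mult_right_mono) auto
    finally show "\<bar>h s (x + r *\<^sub>R axis i 1) - h s x - (r * F1 i (\<alpha> + s) x + r\<^sup>2 / 2 * F2 i (\<alpha> + s) x)\<bar>
      \<le> N * M * \<bar>r\<bar> ^ 3" .
  next
    fix s r :: real and x :: "real ^ 'n" assume s: "0 \<le> s" "0 \<le> r" "s + r \<le> \<omega> - \<alpha>"
    have der: "((\<lambda>u. F (\<alpha> + s + u) x) has_real_derivative Ft (\<alpha> + s + u) x) (at u)"
      and der2: "((\<lambda>u. Ft (\<alpha> + s + u) x) has_real_derivative Ftt (\<alpha> + s + u) x) (at u)"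
      if "0 \<le> u" "u \<le> r" for u
    proof -
      have t: "\<alpha> \<le> u + (\<alpha> + s)" "u + (\<alpha> + s) \<le> \<omega>" using that s by auto
      show "((\<lambda>u. F (\<alpha> + s + u) x) has_real_derivative Ft (\<alpha> + s + u) x) (at u)"
        "((\<lambda>u. Ft (\<alpha> + s + u) x) has_real_derivative Ftt (\<alpha> + s + u) x) (at u)"
        using dt[OF t, of x, unfolded DERIV_shift] dtt[OF t, of x, unfolded DERIV_shift]
        by (simp_all add: add.commute[of "\<alpha> + s"])
    qed
    show "\<bar>h (s + r) x - h s x - r * Ft (\<alpha> + s) x\<bar> \<le> N * M * r\<^sup>2"
    \<comment> \<open>The one-sided Taylor formula in time asks for \<open>r > 0\<close>.\<close>
    proof (cases "r = 0")
      case False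
      then have r: "r > 0" using s by simp
      define diff where "diff m u = (if m = 0 then F (\<alpha> + s + u) x
        else if m = 1 then Ft (\<alpha> + s + u) x else Ftt (\<alpha> + s + u) x)" for m :: nat and u
      have "\<exists>u. 0 < u \<and> u \<le> r \<and> diff 0 r = (\<Sum>m<2. diff m 0 / fact m * r ^ m) + diff 2 u / fact 2 * r ^ 2"
        using der der2 r by (intro Maclaurin2) (auto simp: diff_def[abs_def] less_Suc_eq numeral_2_eq_2)
      then obtain u where u: "0 < u" "u \<le> r" "F (\<alpha> + s + r) x = F (\<alpha> + s) x + Ft (\<alpha> + s) x * r + Ftt (\<alpha> + s + u) x / 2 * r\<^sup>2"
        by (auto simp: diff_def numeral_2_eq_2 power2_eq_square)
      then have "\<bar>h (s + r) x - h s x - r * Ft (\<alpha> + s) x\<bar> = \<bar>Ftt (\<alpha> + s + u) x\<bar> / 2 * r\<^sup>2"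
        by (simp add: h_def abs_mult add.assoc mult_ac)
      also have "\<dots> \<le> N * M * r\<^sup>2"
        using btt[of "\<alpha> + s + u" x] u s MN by (intro mult_right_mono) auto
      finally show ?thesis .
    qed simp
    show "\<bar>h (s + r) x - h s x\<bar> \<le> N * M * r"
    proof (cases "r = 0")
      case False
      then have r: "r > 0" using s by simp
      obtain u where u: "0 < u" "u < r" "F (\<alpha> + s + r) x - F (\<alpha> + s + 0) x = (r - 0) * Ft (\<alpha> + s + u) x"
        using MVT2[OF r, of "\<lambda>u. F (\<alpha> + s + u) x" "\<lambda>u. Ft (\<alpha> + s + u) x"] der by auto
      then have "\<bar>h (s + r) x - h s x\<bar> = \<bar>Ft (\<alpha> + s + u) x\<bar> * r"
        using r by (simp add: h_def abs_mult add.assoc mult_ac)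
      also have "\<dots> \<le> N * M * r"
        using bt[of "\<alpha> + s + u" x] u s MN r by (intro mult_right_mono) auto
      finally show ?thesis .
    qed simp
  next
    fix s :: real and x :: "real ^ 'n" assume "0 \<le> s" "s \<le> \<omega> - \<alpha>"
    then show "Ft (\<alpha> + s) x = beta \<phi> b * (\<Sum>i\<in>UNIV. F2 i (\<alpha> + s) x) + gamma \<phi> b * (\<Sum>i\<in>UNIV. (F1 i (\<alpha> + s) x)\<^sup>2)"
      by (intro pde) auto
  qed
  then show ?thesis by (simp add: h_def)
qed

text \<open>What the heat flow and the Cole-Hopf flow share. The derivatives are named functions, so
  that explicit formulas can be supplied and bounded. \<open>near\<close> is restricted to times up
  to \<open>\<tau>\<close> because the logarithm is controlled only while the heat convolution stays
  close to its datum; \<open>bounds\<close> stays away from time 0, where a Lipschitz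
  \<open>g\<close> gives no control of higher derivatives.\<close>

locale smooth_flow =
  fixes \<beta> \<gamma> :: real and g :: "real ^ 'n::finite \<Rightarrow> real" and F Ft Ftt :: "real \<Rightarrow> real ^ 'n \<Rightarrow> real"
    and F1 F2 F3 :: "'n \<Rightarrow> real \<Rightarrow> real ^ 'n \<Rightarrow> real" and L C \<tau> :: real
  assumes lip: "L-lipschitz_on UNIV g"
    and C: "C \<ge> 0" and \<tau>: "\<tau> > 0"
    and near: "\<And>t x. 0 < t \<Longrightarrow> t \<le> \<tau> \<Longrightarrow> \<bar>F t x - g x\<bar> \<le> C * sqrt t"
    and smooth: "\<And>m. C_k m (\<lambda>(t, x). F t x) pos_time"
    and d1: "\<And>t x i s. 0 < t \<Longrightarrow>
      ((\<lambda>s. F t (x + s *\<^sub>R axis i 1)) has_real_derivative F1 i t (x + s *\<^sub>R axis i 1)) (at s)"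
    and d2: "\<And>t x i s. 0 < t \<Longrightarrow>
      ((\<lambda>s. F1 i t (x + s *\<^sub>R axis i 1)) has_real_derivative F2 i t (x + s *\<^sub>R axis i 1)) (at s)"
    and d3: "\<And>t x i s. 0 < t \<Longrightarrow>
      ((\<lambda>s. F2 i t (x + s *\<^sub>R axis i 1)) has_real_derivative F3 i t (x + s *\<^sub>R axis i 1)) (at s)"
    and dt: "\<And>t x. 0 < t \<Longrightarrow> ((\<lambda>t. F t x) has_real_derivative Ft t x) (at t)"
    and dtt: "\<And>t x. 0 < t \<Longrightarrow> ((\<lambda>t. Ft t x) has_real_derivative Ftt t x) (at t)"
    and bounds: "\<And>\<alpha> \<omega>. 0 < \<alpha> \<Longrightarrow> \<alpha> \<le> \<omega> \<Longrightarrow> \<exists>M\<ge>0. \<forall>t x i. \<alpha> \<le> t \<longrightarrow> t \<le> \<omega> \<longrightarrow>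
      \<bar>F1 i t x\<bar> \<le> M \<and> \<bar>F2 i t x\<bar> \<le> M \<and> \<bar>F3 i t x\<bar> \<le> M \<and> \<bar>Ft t x\<bar> \<le> M \<and> \<bar>Ftt t x\<bar> \<le> M"
    and pde: "\<And>t x. 0 < t \<Longrightarrow> Ft t x = \<beta> * (\<Sum>i\<in>UNIV. F2 i t x) + \<gamma> * (\<Sum>i\<in>UNIV. (F1 i t x)\<^sup>2)"
begin

text \<open>\<open>F\<close> is given by a heat kernel, which describes the evolution at positive
  times only; \<open>g\<close> is glued in at the initial time.\<close>

definition flow :: "real \<Rightarrow> real ^ 'n \<Rightarrow> real" where
  "flow t x = (if t \<le> 0 then g x else F t x)"

lemma flow_initial: "flow 0 x = g x"
  by (simp add: flow_def)

lemma differentiable_space: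
  assumes "t > 0"
  shows "F t differentiable at x"
proof -
  have "(t, x) \<in> pos_time" using assms by simp
  then have "(\<lambda>(t, x). F t x) differentiable at (t, x)" using smooth[of "Suc 0"] by (simp add: assms)
  then have "((\<lambda>(t, x). F t x) \<circ> (\<lambda>x. (t, x))) differentiable at x"
    by (intro differentiable_chain_at) (auto simp: differentiable_def intro!: derivative_intros)
  then show ?thesis by (simp add: o_def)
qed

lemma partial_deriv_F: "t > 0 \<Longrightarrow> partial_deriv (axis i 1) (F t) x = F1 i t x"
  using d1[of t x i 0] by (simp add: partial_deriv_def DERIV_imp_deriv)

lemma partial_deriv_F1: "t > 0 \<Longrightarrow> partial_deriv (axis i 1) (F1 i t) x = F2 i t x"
  using d2[of t i x 0] by (simp add: partial_deriv_def DERIV_imp_deriv)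

lemma flow_DERIV:
  assumes "t > 0"
  shows "((\<lambda>s. flow s x) has_real_derivative
    (\<beta> * laplacian (flow t) x + \<gamma> * (norm (grad (flow t) x))\<^sup>2)) (at t)"
proof -
  have flow: "flow t = F t" using assms by (simp add: flow_def fun_eq_iff)
  have pF: "partial_deriv (axis i 1) (F t) = F1 i t" for i using partial_deriv_F[OF assms] by (simp add: fun_eq_iff)
  have "\<beta> * laplacian (flow t) x + \<gamma> * (norm (grad (flow t) x))\<^sup>2 = Ft t x"
    unfolding flow pde[OF assms] laplacian_def grad_def power2_norm_eq_inner
    by (simp add: inner_vec_def pF partial_deriv_F1[OF assms] power2_eq_square)
  then have "((\<lambda>t. F t x) has_real_derivative (\<beta> * laplacian (flow t) x + \<gamma> * (norm (grad (flow t) x))\<^sup>2)) (at t)"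
    using dt[OF assms, of x] by simp
  then show ?thesis
    by (rule has_field_derivative_transform_within_open[where S = "{0<..}"]) (auto simp: assms flow_def)
qed

lemma flow_C_infinity: "C_infinity (\<lambda>(t, x). flow t x) pos_time"
proof -
  have "C_k m (\<lambda>(t, x). flow t x) pos_time \<longleftrightarrow> C_k m (\<lambda>(t, x). F t x) pos_time" for m
    by (rule C_k_cong[OF open_pos_time]) (auto simp: flow_def)
  then show ?thesis using smooth by (simp add: C_infinity_def)
qed

text \<open>Positive times are covered by smoothness. At time 0 the distance from \<open>g x\<close>
  is split into the \<open>near\<close> estimate at \<open>y\<close>, uniform in \<open>y\<close>,
  and the Lipschitz bound between \<open>y\<close> and \<open>x\<close>.\<close>

lemma flow_continuous: "continuous_on ({0..} \<times> UNIV) (\<lambda>(t, x). flow t x)"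
  unfolding continuous_on_def
proof
  fix p :: "real \<times> (real ^ 'n)" assume "p \<in> {0..} \<times> UNIV"
  then obtain t x where p: "p = (t, x)" "t \<ge> 0" by auto
  show "((\<lambda>(t, x). flow t x) \<longlongrightarrow> (\<lambda>(t, x). flow t x) p) (at p within {0..} \<times> UNIV)"
  proof (cases "t = 0")
    case False
    then have "p \<in> pos_time" using p by auto
    moreover have "continuous_on pos_time (\<lambda>(t, x). flow t x)"
      using flow_C_infinity C_k.simps(1) unfolding C_infinity_def by blast
    ultimately have "isCont (\<lambda>(t, x). flow t x) p"
      using open_pos_time continuous_on_eq_continuous_at by blast
    then show ?thesis unfolding isCont_def by (rule tendsto_within_subset) simp
  next
    case True
    have bound: "\<bar>flow s y - g x\<bar> \<le> C * sqrt s + L * dist y x" if "0 \<le> s" "s \<le> \<tau>" for s y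
    proof -
      have "\<bar>g y - g x\<bar> \<le> L * dist y x" using lipschitz_onD[OF lip, of y x] by (simp add: dist_real_def)
      moreover have "\<bar>flow s y - g y\<bar> \<le> C * sqrt s" using near[of s y] that by (simp add: flow_def)
      ultimately show ?thesis by linarith
    qed
    have "((\<lambda>q. C * sqrt (fst q) + L * dist (snd q) x) \<longlongrightarrow> C * sqrt (fst p) + L * dist (snd p) x) (at p within {0..} \<times> UNIV)"
      by (intro tendsto_intros)
    then have lim: "((\<lambda>q. C * sqrt (fst q) + L * dist (snd q) x) \<longlongrightarrow> 0) (at p within {0..} \<times> UNIV)"
      using True p by simp
    have "((\<lambda>q. fst q) \<longlongrightarrow> fst p) (at p within {0..} \<times> UNIV)" by (intro tendsto_intros)
    then have "\<forall>\<^sub>F q in at p within {0..} \<times> UNIV. fst q < \<tau>" using True p \<tau> by (intro order_tendstoD) auto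
    moreover have "\<forall>\<^sub>F q in at p within {0..} \<times> UNIV. q \<in> {0..} \<times> UNIV"
      by (simp add: eventually_at_filter)
    ultimately have "\<forall>\<^sub>F q in at p within {0..} \<times> UNIV. norm ((\<lambda>(t, x). flow t x) q - g x) \<le> C * sqrt (fst q) + L * dist (snd q) x"
      by eventually_elim (auto intro!: bound)
    then have "((\<lambda>q. (\<lambda>(t, x). flow t x) q - g x) \<longlongrightarrow> 0) (at p within {0..} \<times> UNIV)"
      by (rule Lim_null_comparison[OF _ lim])
    then show ?thesis using True p by (simp add: flow_def LIM_zero_cancel)
  qed
qed

lemma flow_right_limit:
  assumes "t \<ge> 0"
  shows "((\<lambda>\<delta>. flow (t + \<delta>) x) \<longlongrightarrow> flow t x) (at_right 0)"
proof -
  have "((\<lambda>\<delta>. (\<lambda>(t, x). flow t x) (t + \<delta>, x)) \<longlongrightarrow> (\<lambda>(t, x). flow t x) (t, x)) (at_right 0)"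
  proof (rule continuous_on_tendsto_compose[OF flow_continuous])
    have "((\<lambda>\<delta>. (t + \<delta>, x)) \<longlongrightarrow> (t + 0, x)) (at_right 0)" by (intro tendsto_intros)
    then show "((\<lambda>\<delta>. (t + \<delta>, x)) \<longlongrightarrow> (t, x)) (at_right 0)" by simp
    show "(t, x) \<in> {0..} \<times> UNIV" using assms by simp
    show "\<forall>\<^sub>F \<delta> in at_right 0. (t + \<delta>, x) \<in> {0..} \<times> UNIV"
      using assms by (auto simp: eventually_at_right_field intro!: exI[of _ 1])
  qed
  then show ?thesis by simp
qed

text \<open>The scheme is compared with the flow started at time \<open>\<delta>\<close>, where it is uniformly regular;
  this costs an initial error of order \<open>\<surd>\<delta>\<close>.\<close>

lemma tendsto_of_delayed_estimate:
  assumes est: "\<And>\<delta> e. 0 < \<delta> \<Longrightarrow> \<delta> \<le> \<tau> \<Longrightarrow> e > 0 \<Longrightarrow>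
    \<forall>\<^sub>F \<epsilon> in at_right 0. \<bar>R \<epsilon> - l \<delta>\<bar> \<le> C * sqrt \<delta> + e"
    and l: "(l \<longlongrightarrow> l0) (at_right 0)"
  shows "(R \<longlongrightarrow> l0) (at_right (0::real))"
proof (rule tendstoI)
  fix e :: real assume e: "e > 0"
  have "((\<lambda>\<delta>. C * sqrt \<delta>) \<longlongrightarrow> C * sqrt 0) (at_right 0)" by (intro tendsto_intros)
  then have "\<forall>\<^sub>F \<delta> in at_right 0. C * sqrt \<delta> < e / 3" using e by (intro order_tendstoD) auto
  moreover have "\<forall>\<^sub>F \<delta> in at_right 0. dist (l \<delta>) l0 < e / 3" using tendstoD[OF l, of "e / 3"] e by simp
  moreover have "\<forall>\<^sub>F \<delta> in at_right 0. 0 < \<delta> \<and> \<delta> < \<tau>" using \<tau> by (auto simp: eventually_at_right_field)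
  ultimately have "\<forall>\<^sub>F \<delta> in at_right 0. C * sqrt \<delta> < e / 3 \<and> dist (l \<delta>) l0 < e / 3 \<and> 0 < \<delta> \<and> \<delta> < \<tau>"
    by eventually_elim auto
  \<comment> \<open>One third of \<open>e\<close> each for the initial error, for the shift in time
    by \<open>\<delta>\<close>, and for the discretisation.\<close>
  then obtain \<delta> where \<delta>: "C * sqrt \<delta> < e / 3" "dist (l \<delta>) l0 < e / 3" "0 < \<delta>" "\<delta> < \<tau>"
    using eventually_happens'[OF trivial_limit_at_right_real] by blast
  have "\<forall>\<^sub>F \<epsilon> in at_right 0. \<bar>R \<epsilon> - l \<delta>\<bar> \<le> C * sqrt \<delta> + e / 3" using est[of \<delta> "e / 3"] \<delta> e by simp
  then show "\<forall>\<^sub>F \<epsilon> in at_right 0. dist (R \<epsilon>) l0 < e"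
    by eventually_elim (use \<delta> in \<open>unfold dist_real_def, linarith\<close>)
qed

context
  fixes \<phi> :: "real ^ 'n stencil \<Rightarrow> real" and b :: "'n stencil"
  assumes shift: "shift_equivariant \<phi>" and mono: "mono \<phi>"
    and sym: "lattice_symmetric \<phi>" and C2: "C_k 2 \<phi> UNIV" and bs: "b \<in> nonzero_stencil"
begin

lemma rescaled_surface_tendsto_flow:
  assumes "\<beta> = beta \<phi> b" "\<gamma> = gamma \<phi> b" and "t \<ge> 0"
  shows "((\<lambda>\<epsilon>. rescaled_surface \<phi> g \<epsilon> t x) \<longlongrightarrow> flow t x) (at_right 0)"
proof (rule tendsto_of_delayed_estimate[OF _ flow_right_limit[OF \<open>t \<ge> 0\<close>]])
  fix \<delta> e :: real assume \<delta>: "0 < \<delta>" "\<delta> \<le> \<tau>" and e: "e > 0"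
  have le: "\<delta> \<le> t + \<delta>" using \<open>t \<ge> 0\<close> by simp
  obtain M where M: "M \<ge> 0" and b: "\<And>s x i. \<delta> \<le> s \<Longrightarrow> s \<le> t + \<delta> \<Longrightarrow>
      \<bar>F1 i s x\<bar> \<le> M \<and> \<bar>F2 i s x\<bar> \<le> M \<and> \<bar>F3 i s x\<bar> \<le> M \<and> \<bar>Ft s x\<bar> \<le> M \<and> \<bar>Ftt s x\<bar> \<le> M"
    using bounds[OF \<delta>(1) le] by blast
  have pos: "s > 0" if "\<delta> \<le> s" for s using that \<delta> by simp
  \<comment> \<open>The scheme runs for the time \<open>t\<close> but is compared with the flow from
    \<open>\<delta>\<close> to \<open>t + \<delta>\<close>, so it approaches
    \<open>F (t + \<delta>) x\<close>.\<close>
  have "\<forall>\<^sub>F \<epsilon> in at_right 0. \<bar>rescaled_surface \<phi> g \<epsilon> (t + \<delta> - \<delta>) x - F (t + \<delta>) x\<bar> \<le> C * sqrt \<delta> + e"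
    by (rule scheme_convergence_smooth[OF shift mono sym C2 bs le M e, where Ft = Ft and Ftt = Ftt and ?F1.0 = F1 and ?F2.0 = F2 and ?F3.0 = F3])
      (use near[OF \<delta>] in \<open>auto intro!: d1 d2 d3 dt dtt differentiable_space pde[unfolded assms] pos
        dest: b simp: abs_minus_commute\<close>)
  then show "\<forall>\<^sub>F \<epsilon> in at_right 0. \<bar>rescaled_surface \<phi> g \<epsilon> t x - flow (t + \<delta>) x\<bar> \<le> C * sqrt \<delta> + e"
    using \<delta> \<open>t \<ge> 0\<close> by (simp add: flow_def)
qed

text \<open>With both coefficients of \<open>\<phi>\<close> zero the limit equation says that
  nothing moves, so the comparison function is constant in time, namely \<open>F \<delta>\<close>.
  The flow of the locale, whose coefficients are unrelated to those of \<open>\<phi>\<close>, acts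
  as a mollifier.\<close>

lemma rescaled_surface_tendsto_initial:
  assumes "beta \<phi> b = 0" "gamma \<phi> b = 0" and "t \<ge> 0"
  shows "((\<lambda>\<epsilon>. rescaled_surface \<phi> g \<epsilon> t x) \<longlongrightarrow> g x) (at_right 0)"
proof (rule tendsto_of_delayed_estimate[where l = "\<lambda>\<delta>. flow (0 + \<delta>) x"])
  show "((\<lambda>\<delta>. flow (0 + \<delta>) x) \<longlongrightarrow> g x) (at_right 0)"
    using flow_right_limit[of 0 x] by (simp add: flow_initial)
  fix \<delta> e :: real assume \<delta>: "0 < \<delta>" "\<delta> \<le> \<tau>" and e: "e > 0"
  obtain M where M: "M \<ge> 0" and b: "\<And>x i. \<bar>F1 i \<delta> x\<bar> \<le> M \<and> \<bar>F2 i \<delta> x\<bar> \<le> M \<and> \<bar>F3 i \<delta> x\<bar> \<le> M"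
    using bounds[OF \<delta>(1) order_refl] by blast
  have "\<forall>\<^sub>F \<epsilon> in at_right 0. \<bar>rescaled_surface \<phi> g \<epsilon> (t - 0) x - F \<delta> x\<bar> \<le> C * sqrt \<delta> + e"
    by (rule scheme_convergence_smooth[OF shift mono sym C2 bs \<open>t \<ge> 0\<close> M e, where F = "\<lambda>_. F \<delta>" and Ft = "\<lambda>_ _. 0"
          and Ftt = "\<lambda>_ _. 0" and ?F1.0 = "\<lambda>i _. F1 i \<delta>" and ?F2.0 = "\<lambda>i _. F2 i \<delta>" and ?F3.0 = "\<lambda>i _. F3 i \<delta>"])
      (use near[OF \<delta>] b M assms \<delta> in \<open>auto intro!: d1 d2 d3 differentiable_space simp: abs_minus_commute\<close>)
  then show "\<forall>\<^sub>F \<epsilon> in at_right 0. \<bar>rescaled_surface \<phi> g \<epsilon> t x - flow (0 + \<delta>) x\<bar> \<le> C * sqrt \<delta> + e"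
    using \<delta> by (simp add: flow_def)
qed

end

end

section \<open>The heat flow and the deterministic KPZ flow\<close>

lemma finite_uniform_bound:
  fixes f :: "'k \<Rightarrow> 'p \<Rightarrow> real"
  assumes "finite S" and "\<And>k. k \<in> S \<Longrightarrow> \<exists>M. \<forall>p\<in>A. \<bar>f k p\<bar> \<le> M"
  shows "\<exists>M\<ge>0. \<forall>k\<in>S. \<forall>p\<in>A. \<bar>f k p\<bar> \<le> M"
  using assms
proof (induction S rule: finite_induct)
  case (insert k S)
  obtain M where "M \<ge> 0" "\<forall>k\<in>S. \<forall>p\<in>A. \<bar>f k p\<bar> \<le> M" using insert by auto
  moreover obtain M' where "\<forall>p\<in>A. \<bar>f k p\<bar> \<le> M'" using insert.prems by blast
  ultimately show ?case by (intro exI[of _ "max M M'"]) (auto simp: le_max_iff_disj)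
qed auto

text \<open>For \<open>u \<ge> 0\<close> the tangent inequality at \<open>- u\<close> is multiplied
  by \<open>exp u\<close>. The lemma bounds relative increments of the Cole-Hopf datum.\<close>

lemma abs_exp_minus_1_le: "\<bar>exp u - 1\<bar> \<le> \<bar>u\<bar> * exp \<bar>u\<bar>" for u :: real
proof (cases "u \<ge> 0")
  case True
  have "(1 + (- u)) * exp u \<le> exp (- u) * exp u"
    using exp_ge_add_one_self[of "- u"] by (intro mult_right_mono) auto
  then show ?thesis using True by (simp add: exp_minus algebra_simps)
next
  case False
  then have "1 - exp u \<le> - u" using exp_ge_add_one_self[of u] by linarith
  also have "\<dots> \<le> - u * exp (- u)" using False by (simp add: mult_le_cancel_left1)
  finally show ?thesis using False by simp
qed

lemma exp_bounded_lipschitz: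
  fixes g :: "real ^ 'n::finite \<Rightarrow> real"
  assumes "L-lipschitz_on UNIV g"
  shows "exp_bounded g"
proof -
  have "\<bar>g y\<bar> \<le> (\<bar>g 0\<bar> + L) * exp (1 * norm y)" for y
  proof -
    have L: "L \<ge> 0" by (rule lipschitz_on_nonneg[OF assms])
    have e: "norm y \<le> exp (norm y)" using exp_ge_add_one_self[of "norm y"] by linarith
    have "\<bar>g y\<bar> \<le> \<bar>g 0\<bar> + L * norm y"
      using lipschitz_onD[OF assms, of y 0] by (simp add: dist_real_def)
    also have "\<dots> \<le> \<bar>g 0\<bar> * exp (norm y) + L * exp (norm y)"
      using e L by (intro add_mono mult_left_mono) (auto simp: mult_le_cancel_left1)
    finally show ?thesis by (simp add: algebra_simps)
  qed
  moreover have "g \<in> borel_measurable borel"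
    using lipschitz_on_continuous_on[OF assms] by (rule borel_measurable_continuous_onI)
  moreover have "\<bar>g 0\<bar> + L \<ge> 0" using lipschitz_on_nonneg[OF assms] by simp
  ultimately show ?thesis unfolding exp_bounded_def by (metis zero_le_one)
qed

section \<open>The heat flow of a Lipschitz function\<close>

abbreviation heat_x :: "real \<Rightarrow> 'n::finite \<Rightarrow> real \<times> (real ^ 'n) \<Rightarrow> real" where
  "heat_x \<beta> i \<equiv> partial_deriv (space_dir i) (heat_fun \<beta>)"
abbreviation heat_xx :: "real \<Rightarrow> 'n::finite \<Rightarrow> real \<times> (real ^ 'n) \<Rightarrow> real" where
  "heat_xx \<beta> i \<equiv> partial_deriv (space_dir i) (heat_x \<beta> i)"
abbreviation heat_xxx :: "real \<Rightarrow> 'n::finite \<Rightarrow> real \<times> (real ^ 'n) \<Rightarrow> real" where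
  "heat_xxx \<beta> i \<equiv> partial_deriv (space_dir i) (heat_xx \<beta> i)"
abbreviation heat_t :: "real \<Rightarrow> real \<times> (real ^ 'n::finite) \<Rightarrow> real" where
  "heat_t \<beta> \<equiv> partial_deriv time_dir (heat_fun \<beta>)"
abbreviation heat_tt :: "real \<Rightarrow> real \<times> (real ^ 'n::finite) \<Rightarrow> real" where
  "heat_tt \<beta> \<equiv> partial_deriv time_dir (heat_t \<beta>)"

text \<open>The kernels behind all derivatives that \<open>smooth_flow\<close> wants bounded; as a
  finite set they admit one common bound.\<close>

definition heat_derivs :: "real \<Rightarrow> (real \<times> (real ^ 'n::finite) \<Rightarrow> real) set" where
  "heat_derivs \<beta> = range (heat_x \<beta>) \<union> range (heat_xx \<beta>) \<union> range (heat_xxx \<beta>) \<union> {heat_t \<beta>, heat_tt \<beta>}"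

lemma finite_heat_derivs: "finite (heat_derivs \<beta>)"
  by (simp add: heat_derivs_def)

lemma heat_derivs_mem:
  "heat_x \<beta> i \<in> heat_derivs \<beta>" "heat_xx \<beta> i \<in> heat_derivs \<beta>" "heat_xxx \<beta> i \<in> heat_derivs \<beta>"
  "heat_t \<beta> \<in> heat_derivs \<beta>" "heat_tt \<beta> \<in> heat_derivs \<beta>"
  by (auto simp: heat_derivs_def)

lemma heat_derivs_kernels:
  assumes "\<beta> > 0"
  shows "heat_fun \<beta> \<in> gaussian_kernels \<beta>" "heat_x \<beta> i \<in> gaussian_kernels \<beta>" "heat_xx \<beta> i \<in> gaussian_kernels \<beta>"
    "heat_xxx \<beta> i \<in> gaussian_kernels \<beta>" "heat_t \<beta> \<in> gaussian_kernels \<beta>" "heat_tt \<beta> \<in> gaussian_kernels \<beta>"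
  by (intro gaussian_kernels_partial_deriv[OF assms] gaussian_kernels.heat)+

lemma heat_derivs_subset: "\<beta> > 0 \<Longrightarrow> heat_derivs \<beta> \<subseteq> gaussian_kernels \<beta>"
  using heat_derivs_kernels by (auto simp: heat_derivs_def)

lemma heat_derivs_zero_mean:
  assumes \<beta>: "\<beta> > 0" and "k \<in> heat_derivs \<beta>" and "fst p > 0"
  shows "kernel_conv k (\<lambda>_. 1) p = 0"
proof -
  note step = kernel_conv_partial_deriv_1[OF \<beta>]
  note k = heat_derivs_kernels[OF \<beta>]
  have x: "fst q > 0 \<Longrightarrow> kernel_conv (heat_x \<beta> i) (\<lambda>_. 1) q = 0" for i q
    by (rule step[OF k(1) space_dir_Basis kernel_conv_heat_1[OF \<beta>]])
  have xx: "fst q > 0 \<Longrightarrow> kernel_conv (heat_xx \<beta> i) (\<lambda>_. 1) q = 0" for i q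
    by (rule step[OF k(2) space_dir_Basis x])
  have xxx: "fst q > 0 \<Longrightarrow> kernel_conv (heat_xxx \<beta> i) (\<lambda>_. 1) q = 0" for i q
    by (rule step[OF k(3) space_dir_Basis xx])
  have t: "fst q > 0 \<Longrightarrow> kernel_conv (heat_t \<beta>) (\<lambda>_. 1) q = 0" for q
    by (rule step[OF k(1) time_dir_Basis kernel_conv_heat_1[OF \<beta>]])
  have tt: "fst q > 0 \<Longrightarrow> kernel_conv (heat_tt \<beta>) (\<lambda>_. 1) q = 0" for q
    by (rule step[OF k(5) time_dir_Basis t])
  from assms(2) show ?thesis
    unfolding heat_derivs_def by (elim UnE rangeE insertE emptyE)
      (simp_all only: x[OF assms(3)] xx[OF assms(3)] xxx[OF assms(3)] t[OF assms(3)] tt[OF assms(3)])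
qed

text \<open>\<open>g\<close> may be unbounded, but these kernels have mean zero, so \<open>g\<close>
  is replaced by \<open>g - g x\<close>, which is at most \<open>L * exp (norm (x - y))\<close> in
  absolute value, whatever \<open>x\<close> is.\<close>

lemma heat_flow_bounds:
  fixes g :: "real ^ 'n::finite \<Rightarrow> real"
  assumes \<beta>: "\<beta> > 0" and lip: "L-lipschitz_on UNIV g" and "0 < \<alpha>" "\<alpha> \<le> \<omega>"
  shows "\<exists>M\<ge>0. \<forall>k\<in>heat_derivs \<beta>. \<forall>p\<in>{\<alpha>..\<omega>} \<times> UNIV. \<bar>kernel_conv k g p\<bar> \<le> M"
proof (rule finite_uniform_bound[OF finite_heat_derivs])
  fix k :: "real \<times> (real ^ 'n) \<Rightarrow> real" assume k: "k \<in> heat_derivs \<beta>"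
  then have kk: "k \<in> gaussian_kernels \<beta>" using heat_derivs_subset[OF \<beta>] by blast
  have L: "L \<ge> 0" by (rule lipschitz_on_nonneg[OF lip])
  obtain M where M: "\<And>t x G D. \<alpha> \<le> t \<Longrightarrow> t \<le> \<omega> \<Longrightarrow> D \<ge> 0 \<Longrightarrow> exp_bounded G \<Longrightarrow>
    (\<forall>y. \<bar>G y\<bar> \<le> D * exp (1 * norm (x - y))) \<Longrightarrow> \<bar>kernel_conv k G (t, x)\<bar> \<le> M * D"
    using kernel_conv_upper_bound[OF \<beta> kk assms(3,4), of 1] by blast
  have "\<bar>kernel_conv k g (t, x)\<bar> \<le> M * L" if t: "\<alpha> \<le> t" "t \<le> \<omega>" for t x
  proof -
    have t0: "t > 0" using t assms by simp
    let ?G = "\<lambda>y. g y - g x"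
    have lip': "L-lipschitz_on UNIV ?G"
      using lip by (simp add: lipschitz_on_def dist_real_def)
    have "\<bar>?G y\<bar> \<le> L * exp (1 * norm (x - y))" for y
    proof -
      have e: "norm (x - y) \<le> exp (norm (x - y))" using exp_ge_add_one_self[of "norm (x - y)"] by linarith
      have "\<bar>?G y\<bar> \<le> L * norm (x - y)"
        using lipschitz_onD[OF lip, of y x] by (simp add: dist_real_def dist_norm norm_minus_commute)
      also have "\<dots> \<le> L * exp (1 * norm (x - y))"
        using e L by (intro mult_left_mono) auto
      finally show ?thesis .
    qed
    then have "\<bar>kernel_conv k ?G (t, x)\<bar> \<le> M * L"
      by (intro M t L exp_bounded_lipschitz[OF lip']) auto
    moreover have "kernel_conv k g (t, x) = kernel_conv k ?G (t, x)"
      using kernel_conv_diff(1)[OF \<beta> kk t0 exp_bounded_lipschitz[OF lip], of x "g x"]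
        heat_derivs_zero_mean[OF \<beta> k, of "(t, x)"] t0
      by (simp add: kernel_conv_def)
    ultimately show ?thesis by simp
  qed
  then show "\<exists>M. \<forall>p\<in>{\<alpha>..\<omega>} \<times> UNIV. \<bar>kernel_conv k g p\<bar> \<le> M" by (intro exI[of _ "M * L"]) auto
qed

lemma heat_flow:
  fixes g :: "real ^ 'n::finite \<Rightarrow> real"
  assumes \<beta>: "\<beta> > 0" and lip: "L-lipschitz_on UNIV g"
  shows "\<exists>C. smooth_flow \<beta> 0 g (\<lambda>t x. kernel_conv (heat_fun \<beta>) g (t, x))
    (\<lambda>t x. kernel_conv (heat_t \<beta>) g (t, x)) (\<lambda>t x. kernel_conv (heat_tt \<beta>) g (t, x))
    (\<lambda>i t x. kernel_conv (heat_x \<beta> i) g (t, x)) (\<lambda>i t x. kernel_conv (heat_xx \<beta> i) g (t, x))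
    (\<lambda>i t x. kernel_conv (heat_xxx \<beta> i) g (t, x)) L C 1"
proof -
  have G: "exp_bounded g" by (rule exp_bounded_lipschitz[OF lip])
  have L: "L \<ge> 0" by (rule lipschitz_on_nonneg[OF lip])
  note k = heat_derivs_kernels[OF \<beta>]
  \<comment> \<open>Here \<open>B = 0\<close>: the increments of \<open>g\<close> itself are bounded
    linearly, without an exponential weight.\<close>
  obtain C where C: "C \<ge> 0" and near: "\<And>t x G D. 0 < t \<Longrightarrow> t \<le> 1 \<Longrightarrow> D \<ge> 0 \<Longrightarrow> exp_bounded G \<Longrightarrow>
    (\<forall>y :: real ^ 'n. \<bar>G y - G x\<bar> \<le> D * (norm (x - y) * exp (0 * norm (x - y)))) \<Longrightarrow>
    \<bar>kernel_conv (heat_fun \<beta>) G (t, x) - G x\<bar> \<le> D * (C * sqrt t)"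
    using kernel_conv_heat_near_initial[OF \<beta> order_refl] by blast
  show ?thesis
  proof (rule exI[of _ "L * C"], rule smooth_flow.intro)
    show "\<bar>kernel_conv (heat_fun \<beta>) g (t, x) - g x\<bar> \<le> L * C * sqrt t" if "0 < t" "t \<le> 1" for t x
    proof -
      have "\<bar>g y - g x\<bar> \<le> L * (norm (x - y) * exp (0 * norm (x - y)))" for y
        using lipschitz_onD[OF lip, of y x] by (simp add: dist_real_def dist_norm norm_minus_commute)
      then show ?thesis using near[OF that L G, of x] by (simp add: mult.assoc)
    qed
    show "\<exists>M\<ge>0. \<forall>t x i. \<alpha> \<le> t \<longrightarrow> t \<le> \<omega> \<longrightarrow> \<bar>kernel_conv (heat_x \<beta> i) g (t, x)\<bar> \<le> M \<and>
        \<bar>kernel_conv (heat_xx \<beta> i) g (t, x)\<bar> \<le> M \<and> \<bar>kernel_conv (heat_xxx \<beta> i) g (t, x)\<bar> \<le> M \<and>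
        \<bar>kernel_conv (heat_t \<beta>) g (t, x)\<bar> \<le> M \<and> \<bar>kernel_conv (heat_tt \<beta>) g (t, x)\<bar> \<le> M"
      if \<alpha>: "0 < \<alpha>" "\<alpha> \<le> \<omega>" for \<alpha> \<omega>
    proof -
      obtain M where "M \<ge> 0" and M: "\<And>k t x. k \<in> heat_derivs \<beta> \<Longrightarrow> \<alpha> \<le> t \<Longrightarrow> t \<le> \<omega> \<Longrightarrow> \<bar>kernel_conv k g (t, x)\<bar> \<le> M"
        using heat_flow_bounds[OF \<beta> lip \<alpha>] by auto
      then show ?thesis using heat_derivs_mem by blast
    qed
    show "C_k m (\<lambda>(t, x). kernel_conv (heat_fun \<beta>) g (t, x)) pos_time" for m
      using C_k_kernel_conv[OF \<beta> k(1) G] by (simp add: case_prod_unfold)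
  qed (use lip C L in \<open>auto intro!: kernel_conv_DERIV_space[OF \<beta> _ G] kernel_conv_DERIV_time[OF \<beta> _ G] kernel_conv_heat_equation[OF \<beta> _ G] k\<close>)
qed

text \<open>Three derivatives of \<open>c * ln U\<close> as polynomials in the ratios of the
  derivatives of \<open>U\<close> to \<open>U\<close>. In this form bounds on the ratios carry over
  although \<open>U\<close> and its derivatives may be unbounded.\<close>

lemma DERIV_log_ratios:
  fixes U U1 U2 U3 :: "real \<Rightarrow> real"
  assumes pos: "U s > 0"
    and U: "(U has_real_derivative U1 s) (at s)" "(U1 has_real_derivative U2 s) (at s)" "(U2 has_real_derivative U3 s) (at s)"
  shows "((\<lambda>s. c * ln (U s)) has_real_derivative c * (U1 s / U s)) (at s)"
    and "((\<lambda>s. c * (U1 s / U s)) has_real_derivative c * (U2 s / U s - (U1 s / U s)\<^sup>2)) (at s)"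
    and "((\<lambda>s. c * (U2 s / U s - (U1 s / U s)\<^sup>2)) has_real_derivative
      c * (U3 s / U s - 3 * (U1 s / U s) * (U2 s / U s) + 2 * (U1 s / U s) ^ 3)) (at s)"
  using pos
  by (auto intro!: derivative_eq_intros U simp: field_simps power2_eq_square power3_eq_cube)

text \<open>The Cole-Hopf transformation: \<open>U\<close> solves the heat equation, and the
  negative square in the second derivative of \<open>c * ln U\<close> is compensated by the gradient
  term. \<open>G\<close>, \<open>U\<close> and the derivatives of \<open>U\<close> are all compared
  with \<open>G x\<close>.\<close>

lemma kpz_flow:
  fixes g :: "real ^ 'n::finite \<Rightarrow> real"
  assumes \<beta>: "\<beta> > 0" and \<gamma>: "\<gamma> \<noteq> 0" and lip: "L-lipschitz_on UNIV g"
  defines "G \<equiv> \<lambda>y. exp (\<gamma> * g y / \<beta>)"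
  shows "exp_bounded G"
    and "\<exists>Ft Ftt F1 F2 F3 C \<tau>. smooth_flow \<beta> \<gamma> g (\<lambda>t x. \<beta> / \<gamma> * ln (kernel_conv (heat_fun \<beta>) G (t, x)))
      Ft Ftt F1 F2 F3 L C \<tau>"
proof -
  define c where "c = \<beta> / \<gamma>"
  \<comment> \<open>\<open>B\<close> is a Lipschitz constant of the exponent
    \<open>\<gamma> * g y / \<beta>\<close>.\<close>
  define B where "B = \<bar>\<gamma> / \<beta>\<bar> * L"
  have L: "L \<ge> 0" by (rule lipschitz_on_nonneg[OF lip])
  have B: "B \<ge> 0" using L by (simp add: B_def)
  have Gpos: "G x > 0" for x by (simp add: G_def)
  have Geq: "G y = G x * exp (\<gamma> * (g y - g x) / \<beta>)" for x y
    using \<beta> by (simp add: G_def exp_add[symmetric] diff_divide_distrib right_diff_distrib)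
  have incr: "\<bar>\<gamma> * (g y - g x) / \<beta>\<bar> \<le> B * norm (x - y)" for x y
  proof -
    have "\<bar>g y - g x\<bar> \<le> L * norm (x - y)"
      using lipschitz_onD[OF lip, of y x] by (simp add: dist_real_def dist_norm norm_minus_commute)
    then have "\<bar>\<gamma> / \<beta>\<bar> * \<bar>g y - g x\<bar> \<le> \<bar>\<gamma> / \<beta>\<bar> * (L * norm (x - y))" by (intro mult_left_mono) auto
    then show ?thesis by (simp add: B_def abs_mult mult.assoc)
  qed
  \<comment> \<open>These are the hypotheses of the upper and lower convolution bounds with
    \<open>D = G x\<close>.\<close>
  have Gup: "\<bar>G y\<bar> \<le> G x * exp (B * norm (x - y))" and Glow: "G x * exp (- B * norm (x - y)) \<le> G y" for x y
    using abs_le_D1[OF incr[of y x]] abs_le_D2[OF incr[of y x]] Gpos[of x] Gpos[of y] unfolding Geq[of y x]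
    by (simp_all add: abs_mult)
  have "G \<in> borel_measurable borel"
    unfolding G_def by (intro borel_measurable_continuous_onI continuous_intros lipschitz_on_continuous_on[OF lip])
      (use \<beta> in simp)
  then show G: "exp_bounded G"
    unfolding exp_bounded_def using Gup[of _ 0] Gpos[of 0] B
    by (intro conjI exI[of _ "G 0"] exI[of _ B]) (simp_all add: less_imp_le)
  define u where "u k t x = kernel_conv k G (t, x)" for k t x
  define U where "U = u (heat_fun \<beta>)"
  note k = heat_derivs_kernels[OF \<beta>]
  have Upos: "U t x > 0" if t: "t > 0" for t x
  proof -
    obtain m where "m > 0" and m: "\<And>s x G D. t \<le> s \<Longrightarrow> s \<le> t \<Longrightarrow> D \<ge> 0 \<Longrightarrow> exp_bounded G \<Longrightarrow>
      (\<forall>y :: real ^ 'n. D * exp (- B * norm (x - y)) \<le> G y) \<Longrightarrow> m * D \<le> kernel_conv (heat_fun \<beta>) G (s, x)"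
      using kernel_conv_heat_lower_bound[OF \<beta> t order_refl B] by blast
    have "0 < m * G x" using \<open>m > 0\<close> Gpos[of x] by simp
    also have "\<dots> \<le> U t x" unfolding U_def u_def by (rule m) (use Gpos[of x] Glow G in auto)
    finally show ?thesis .
  qed
  define F1 where "F1 i t x = c * (u (heat_x \<beta> i) t x / U t x)" for i t x
  define F2 where "F2 i t x = c * (u (heat_xx \<beta> i) t x / U t x - (u (heat_x \<beta> i) t x / U t x)\<^sup>2)" for i t x
  define F3 where "F3 i t x = c * (u (heat_xxx \<beta> i) t x / U t x
    - 3 * (u (heat_x \<beta> i) t x / U t x) * (u (heat_xx \<beta> i) t x / U t x) + 2 * (u (heat_x \<beta> i) t x / U t x) ^ 3)" for i t x
  define Ft where "Ft t x = c * (u (heat_t \<beta>) t x / U t x)" for t x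
  define Ftt where "Ftt t x = c * (u (heat_tt \<beta>) t x / U t x - (u (heat_t \<beta>) t x / U t x)\<^sup>2)" for t x
  have bounds: "\<exists>M\<ge>0. \<forall>t x i. \<alpha> \<le> t \<longrightarrow> t \<le> \<omega> \<longrightarrow> \<bar>F1 i t x\<bar> \<le> M \<and> \<bar>F2 i t x\<bar> \<le> M \<and>
      \<bar>F3 i t x\<bar> \<le> M \<and> \<bar>Ft t x\<bar> \<le> M \<and> \<bar>Ftt t x\<bar> \<le> M" if \<alpha>: "0 < \<alpha>" "\<alpha> \<le> \<omega>" for \<alpha> \<omega>
  proof -
    obtain m where "m > 0" and m: "\<And>s x G D. \<alpha> \<le> s \<Longrightarrow> s \<le> \<omega> \<Longrightarrow> D \<ge> 0 \<Longrightarrow> exp_bounded G \<Longrightarrow>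
      (\<forall>y :: real ^ 'n. D * exp (- B * norm (x - y)) \<le> G y) \<Longrightarrow> m * D \<le> kernel_conv (heat_fun \<beta>) G (s, x)"
      using kernel_conv_heat_lower_bound[OF \<beta> \<alpha> B] by blast
    \<comment> \<open>The factor \<open>G x\<close> of this lower bound cancels against the same
      factor in the upper bound of the differentiated convolutions, leaving a bound on the ratios
      independent of \<open>x\<close>.\<close>
    have mU: "m * G x \<le> U t x" if "\<alpha> \<le> t" "t \<le> \<omega>" for t x
      unfolding U_def u_def by (rule m[OF that]) (use Gpos[of x] Glow G in auto)
    have "\<exists>M\<ge>0. \<forall>k\<in>heat_derivs \<beta>. \<forall>p\<in>{\<alpha>..\<omega>} \<times> UNIV. \<bar>(\<lambda>k (t, x). u k t x / U t x) k p\<bar> \<le> M"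
    proof (rule finite_uniform_bound[OF finite_heat_derivs])
      fix k :: "real \<times> (real ^ 'n) \<Rightarrow> real" assume "k \<in> heat_derivs \<beta>"
      then have kk: "k \<in> gaussian_kernels \<beta>" using heat_derivs_subset[OF \<beta>] by blast
      obtain M where M: "\<And>t x G D. \<alpha> \<le> t \<Longrightarrow> t \<le> \<omega> \<Longrightarrow> D \<ge> 0 \<Longrightarrow> exp_bounded G \<Longrightarrow>
        (\<forall>y. \<bar>G y\<bar> \<le> D * exp (B * norm (x - y))) \<Longrightarrow> \<bar>kernel_conv k G (t, x)\<bar> \<le> M * D" and "M \<ge> 0"
        using kernel_conv_upper_bound[OF \<beta> kk \<alpha>, of B] by blast
      have "\<bar>u k t x / U t x\<bar> \<le> M / m" if t: "\<alpha> \<le> t" "t \<le> \<omega>" for t x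
      proof -
        have "\<bar>u k t x\<bar> \<le> M * G x" unfolding u_def by (rule M[OF t]) (use Gpos[of x] Gup G in auto)
        moreover have "0 < m * G x" using \<open>m > 0\<close> Gpos[of x] by simp
        ultimately have "\<bar>u k t x\<bar> / U t x \<le> (M * G x) / (m * G x)"
          using mU[OF t, of x] \<open>M \<ge> 0\<close> Gpos[of x] by (intro frac_le) auto
        also have "\<dots> = M / m" using Gpos[of x] by simp
        finally show ?thesis using Upos[of t x] t \<alpha> by simp
      qed
      then show "\<exists>M. \<forall>p\<in>{\<alpha>..\<omega>} \<times> UNIV. \<bar>(\<lambda>k (t, x). u k t x / U t x) k p\<bar> \<le> M"
        by (intro exI[of _ "M / m"]) auto
    qed
    then obtain M where "M \<ge> 0" and M: "\<And>k t x. k \<in> heat_derivs \<beta> \<Longrightarrow> \<alpha> \<le> t \<Longrightarrow> t \<le> \<omega> \<Longrightarrow> \<bar>u k t x / U t x\<bar> \<le> M"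
      by auto
    \<comment> \<open>With \<open>N \<ge> 1\<close> the lower powers of \<open>N\<close> are
      dominated by its cube.\<close>
    define N where "N = M + 1"
    have N: "N \<ge> 1" using \<open>M \<ge> 0\<close> by (simp add: N_def)
    have r: "\<bar>u k t x / U t x\<bar> \<le> N" if "k \<in> heat_derivs \<beta>" "\<alpha> \<le> t" "t \<le> \<omega>" for k t x
      using M[OF that, of x] by (simp add: N_def)
    have N3: "N \<le> N ^ 3" "N\<^sup>2 \<le> N ^ 3" using N by (auto intro: power_increasing self_le_power)
    have lin: "\<bar>c * a\<bar> \<le> \<bar>c\<bar> * (6 * N ^ 3)" if "\<bar>a\<bar> \<le> N" for a
      unfolding abs_mult using that N3 N by (intro mult_left_mono) auto
    have sq: "\<bar>a\<^sup>2\<bar> \<le> N\<^sup>2" if "\<bar>a\<bar> \<le> N" for a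
      using power_mono[OF that, of 2] by simp
    have quad: "\<bar>c * (a - b\<^sup>2)\<bar> \<le> \<bar>c\<bar> * (6 * N ^ 3)" if "\<bar>a\<bar> \<le> N" "\<bar>b\<bar> \<le> N" for a b
    proof -
      have "\<bar>a - b\<^sup>2\<bar> \<le> 6 * N ^ 3" using that(1) sq[OF that(2)] N3 N by linarith
      then show ?thesis unfolding abs_mult by (intro mult_left_mono) auto
    qed
    have cub: "\<bar>c * (a - 3 * b * d + 2 * b ^ 3)\<bar> \<le> \<bar>c\<bar> * (6 * N ^ 3)"
      if "\<bar>a\<bar> \<le> N" "\<bar>b\<bar> \<le> N" "\<bar>d\<bar> \<le> N" for a b d
    proof -
      have "\<bar>b * d\<bar> \<le> N * N" unfolding abs_mult using that N by (intro mult_mono) auto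
      then have "\<bar>b * d\<bar> \<le> N ^ 3" using N3(2) by (simp add: power2_eq_square)
      moreover have "\<bar>b ^ 3\<bar> \<le> N ^ 3" using power_mono[OF that(2), of 3] by (simp add: power_abs)
      ultimately have "\<bar>a - 3 * b * d + 2 * b ^ 3\<bar> \<le> 6 * N ^ 3" using that(1) N3(1) by linarith
      then show ?thesis unfolding abs_mult by (intro mult_left_mono) auto
    qed
    show ?thesis
    \<comment> \<open>The factor 6 is the sum \<open>1 + 3 + 2\<close> of the coefficients in the
      third derivative; the lower derivatives need less.\<close>
    proof (intro exI[of _ "\<bar>c\<bar> * (6 * N ^ 3)"] conjI allI impI)
      show "0 \<le> \<bar>c\<bar> * (6 * N ^ 3)" using N by simp
      fix t x i assume t: "\<alpha> \<le> t" "t \<le> \<omega>"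
      note r = r[OF _ t] heat_derivs_mem
      show "\<bar>F1 i t x\<bar> \<le> \<bar>c\<bar> * (6 * N ^ 3)" unfolding F1_def by (intro lin r)
      show "\<bar>F2 i t x\<bar> \<le> \<bar>c\<bar> * (6 * N ^ 3)" unfolding F2_def by (intro quad r)
      show "\<bar>F3 i t x\<bar> \<le> \<bar>c\<bar> * (6 * N ^ 3)" unfolding F3_def by (intro cub r)
      show "\<bar>Ft t x\<bar> \<le> \<bar>c\<bar> * (6 * N ^ 3)" unfolding Ft_def by (intro lin r)
      show "\<bar>Ftt t x\<bar> \<le> \<bar>c\<bar> * (6 * N ^ 3)" unfolding Ftt_def by (intro quad r)
    qed
  qed
  obtain C0 where C0: "C0 \<ge> 0" and near0: "\<And>t x G D. 0 < t \<Longrightarrow> t \<le> 1 \<Longrightarrow> D \<ge> 0 \<Longrightarrow> exp_bounded G \<Longrightarrow>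
    (\<forall>y :: real ^ 'n. \<bar>G y - G x\<bar> \<le> D * (norm (x - y) * exp (B * norm (x - y)))) \<Longrightarrow>
    \<bar>kernel_conv (heat_fun \<beta>) G (t, x) - G x\<bar> \<le> D * (C0 * sqrt t)"
    using kernel_conv_heat_near_initial[OF \<beta> B] by blast
  \<comment> \<open>For \<open>t \<le> \<tau>\<close> the root \<open>sqrt t\<close> is at most
    \<open>a\<close>, which keeps the relative error \<open>B * C0 * sqrt t\<close> below one
    half.\<close>
  define a where "a = 1 / (2 * (B * C0 + 1))"
  define \<tau> where "\<tau> = min 1 (a\<^sup>2)"
  have BC: "B * C0 \<ge> 0" using B C0 by simp
  have a: "a > 0" using BC by (simp add: a_def)
  have near: "\<bar>c * ln (U t x) - g x\<bar> \<le> (2 * \<bar>c\<bar> * (B * C0)) * sqrt t" if t: "0 < t" "t \<le> \<tau>" for t x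
  proof -
    have t1: "t \<le> 1" using t by (simp add: \<tau>_def)
    have "\<bar>U t x - G x\<bar> \<le> (G x * B) * (C0 * sqrt t)"
      unfolding U_def u_def
    proof (rule near0[OF t(1) t1 _ G], use B Gpos[of x] in simp, intro allI)
      fix y
      let ?v = "\<gamma> * (g y - g x) / \<beta>"
      have "\<bar>exp ?v - 1\<bar> \<le> \<bar>?v\<bar> * exp \<bar>?v\<bar>" by (rule abs_exp_minus_1_le)
      also have "\<dots> \<le> (B * norm (x - y)) * exp (B * norm (x - y))"
        using incr[of y x] B by (intro mult_mono) auto
      finally have "G x * \<bar>exp ?v - 1\<bar> \<le> G x * ((B * norm (x - y)) * exp (B * norm (x - y)))"
        using Gpos[of x] by (intro mult_left_mono) auto
      moreover have "G y - G x = G x * (exp ?v - 1)" unfolding Geq[of y x] by (simp add: algebra_simps)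
      ultimately show "\<bar>G y - G x\<bar> \<le> G x * B * (norm (x - y) * exp (B * norm (x - y)))"
        using Gpos[of x] by (simp add: abs_mult mult.assoc)
    qed
    then have "\<bar>U t x - G x\<bar> / G x \<le> B * C0 * sqrt t"
      using Gpos[of x] by (simp add: pos_divide_le_eq mult_ac)
    \<comment> \<open>The relative deviation of \<open>U\<close> from \<open>G\<close>; the error of
      the flow is then \<open>c * ln (1 + w)\<close>.\<close>
    define w where "w = U t x / G x - 1"
    have w: "\<bar>w\<bar> \<le> B * C0 * sqrt t"
    proof -
      have "w = (U t x - G x) / G x" using Gpos[of x] by (simp add: w_def field_simps)
      then show ?thesis using \<open>\<bar>U t x - G x\<bar> / G x \<le> _\<close> Gpos[of x] by simp
    qed
    have "sqrt t \<le> a" using t a by (intro real_le_lsqrt) (auto simp: \<tau>_def)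
    then have "B * C0 * sqrt t \<le> B * C0 * a" using BC by (intro mult_left_mono)
    also have "\<dots> \<le> 1 / 2" using BC by (simp add: a_def field_simps)
    finally have w2: "\<bar>w\<bar> \<le> 1 / 2" using w by simp
    \<comment> \<open>The quadratic remainder of the logarithm is at most
      \<open>\<bar>w\<bar>\<close> because \<open>\<bar>w\<bar> \<le> 1 / 2\<close>, so the
      logarithm is at most \<open>2 * \<bar>w\<bar>\<close>.\<close>
    have "\<bar>ln (1 + w) - w\<bar> \<le> 2 * w\<^sup>2" by (rule abs_ln_one_plus_x_minus_x_bound[OF w2])
    also have "\<dots> \<le> \<bar>w\<bar>"
      using mult_right_mono[OF w2, of "\<bar>w\<bar>"] by (simp add: power2_eq_square abs_mult_self_eq)
    finally have ln: "\<bar>ln (1 + w)\<bar> \<le> 2 * \<bar>w\<bar>" by linarith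
    have "c * ln (U t x) - g x = c * ln (1 + w)"
    proof -
      have "g x = c * ln (G x)" using \<beta> \<gamma> by (simp add: G_def c_def)
      moreover have "ln (1 + w) = ln (U t x) - ln (G x)"
        using Upos[OF t(1), of x] Gpos[of x] by (simp add: w_def ln_div)
      ultimately show ?thesis by (simp only: right_diff_distrib)
    qed
    then have "\<bar>c * ln (U t x) - g x\<bar> \<le> \<bar>c\<bar> * (2 * (B * C0 * sqrt t))"
      using ln w by (simp add: abs_mult mult_left_mono)
    then show ?thesis by (simp add: mult_ac)
  qed
  have flow: "smooth_flow \<beta> \<gamma> g (\<lambda>t x. c * ln (U t x)) Ft Ftt F1 F2 F3 L (2 * \<bar>c\<bar> * (B * C0)) \<tau>"
  proof (rule smooth_flow.intro)
    show "L-lipschitz_on UNIV g" by (rule lip)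
    show "0 \<le> 2 * \<bar>c\<bar> * (B * C0)" "0 < \<tau>" using BC a by (auto simp: \<tau>_def)
    show "\<bar>c * ln (U t x) - g x\<bar> \<le> 2 * \<bar>c\<bar> * (B * C0) * sqrt t" if "0 < t" "t \<le> \<tau>" for t x
      using near[OF that] .
    show "C_k m (\<lambda>(t, x). c * ln (U t x)) pos_time" for m
    proof -
      have "C_k m (\<lambda>p. c * ln (kernel_conv (heat_fun \<beta>) G p)) pos_time"
        using Upos by (intro C_k_mult C_k_const C_k_ln open_pos_time C_k_kernel_conv[OF \<beta> k(1) G]) (auto simp: U_def u_def)
      then show ?thesis by (simp add: case_prod_unfold U_def u_def)
    qed
  next
    fix t :: real and x :: "real ^ 'n" and i :: 'n and s :: real
    assume t: "0 < t"
    note der = DERIV_log_ratios[where s = s and U = "\<lambda>s. U t (x + s *\<^sub>R axis i 1)"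
        and ?U1.0 = "\<lambda>s. u (heat_x \<beta> i) t (x + s *\<^sub>R axis i 1)"
        and ?U2.0 = "\<lambda>s. u (heat_xx \<beta> i) t (x + s *\<^sub>R axis i 1)"
        and ?U3.0 = "\<lambda>s. u (heat_xxx \<beta> i) t (x + s *\<^sub>R axis i 1)",
        OF Upos[OF t] kernel_conv_DERIV_space[OF \<beta> k(1) G t, folded u_def, folded U_def]
          kernel_conv_DERIV_space[OF \<beta> k(2) G t, folded u_def] kernel_conv_DERIV_space[OF \<beta> k(3) G t, folded u_def]]
    show "((\<lambda>s. c * ln (U t (x + s *\<^sub>R axis i 1))) has_real_derivative F1 i t (x + s *\<^sub>R axis i 1)) (at s)"
      "((\<lambda>s. F1 i t (x + s *\<^sub>R axis i 1)) has_real_derivative F2 i t (x + s *\<^sub>R axis i 1)) (at s)"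
      "((\<lambda>s. F2 i t (x + s *\<^sub>R axis i 1)) has_real_derivative F3 i t (x + s *\<^sub>R axis i 1)) (at s)"
      unfolding F1_def F2_def F3_def by (rule der)+
  next
    fix t :: real and x :: "real ^ 'n" assume t: "0 < t"
    have der_t: "((\<lambda>t. U t x) has_real_derivative u (heat_t \<beta>) t x) (at t)"
      "((\<lambda>t. u (heat_t \<beta>) t x) has_real_derivative u (heat_tt \<beta>) t x) (at t)"
      unfolding U_def u_def
      by (rule kernel_conv_DERIV_time[OF \<beta> k(1) G t], rule kernel_conv_DERIV_time[OF \<beta> k(5) G t])
    show "((\<lambda>t. c * ln (U t x)) has_real_derivative Ft t x) (at t)"
      unfolding Ft_def using Upos[OF t, of x] by (auto intro!: derivative_eq_intros der_t)
    show "((\<lambda>t. Ft t x) has_real_derivative Ftt t x) (at t)"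
      unfolding Ft_def Ftt_def using Upos[OF t, of x]
      by (auto intro!: derivative_eq_intros der_t simp: field_simps power2_eq_square)
    have heat: "u (heat_t \<beta>) t x = \<beta> * (\<Sum>i\<in>UNIV. u (heat_xx \<beta> i) t x)"
      unfolding u_def by (rule kernel_conv_heat_equation[OF \<beta> t G])
    \<comment> \<open>This identity determines \<open>c = \<beta> / \<gamma>\<close>: it makes the
      squares in \<open>F2\<close> cancel against the gradient term.\<close>
    have cc: "\<gamma> * (c * c) = \<beta> * c" using \<gamma> by (simp add: c_def)
    have sq: "\<gamma> * (\<Sum>i\<in>UNIV. (F1 i t x)\<^sup>2) = \<beta> * c * (\<Sum>i\<in>UNIV. (u (heat_x \<beta> i) t x / U t x)\<^sup>2)"
    proof -
      have "(F1 i t x)\<^sup>2 = (c * c) * (u (heat_x \<beta> i) t x / U t x)\<^sup>2" for i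
        by (simp add: F1_def power2_eq_square)
      then show ?thesis by (simp only: sum_distrib_left[symmetric] mult.assoc[symmetric] cc[unfolded mult.assoc[symmetric]])
    qed
    show "Ft t x = \<beta> * (\<Sum>i\<in>UNIV. F2 i t x) + \<gamma> * (\<Sum>i\<in>UNIV. (F1 i t x)\<^sup>2)"
      unfolding sq Ft_def F2_def heat
      by (simp add: sum_distrib_left[symmetric] sum_subtractf sum_divide_distrib[symmetric] algebra_simps)
  next
    fix \<alpha> \<omega> :: real assume \<alpha>: "0 < \<alpha>" "\<alpha> \<le> \<omega>"
    show "\<exists>M\<ge>0. \<forall>t x i. \<alpha> \<le> t \<longrightarrow> t \<le> \<omega> \<longrightarrow> \<bar>F1 i t x\<bar> \<le> M \<and> \<bar>F2 i t x\<bar> \<le> M \<and>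
      \<bar>F3 i t x\<bar> \<le> M \<and> \<bar>Ft t x\<bar> \<le> M \<and> \<bar>Ftt t x\<bar> \<le> M"
      by (rule bounds[OF \<alpha>])
  qed
  then show "\<exists>Ft Ftt F1 F2 F3 C \<tau>. smooth_flow \<beta> \<gamma> g (\<lambda>t x. \<beta> / \<gamma> * ln (kernel_conv (heat_fun \<beta>) G (t, x)))
      Ft Ftt F1 F2 F3 L C \<tau>"
    unfolding U_def u_def c_def by blast
qed

section \<open>The three scaling limits\<close>

theorem theorem1p1:
  fixes \<phi> :: "real ^ ('n::finite) stencil \<Rightarrow> real"
    and g :: "real ^ 'n \<Rightarrow> real"
    and b :: "'n stencil"
    and L \<beta> \<gamma> :: real
  assumes "shift_equivariant \<phi>"
    and "mono \<phi>"
    and "lattice_symmetric \<phi>"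
    and "C_k 2 \<phi> UNIV"
    and "L-lipschitz_on UNIV g"
    and "b \<in> nonzero_stencil"
    and "\<beta> = beta \<phi> b"
    and "\<gamma> = gamma \<phi> b"
  shows
    "(\<beta> \<noteq> 0 \<and> \<gamma> \<noteq> 0 \<longrightarrow>
       (\<exists>f :: real \<Rightarrow> real ^ 'n \<Rightarrow> real.
          (\<forall>t\<ge>0. \<forall>x. ((\<lambda>\<epsilon>. rescaled_surface \<phi> g \<epsilon> t x) \<longlongrightarrow> f t x) (at_right 0)) \<and>
          (\<forall>x. f 0 x = g x) \<and>
          (\<forall>t>0. \<forall>x.
             integrable lborel (\<lambda>y. heat_kernel \<beta> t (x - y) * exp (\<gamma> * g y / \<beta>)) \<and>
             f t x = \<beta> / \<gamma> * ln (LINT y|lborel. heat_kernel \<beta> t (x - y) * exp (\<gamma> * g y / \<beta>))) \<and>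
          continuous_on ({0..} \<times> UNIV) (\<lambda>(t, x). f t x) \<and>
          C_infinity (\<lambda>(t, x). f t x) ({0<..} \<times> UNIV) \<and>
          (\<forall>t>0. \<forall>x. ((\<lambda>s. f s x) has_real_derivative
             (\<beta> * laplacian (f t) x + \<gamma> * (norm (grad (f t) x))\<^sup>2)) (at t)))) \<and>
     (\<beta> \<noteq> 0 \<and> \<gamma> = 0 \<longrightarrow>
       (\<exists>f :: real \<Rightarrow> real ^ 'n \<Rightarrow> real.
          (\<forall>t\<ge>0. \<forall>x. ((\<lambda>\<epsilon>. rescaled_surface \<phi> g \<epsilon> t x) \<longlongrightarrow> f t x) (at_right 0)) \<and>
          (\<forall>x. f 0 x = g x) \<and>
          (\<forall>t>0. \<forall>x.
             integrable lborel (\<lambda>y. heat_kernel \<beta> t (x - y) * g y) \<and>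
             f t x = (LINT y|lborel. heat_kernel \<beta> t (x - y) * g y)) \<and>
          continuous_on ({0..} \<times> UNIV) (\<lambda>(t, x). f t x) \<and>
          C_infinity (\<lambda>(t, x). f t x) ({0<..} \<times> UNIV) \<and>
          (\<forall>t>0. \<forall>x. ((\<lambda>s. f s x) has_real_derivative \<beta> * laplacian (f t) x) (at t)))) \<and>
     (\<beta> = 0 \<longrightarrow>
       \<gamma> = 0 \<and>
       (\<forall>t\<ge>0. \<forall>x. ((\<lambda>\<epsilon>. rescaled_surface \<phi> g \<epsilon> t x) \<longlongrightarrow> g x) (at_right 0)))"
proof -
  note shift = assms(1) and mono = assms(2) and sym = assms(3) and C2 = assms(4) and lip = assms(5) and b = assms(6)
  \<comment> \<open>Monotonicity fixes the sign, so a nonzero \<open>\<beta>\<close> is a genuine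
    diffusion coefficient and the heat kernel is a probability density at positive times.\<close>
  have "beta \<phi> b \<ge> 0"
    unfolding beta_def using C2 by (intro partial_deriv_nonneg_if_mono mono) (simp add: numeral_2_eq_2)
  then have \<beta>_pos: "\<beta> > 0" if "\<beta> \<noteq> 0" using that assms(7) by simp
  have kpz: "\<exists>f :: real \<Rightarrow> real ^ 'n \<Rightarrow> real.
          (\<forall>t\<ge>0. \<forall>x. ((\<lambda>\<epsilon>. rescaled_surface \<phi> g \<epsilon> t x) \<longlongrightarrow> f t x) (at_right 0)) \<and>
          (\<forall>x. f 0 x = g x) \<and>
          (\<forall>t>0. \<forall>x.
             integrable lborel (\<lambda>y. heat_kernel \<beta> t (x - y) * exp (\<gamma> * g y / \<beta>)) \<and>
             f t x = \<beta> / \<gamma> * ln (LINT y|lborel. heat_kernel \<beta> t (x - y) * exp (\<gamma> * g y / \<beta>))) \<and>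
          continuous_on ({0..} \<times> UNIV) (\<lambda>(t, x). f t x) \<and>
          C_infinity (\<lambda>(t, x). f t x) ({0<..} \<times> UNIV) \<and>
          (\<forall>t>0. \<forall>x. ((\<lambda>s. f s x) has_real_derivative
             (\<beta> * laplacian (f t) x + \<gamma> * (norm (grad (f t) x))\<^sup>2)) (at t))"
    if nonzero: "\<beta> \<noteq> 0" "\<gamma> \<noteq> 0"
  proof -
    let ?G = "\<lambda>y. exp (\<gamma> * g y / \<beta>)"
    note \<beta> = \<beta>_pos[OF nonzero(1)]
    obtain Ft Ftt F1 F2 F3 C \<tau> where flow: "smooth_flow \<beta> \<gamma> g
        (\<lambda>t x. \<beta> / \<gamma> * ln (kernel_conv (heat_fun \<beta>) ?G (t, x))) Ft Ftt F1 F2 F3 L C \<tau>"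
      using kpz_flow(2)[OF \<beta> nonzero(2) lip] by blast
    interpret smooth_flow \<beta> \<gamma> g "\<lambda>t x. \<beta> / \<gamma> * ln (kernel_conv (heat_fun \<beta>) ?G (t, x))" Ft Ftt F1 F2 F3 L C \<tau>
      by (rule flow)
    show ?thesis
    proof (intro exI[of _ flow] conjI allI impI)
      show "((\<lambda>\<epsilon>. rescaled_surface \<phi> g \<epsilon> t x) \<longlongrightarrow> flow t x) (at_right 0)" if "t \<ge> 0" for t x
        by (rule rescaled_surface_tendsto_flow[OF shift mono sym C2 b assms(7,8) that])
      show "integrable lborel (\<lambda>y. heat_kernel \<beta> t (x - y) * ?G y)" if "t > 0" for t x
        using kernel_conv_integrable[OF \<beta> gaussian_kernels.heat that kpz_flow(1)[OF \<beta> nonzero(2) lip]] by simp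
      show "flow t x = \<beta> / \<gamma> * ln (LINT y|lborel. heat_kernel \<beta> t (x - y) * ?G y)" if "t > 0" for t x
        unfolding flow_def using that by (simp add: kernel_conv_def)
    qed (rule flow_initial flow_continuous flow_C_infinity flow_DERIV | assumption)+
  qed
  have heat: "\<exists>f :: real \<Rightarrow> real ^ 'n \<Rightarrow> real.
          (\<forall>t\<ge>0. \<forall>x. ((\<lambda>\<epsilon>. rescaled_surface \<phi> g \<epsilon> t x) \<longlongrightarrow> f t x) (at_right 0)) \<and>
          (\<forall>x. f 0 x = g x) \<and>
          (\<forall>t>0. \<forall>x.
             integrable lborel (\<lambda>y. heat_kernel \<beta> t (x - y) * g y) \<and>
             f t x = (LINT y|lborel. heat_kernel \<beta> t (x - y) * g y)) \<and>
          continuous_on ({0..} \<times> UNIV) (\<lambda>(t, x). f t x) \<and>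
          C_infinity (\<lambda>(t, x). f t x) ({0<..} \<times> UNIV) \<and>
          (\<forall>t>0. \<forall>x. ((\<lambda>s. f s x) has_real_derivative \<beta> * laplacian (f t) x) (at t))"
    if "\<beta> \<noteq> 0" "\<gamma> = 0"
  proof -
    note \<beta> = \<beta>_pos[OF that(1)]
    obtain C where flow: "smooth_flow \<beta> 0 g (\<lambda>t x. kernel_conv (heat_fun \<beta>) g (t, x))
      (\<lambda>t x. kernel_conv (heat_t \<beta>) g (t, x)) (\<lambda>t x. kernel_conv (heat_tt \<beta>) g (t, x))
      (\<lambda>i t x. kernel_conv (heat_x \<beta> i) g (t, x)) (\<lambda>i t x. kernel_conv (heat_xx \<beta> i) g (t, x))
      (\<lambda>i t x. kernel_conv (heat_xxx \<beta> i) g (t, x)) L C 1"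
      using heat_flow[OF \<beta> lip] by blast
    interpret smooth_flow \<beta> 0 g "\<lambda>t x. kernel_conv (heat_fun \<beta>) g (t, x)"
      "\<lambda>t x. kernel_conv (heat_t \<beta>) g (t, x)" "\<lambda>t x. kernel_conv (heat_tt \<beta>) g (t, x)"
      "\<lambda>i t x. kernel_conv (heat_x \<beta> i) g (t, x)" "\<lambda>i t x. kernel_conv (heat_xx \<beta> i) g (t, x)"
      "\<lambda>i t x. kernel_conv (heat_xxx \<beta> i) g (t, x)" L C 1
      by (rule flow)
    show ?thesis
    proof (intro exI[of _ flow] conjI allI impI)
      show "((\<lambda>\<epsilon>. rescaled_surface \<phi> g \<epsilon> t x) \<longlongrightarrow> flow t x) (at_right 0)" if "t \<ge> 0" for t x
        using rescaled_surface_tendsto_flow[OF shift mono sym C2 b assms(7) _ that] \<open>\<gamma> = 0\<close> assms(8) by simp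
      show "integrable lborel (\<lambda>y. heat_kernel \<beta> t (x - y) * g y)" if "t > 0" for t x
        using kernel_conv_integrable[OF \<beta> gaussian_kernels.heat that exp_bounded_lipschitz[OF lip]] by simp
      show "flow t x = (LINT y|lborel. heat_kernel \<beta> t (x - y) * g y)" if "t > 0" for t x
        unfolding flow_def using that by (simp add: kernel_conv_def)
      show "((\<lambda>s. flow s x) has_real_derivative \<beta> * laplacian (flow t) x) (at t)" if "t > 0" for t x
        using flow_DERIV[OF that, of x] by simp
    qed (rule flow_initial flow_continuous flow_C_infinity)+
  qed
  have degenerate: "\<gamma> = 0 \<and> (\<forall>t\<ge>0. \<forall>x. ((\<lambda>\<epsilon>. rescaled_surface \<phi> g \<epsilon> t x) \<longlongrightarrow> g x) (at_right 0))"
    if "\<beta> = 0"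
  proof -
    have \<gamma>: "\<gamma> = 0" using gamma_eq_0_if_beta_eq_0[OF mono sym C2 b] that assms(7,8) by simp
    \<comment> \<open>Heat flow with diffusion coefficient 1 provides the mollification of
      \<open>g\<close>.\<close>
    obtain C where flow: "smooth_flow 1 0 g (\<lambda>t x. kernel_conv (heat_fun 1) g (t, x))
      (\<lambda>t x. kernel_conv (heat_t 1) g (t, x)) (\<lambda>t x. kernel_conv (heat_tt 1) g (t, x))
      (\<lambda>i t x. kernel_conv (heat_x 1 i) g (t, x)) (\<lambda>i t x. kernel_conv (heat_xx 1 i) g (t, x))
      (\<lambda>i t x. kernel_conv (heat_xxx 1 i) g (t, x)) L C 1"
      using heat_flow[OF zero_less_one lip] by blast
    show ?thesis
      using \<gamma> that assms(7,8) smooth_flow.rescaled_surface_tendsto_initial[OF flow shift mono sym C2 b] by simp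
  qed
  show ?thesis using kpz heat degenerate by blast
qed

end
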